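(* Let $\{(\phi_k^*,\mathbf u_k^* )\}_{k\ge 0}$ be a sequence of discrete minimizing pairs generated by the adaptive algorithm described in the context. Let $\{\mathbf u_{k_j}^*\}_{j\ge 0}$ be a subsequence and $\overline{\mathbf u}\in\mathbf V$ such that $\mathbf u_{k_j}^*\to\overline{\mathbf u}$ weakly in $L^2(\Omega)^d$ and $\nabla_{k_j}\mathbf u_{k_j}^*\to\nabla\overline{\mathbf u}$ weakly in $L^2(\Omega)^{d\times d}$. Then the convergence is strong in $L^2(\Omega)^d$: $$\lim_{j\to\infty}\|\mathbf u_{k_j}^*-\overline{\mathbf u}\|_{L^2(\Omega)}=0.$$
   Context: Setting. Let $d\in\{2,3\}$, $\Omega\subset\mathbb R^d$ an open bounded domain with polygonal/polyhedral boundary, $\mu,\gamma,\varepsilon>0$, $\beta\in(0,1)$, $\mathbf f\in L^2(\Omega)^d$ (body force). Let $\alpha_\varepsilon\in C^1([0,1])$ take values in $[0,\overline\alpha_\varepsilon]$ with $\overline\alpha_\varepsilon>0$, and let the scalar potential $f$ be either $f(s)=\frac12 s(1-s)$ or $f(s)=\frac14 s^2(1-s)^2$. $(\cdot,\cdot)$ is the $L^2(\Omega)$ inner product of scalar, vector or matrix fields. The boundary velocity is zero. Put $\mathcal U=\{\phi\in H^1(\Omega):\ \phi\in[0,1]\text{ a.e.},\ \int_\Omega\phi\,dx\le\beta|\Omega|\}$ and $\mathbf V=\{\mathbf v\in H^1_0(\Omega)^d:\ \mathrm{div}\,\mathbf v=0\}$. Meshes. $\mathcal T_0$ is a shape-regular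 conforming triangulation of $\overline\Omega$ into closed triangles/tetrahedra; $\mathbb T$ is the set of all conforming triangulations obtained from $\mathcal T_0$ by successive (newest-vertex/Kossaczký type) bisections, for which the shape regularity is bounded uniformly by a constant depending only on $\mathcal T_0$. For $\mathcal T_k\in\mathbb T$, $\mathcal F_k$ (resp. $\mathcal F_k(\Omega)$) is the set of all (resp. interior) edges ($d=2$) / faces ($d=3$), $\mathbf n_F$ is a fixed unit normal to $F\in\mathcal F_k$ (pointing from $T_+$ to $T_-$ if $F=\partial T_+\cap\partial T_-$; outward if $F\subset\partial\Omega$), $h_T=|T|^{1/d}$, $h_F=|F|^{1/(d-1)}$. The jump is $[v]=v|_{T_+}-v|_{T_-}$ on interior $F$ and $[v]=v$ on $F\subset\partial\Omega$. $\nabla_k$, $\mathrm{div}_k$ denote the elementwise gradient and divergence over $\mathcal T_k$. Discrete spaces. $S_k\subset H^1(\Omega)$ is the space of continuous piecewise linear functions over $\mathcal T_k$ and $\mathcal U_k=S_k\cap\mathcal U$. $\mathbf Z_k$ is the Crouzeix–Raviart space of $\mathbf v\in L^2(\Omega)^d$ with $\mathbf v|_T\in P_1(T)^d$ for all $T\in\mathcal T_k$ and $\int_F[\mathbf v]\,ds=\mathbf 0$ for all $F\in\mathcal F_k$ (interior and boundary). $\mathbf V_k=\{\mathbf v\in\mathbf Z_k:\ \mathrm{div}_k\mathbf v=0\}$. Discrete problem. For $\phi_k\in\mathcal U_k$ let $\mathbf u_k=\mathbf u_k(\phi_k)\in\mathbf V_k$ be the unique solution of $\mu(\nabla_k\mathbf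 u_k,\nabla_k\mathbf v_k)+(\alpha_\varepsilon(\phi_k)\mathbf u_k,\mathbf v_k)=(\mathbf f,\mathbf v_k)$ for all $\mathbf v_k\in\mathbf V_k$. A discrete minimizing pair is $(\phi_k^*,\mathbf u_k^* )$ where $\phi_k^*\in\mathcal U_k$ minimizes over $\mathcal U_k$ $$\mathcal J_k^\varepsilon(\phi_k)=\tfrac12(\alpha_\varepsilon(\phi_k),|\mathbf u_k|^2)+\tfrac\mu2\|\nabla_k\mathbf u_k\|_{L^2(\Omega)}^2-(\mathbf f,\mathbf u_k)+\gamma\Big(\tfrac\varepsilon2\|\nabla\phi_k\|_{L^2(\Omega)}^2+\tfrac1\varepsilon\int_\Omega f(\phi_k)\,dx\Big)$$ and $\mathbf u_k^*=\mathbf u_k(\phi_k^* )$. Error indicators. For $T\in\mathcal T_k$, $$\eta_{k,1}^2(T)=h_T^2\big\|\tfrac\gamma\varepsilon f'(\phi_k^* )+\tfrac12\alpha_\varepsilon'(\phi_k^* )|\mathbf u_k^*|^2\big\|_{L^2(T)}^2+\sum_{F\subset\partial T}h_F\|J_{F,1}\|_{L^2(F)}^2,$$ with $J_{F,1}=\gamma\varepsilon[\nabla\phi_k^*]\cdot\mathbf n_F$ (so $\gamma\varepsilon\nabla\phi_k^*\cdot\mathbf n$ on boundary faces), and $$\eta_{k,2}^2(T)=h_T^2\|\alpha_\varepsilon(\phi_k^* )\mathbf u_k^*-\mathbf f\|_{L^2(T)}^2+\sum_{F\subset\partial T,\,F\in\mathcal F_k(\Omega)}\tfrac12h_F\|[\mathbf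 u_k^*]\|_{L^2(F)}^2+\sum_{F\subset\partial T\cap\partial\Omega}h_F\|\mathbf u_k^*\|_{L^2(F)}^2 .$$ Adaptive algorithm. Starting from $\mathcal T_0$, for $k=0,1,2,\dots$ (without termination): (i) compute a discrete minimizing pair $(\phi_k^*,\mathbf u_k^* )$ over $\mathcal T_k$; (ii) compute the indicators $\eta_{k,1}(T),\eta_{k,2}(T)$, $T\in\mathcal T_k$; (iii) choose $\mathcal M_k^1,\mathcal M_k^2\subseteq\mathcal T_k$ such that $\mathcal M_k^i$ contains at least one element $T_k^i$ with $\eta_{k,i}(T_k^i)=\max_{T\in\mathcal T_k}\eta_{k,i}(T)$, $i=1,2$, and set $\mathcal M_k=\mathcal M_k^1\cup\mathcal M_k^2$; (iv) refine each $T\in\mathcal M_k$ by bisection (and further elements as needed for conformity) to obtain $\mathcal T_{k+1}\in\mathbb T$. *)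

theory Defs
  imports "HOL-Analysis.Analysis"
begin

section \<open>Lebesgue and Sobolev spaces on \<open>\<Omega>\<close>\<close>

text \<open>Elements of function spaces are represented by concrete functions, to be read up to
  equality almost everywhere.  For matrix fields \<open>norm\<close> and \<open>\<bullet>\<close> are the Frobenius norm and inner
  product.\<close>

definition L2 :: "'a::euclidean_space set \<Rightarrow> ('a \<Rightarrow> 'b::euclidean_space) set" where
  "L2 S = {v. v \<in> borel_measurable (lebesgue_on S) \<and>
              integrable (lebesgue_on S) (\<lambda>x. (norm (v x))\<^sup>2)}"

definition l2_inner ::
    "'a::euclidean_space set \<Rightarrow> ('a \<Rightarrow> 'b::euclidean_space) \<Rightarrow> ('a \<Rightarrow> 'b) \<Rightarrow> real" where
  "l2_inner S v w = (\<integral>x. v x \<bullet> w x \<partial>lebesgue_on S)"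

definition l2_norm :: "'a::euclidean_space set \<Rightarrow> ('a \<Rightarrow> 'b::euclidean_space) \<Rightarrow> real" where
  "l2_norm S v = sqrt (\<integral>x. (norm (v x))\<^sup>2 \<partial>lebesgue_on S)"

definition l2_weakly_converges ::
    "'a::euclidean_space set \<Rightarrow> (nat \<Rightarrow> 'a \<Rightarrow> 'b::euclidean_space) \<Rightarrow> ('a \<Rightarrow> 'b) \<Rightarrow> bool" where
  "l2_weakly_converges S v w \<longleftrightarrow> (\<forall>n. v n \<in> L2 S) \<and> w \<in> L2 S \<and>
     (\<forall>z\<in>L2 S. (\<lambda>n. l2_inner S (v n) z) \<longlonglongrightarrow> l2_inner S w z)"

definition grad :: "(real^'d \<Rightarrow> real) \<Rightarrow> real^'d \<Rightarrow> real^'d" where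
  "grad v x = (\<chi> i. frechet_derivative v (at x) (axis i 1))"

text \<open>Entry \<open>(i, j)\<close> is the \<open>j\<close>-th partial derivative of the \<open>i\<close>-th component, so that the
  divergence is the trace.\<close>

definition jac :: "(real^'d \<Rightarrow> real^'d) \<Rightarrow> real^'d \<Rightarrow> real^'d^'d" where
  "jac v x = matrix (frechet_derivative v (at x))"

primrec Ck :: "nat \<Rightarrow> (real^'d \<Rightarrow> real) \<Rightarrow> bool" where
  "Ck 0 v \<longleftrightarrow> continuous_on UNIV v"
| "Ck (Suc k) v \<longleftrightarrow> (\<forall>x. v differentiable (at x)) \<and> (\<forall>i. Ck k (\<lambda>x. grad v x $ i))"

definition test_functions :: "(real^'d) set \<Rightarrow> (real^'d \<Rightarrow> real) set" where
  "test_functions \<Omega> = {\<psi>. (\<forall>k. Ck k \<psi>) \<and> compact (closure {x. \<psi> x \<noteq> 0}) \<and>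
                           closure {x. \<psi> x \<noteq> 0} \<subseteq> \<Omega>}"

definition weak_gradient ::
    "(real^'d) set \<Rightarrow> (real^'d \<Rightarrow> real) \<Rightarrow> (real^'d \<Rightarrow> real^'d) \<Rightarrow> bool" where
  "weak_gradient \<Omega> v g \<longleftrightarrow> v \<in> L2 \<Omega> \<and> g \<in> L2 \<Omega> \<and>
     (\<forall>\<psi>\<in>test_functions \<Omega>. \<forall>i.
        (\<integral>x. v x * grad \<psi> x $ i \<partial>lebesgue_on \<Omega>) = - (\<integral>x. g x $ i * \<psi> x \<partial>lebesgue_on \<Omega>))"

definition H1 :: "(real^'d) set \<Rightarrow> (real^'d \<Rightarrow> real) set" where
  "H1 \<Omega> = {v. \<exists>g. weak_gradient \<Omega> v g}"

text \<open>The closure of the test functions in \<open>H1\<close>.\<close>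

definition H10 :: "(real^'d) set \<Rightarrow> (real^'d \<Rightarrow> real) set" where
  "H10 \<Omega> = {v. \<exists>g \<psi>. weak_gradient \<Omega> v g \<and> (\<forall>n::nat. \<psi> n \<in> test_functions \<Omega>) \<and>
                 (\<lambda>n. l2_norm \<Omega> (\<lambda>x. v x - \<psi> n x)) \<longlonglongrightarrow> 0 \<and>
                 (\<lambda>n. l2_norm \<Omega> (\<lambda>x. g x - grad (\<psi> n) x)) \<longlonglongrightarrow> 0}"

definition weak_jacobian ::
    "(real^'d) set \<Rightarrow> (real^'d \<Rightarrow> real^'d) \<Rightarrow> (real^'d \<Rightarrow> real^'d^'d) \<Rightarrow> bool" where
  "weak_jacobian \<Omega> v G \<longleftrightarrow> (\<forall>i. weak_gradient \<Omega> (\<lambda>x. v x $ i) (\<lambda>x. G x $ i))"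

definition V_space :: "(real^'d) set \<Rightarrow> (real^'d \<Rightarrow> real^'d) set" where
  "V_space \<Omega> = {v. (\<forall>i. (\<lambda>x. v x $ i) \<in> H10 \<Omega>) \<and>
                   (\<exists>G. weak_jacobian \<Omega> v G \<and> (AE x in lebesgue_on \<Omega>. trace (G x) = 0))}"

definition U_space :: "(real^'d) set \<Rightarrow> real \<Rightarrow> (real^'d \<Rightarrow> real) set" where
  "U_space \<Omega> \<beta> = {\<phi>\<in>H1 \<Omega>. (AE x in lebesgue_on \<Omega>. \<phi> x \<in> {0..1}) \<and>
                     (\<integral>x. \<phi> x \<partial>lebesgue_on \<Omega>) \<le> \<beta> * measure lebesgue \<Omega>}"


section \<open>Domains, triangulations and bisection\<close>

definition polyhedral_domain :: "(real^'d) set \<Rightarrow> bool" where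
  "polyhedral_domain \<Omega> \<longleftrightarrow> open \<Omega> \<and> bounded \<Omega> \<and> connected \<Omega> \<and> \<Omega> \<noteq> {} \<and>
     (\<exists>P. finite P \<and> (\<forall>p\<in>P. polytope p \<and> aff_dim p = int CARD('d) - 1) \<and> frontier \<Omega> = \<Union>P)"

definition conforming_triangulation :: "(real^'d) set \<Rightarrow> (real^'d) set set \<Rightarrow> bool" where
  "conforming_triangulation \<Omega> \<T> \<longleftrightarrow>
     triangulation \<T> \<and> (\<forall>T\<in>\<T>. int CARD('d) simplex T) \<and> \<Union>\<T> = closure \<Omega>"

text \<open>Newest-vertex bisection in two dimensions and Kossaczky's bisection in three dimensions, in
  their common formulation by tagged simplices: a simplex is given by an ordered list of vertices
  \<open>z\<^sub>0, \<dots>, z\<^sub>d\<close> and a type \<open>t < d\<close>; its refinement edge joins \<open>z\<^sub>0\<close> and \<open>z\<^sub>d\<close>.  With \<open>m\<close> the midpoint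
  of that edge, the children are
    \<open>(z\<^sub>0, m, z\<^sub>1, \<dots>, z\<^sub>t, z\<^sub>t\<^sub>+\<^sub>1, \<dots>, z\<^sub>d\<^sub>-\<^sub>1)\<close> and \<open>(z\<^sub>d, m, z\<^sub>1, \<dots>, z\<^sub>t, z\<^sub>d\<^sub>-\<^sub>1, \<dots>, z\<^sub>t\<^sub>+\<^sub>1)\<close>,
  both of type \<open>(t + 1) mod d\<close>.  For \<open>d = 2\<close> the type does not affect the vertices of the children, and the
  vertex opposite the refinement edge of a child is the new vertex \<open>m\<close>.\<close>

type_synonym 'd tagged_simplex = "(real^'d) list \<times> nat"

definition element_of :: "'d::finite tagged_simplex \<Rightarrow> (real^'d) set" where
  "element_of S = convex hull (set (fst S))"

definition elements :: "'d::finite tagged_simplex set \<Rightarrow> (real^'d) set set" where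
  "elements G = element_of ` G"

fun bisect :: "'d::finite tagged_simplex \<Rightarrow> 'd tagged_simplex set" where
  "bisect (zs, t) =
     (let m = midpoint (hd zs) (last zs);
          inner = butlast (tl zs);
          t' = Suc t mod CARD('d)
      in {(hd zs # m # inner, t'), (last zs # m # take t inner @ rev (drop t inner), t')})"

inductive bisection_step ::
    "'d::finite tagged_simplex set \<Rightarrow> 'd tagged_simplex set \<Rightarrow> bool" where
  "S \<in> G \<Longrightarrow> bisection_step G ((G - {S}) \<union> bisect S)"

text \<open>The initial triangulation may be tagged arbitrarily.  Meshes occurring between the two ends
  of a sequence of bisections need not be conforming.\<close>

definition initial_mesh :: "(real^'d) set \<Rightarrow> 'd::finite tagged_simplex set \<Rightarrow> bool" where
  "initial_mesh \<Omega> G \<longleftrightarrow> conforming_triangulation \<Omega> (elements G) \<and> inj_on element_of G \<and>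
     (\<forall>(zs, t)\<in>G. length zs = CARD('d) + 1 \<and> t < CARD('d))"

definition refinements ::
    "(real^'d) set \<Rightarrow> 'd::finite tagged_simplex set \<Rightarrow> 'd tagged_simplex set set" where
  "refinements \<Omega> G = {G'. bisection_step\<^sup>*\<^sup>* G G' \<and> conforming_triangulation \<Omega> (elements G')}"


section \<open>Faces, surface integrals, traces and jumps\<close>

text \<open>A face \<open>F\<close> is flat, so its \<open>(d - 1)\<close>-dimensional measure is the \<open>d\<close>-dimensional Lebesgue
  measure of the slab of unit thickness erected orthogonally over \<open>F\<close>; by Fubini, surface
  integrals over \<open>F\<close> are integrals over this slab of the integrand extended constantly in the
  normal direction.\<close>

definition face_proj :: "(real^'d) set \<Rightarrow> real^'d \<Rightarrow> real^'d" where
  "face_proj F = closest_point (affine hull F)"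

definition face_slab :: "(real^'d) set \<Rightarrow> (real^'d) set" where
  "face_slab F = {x. face_proj F x \<in> F \<and> dist x (face_proj F x) \<le> 1/2}"

definition face_integral :: "(real^'d) set \<Rightarrow> (real^'d \<Rightarrow> 'b::euclidean_space) \<Rightarrow> 'b" where
  "face_integral F g = (\<integral>x. g (face_proj F x) \<partial>lebesgue_on (face_slab F))"

definition face_measure :: "(real^'d) set \<Rightarrow> real" where
  "face_measure F = measure lebesgue (face_slab F)"

definition h_elem :: "(real^'d) set \<Rightarrow> real" where
  "h_elem T = measure lebesgue T powr (1 / real CARD('d))"

definition h_face :: "(real^'d) set \<Rightarrow> real" where
  "h_face F = face_measure F powr (1 / (real CARD('d) - 1))"

text \<open>\<open>v|\<^sub>T\<close> on the boundary of \<open>T\<close>, as the limit from the interior of \<open>T\<close>; the values that a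
  piecewise defined \<open>v\<close> takes on the mesh skeleton itself are immaterial.\<close>

definition trace_from ::
    "(real^'d) set \<Rightarrow> (real^'d \<Rightarrow> 'b::euclidean_space) \<Rightarrow> real^'d \<Rightarrow> 'b" where
  "trace_from T v x = Lim (at x within interior T) v"

definition neighbour :: "(real^'d) set set \<Rightarrow> (real^'d) set \<Rightarrow> (real^'d) set \<Rightarrow> (real^'d) set" where
  "neighbour \<T> T F = (THE T'. T' \<in> \<T> \<and> T' \<noteq> T \<and> F facet_of T')"

text \<open>The jump across a facet \<open>F\<close> of \<open>T\<close>, and the unit normal of \<open>F\<close>, in the orientation with
  \<open>T\<^sub>+ = T\<close>.  The opposite orientation changes the sign of both, so the vanishing of a mean jump,
  norms of jumps, and products of a jump with the normal do not depend on it.\<close>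

definition jump ::
    "(real^'d) set \<Rightarrow> (real^'d) set set \<Rightarrow> (real^'d) set \<Rightarrow> (real^'d) set \<Rightarrow>
     (real^'d \<Rightarrow> 'b::euclidean_space) \<Rightarrow> real^'d \<Rightarrow> 'b" where
  "jump \<Omega> \<T> T F v x =
     (if F \<subseteq> frontier \<Omega> then trace_from T v x
      else trace_from T v x - trace_from (neighbour \<T> T F) v x)"

definition face_normal :: "(real^'d) set \<Rightarrow> (real^'d) set \<Rightarrow> real^'d" where
  "face_normal T F = (THE n. norm n = 1 \<and> (\<forall>x\<in>F. \<forall>y\<in>F. n \<bullet> (y - x) = 0) \<and>
                             (\<forall>x\<in>F. \<forall>y\<in>T. n \<bullet> (y - x) \<le> 0))"


section \<open>Discrete spaces and the discrete problem\<close>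

definition P1_on :: "'a::euclidean_space set \<Rightarrow> ('a \<Rightarrow> 'b::euclidean_space) \<Rightarrow> bool" where
  "P1_on A v \<longleftrightarrow> (\<exists>L c. linear L \<and> (\<forall>x\<in>A. v x = L x + c))"

definition S_space :: "(real^'d) set \<Rightarrow> (real^'d) set set \<Rightarrow> (real^'d \<Rightarrow> real) set" where
  "S_space \<Omega> \<T> = {\<phi>. continuous_on (closure \<Omega>) \<phi> \<and> (\<forall>T\<in>\<T>. P1_on T \<phi>)}"

definition Uk_space :: "(real^'d) set \<Rightarrow> real \<Rightarrow> (real^'d) set set \<Rightarrow> (real^'d \<Rightarrow> real) set" where
  "Uk_space \<Omega> \<beta> \<T> = S_space \<Omega> \<T> \<inter> U_space \<Omega> \<beta>"

definition CR_space :: "(real^'d) set \<Rightarrow> (real^'d) set set \<Rightarrow> (real^'d \<Rightarrow> real^'d) set" where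
  "CR_space \<Omega> \<T> = {v\<in>L2 \<Omega>. (\<forall>T\<in>\<T>. P1_on (interior T) v) \<and>
                     (\<forall>T\<in>\<T>. \<forall>F. F facet_of T \<longrightarrow> face_integral F (jump \<Omega> \<T> T F v) = 0)}"

text \<open>On discrete functions, the pointwise derivatives \<open>grad\<close> and \<open>jac\<close>, taken in the interiors
  of the elements, are the elementwise ones; for \<open>\<phi>\<close> in \<open>S_space\<close>, \<open>grad \<phi>\<close> is almost everywhere
  the weak gradient.\<close>

definition Vk_space :: "(real^'d) set \<Rightarrow> (real^'d) set set \<Rightarrow> (real^'d \<Rightarrow> real^'d) set" where
  "Vk_space \<Omega> \<T> = {v\<in>CR_space \<Omega> \<T>. \<forall>T\<in>\<T>. \<forall>x\<in>interior T. trace (jac v x) = 0}"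

definition discrete_velocity ::
    "(real^'d) set \<Rightarrow> real \<Rightarrow> (real \<Rightarrow> real) \<Rightarrow> (real^'d \<Rightarrow> real^'d) \<Rightarrow> (real^'d) set set \<Rightarrow>
     (real^'d \<Rightarrow> real) \<Rightarrow> (real^'d \<Rightarrow> real^'d) \<Rightarrow> bool" where
  "discrete_velocity \<Omega> \<mu> \<alpha> body \<T> \<phi> u \<longleftrightarrow> u \<in> Vk_space \<Omega> \<T> \<and>
     (\<forall>v\<in>Vk_space \<Omega> \<T>. \<mu> * l2_inner \<Omega> (jac u) (jac v)
                        + l2_inner \<Omega> (\<lambda>x. \<alpha> (\<phi> x) *\<^sub>R u x) v = l2_inner \<Omega> body v)"

definition objective ::
    "(real^'d) set \<Rightarrow> real \<Rightarrow> real \<Rightarrow> real \<Rightarrow> (real \<Rightarrow> real) \<Rightarrow> (real \<Rightarrow> real) \<Rightarrow>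
     (real^'d \<Rightarrow> real^'d) \<Rightarrow> (real^'d \<Rightarrow> real) \<Rightarrow> (real^'d \<Rightarrow> real^'d) \<Rightarrow> real" where
  "objective \<Omega> \<mu> \<gamma> \<epsilon> \<alpha> f body \<phi> u =
     1/2 * l2_inner \<Omega> (\<lambda>x. \<alpha> (\<phi> x)) (\<lambda>x. (norm (u x))\<^sup>2)
     + \<mu>/2 * (l2_norm \<Omega> (jac u))\<^sup>2 - l2_inner \<Omega> body u
     + \<gamma> * (\<epsilon>/2 * (l2_norm \<Omega> (grad \<phi>))\<^sup>2 + 1/\<epsilon> * (\<integral>x. f (\<phi> x) \<partial>lebesgue_on \<Omega>))"

definition discrete_minimizing_pair ::
    "(real^'d) set \<Rightarrow> real \<Rightarrow> real \<Rightarrow> real \<Rightarrow> real \<Rightarrow> (real \<Rightarrow> real) \<Rightarrow> (real \<Rightarrow> real) \<Rightarrow>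
     (real^'d \<Rightarrow> real^'d) \<Rightarrow> (real^'d) set set \<Rightarrow> (real^'d \<Rightarrow> real) \<Rightarrow> (real^'d \<Rightarrow> real^'d) \<Rightarrow> bool"
  where
  "discrete_minimizing_pair \<Omega> \<mu> \<gamma> \<epsilon> \<beta> \<alpha> f body \<T> \<phi> u \<longleftrightarrow>
     \<phi> \<in> Uk_space \<Omega> \<beta> \<T> \<and> discrete_velocity \<Omega> \<mu> \<alpha> body \<T> \<phi> u \<and>
     (\<forall>\<phi>'\<in>Uk_space \<Omega> \<beta> \<T>. \<forall>u'. discrete_velocity \<Omega> \<mu> \<alpha> body \<T> \<phi>' u' \<longrightarrow>
        objective \<Omega> \<mu> \<gamma> \<epsilon> \<alpha> f body \<phi> u \<le> objective \<Omega> \<mu> \<gamma> \<epsilon> \<alpha> f body \<phi>' u')"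


section \<open>Error indicators and the adaptive algorithm\<close>

definition eta1 ::
    "(real^'d) set \<Rightarrow> real \<Rightarrow> real \<Rightarrow> (real \<Rightarrow> real) \<Rightarrow> (real \<Rightarrow> real) \<Rightarrow> (real^'d) set set \<Rightarrow>
     (real^'d \<Rightarrow> real) \<Rightarrow> (real^'d \<Rightarrow> real^'d) \<Rightarrow> (real^'d) set \<Rightarrow> real" where
  "eta1 \<Omega> \<gamma> \<epsilon> d\<alpha> f \<T> \<phi> u T = sqrt
     ((h_elem T)\<^sup>2
        * (l2_norm T (\<lambda>x. \<gamma>/\<epsilon> * deriv f (\<phi> x) + 1/2 * d\<alpha> (\<phi> x) * (norm (u x))\<^sup>2))\<^sup>2
      + (\<Sum>F | F facet_of T. h_face F *
           face_integral F (\<lambda>x. (\<gamma> * \<epsilon> * (jump \<Omega> \<T> T F (grad \<phi>) x \<bullet> face_normal T F))\<^sup>2)))"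

definition eta2 ::
    "(real^'d) set \<Rightarrow> (real \<Rightarrow> real) \<Rightarrow> (real^'d \<Rightarrow> real^'d) \<Rightarrow> (real^'d) set set \<Rightarrow>
     (real^'d \<Rightarrow> real) \<Rightarrow> (real^'d \<Rightarrow> real^'d) \<Rightarrow> (real^'d) set \<Rightarrow> real" where
  "eta2 \<Omega> \<alpha> body \<T> \<phi> u T = sqrt
     ((h_elem T)\<^sup>2 * (l2_norm T (\<lambda>x. \<alpha> (\<phi> x) *\<^sub>R u x - body x))\<^sup>2
      + (\<Sum>F | F facet_of T \<and> \<not> F \<subseteq> frontier \<Omega>.
           1/2 * h_face F * face_integral F (\<lambda>x. (norm (jump \<Omega> \<T> T F u x))\<^sup>2))
      + (\<Sum>F | F facet_of T \<and> F \<subseteq> frontier \<Omega>.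
           h_face F * face_integral F (\<lambda>x. (norm (trace_from T u x))\<^sup>2)))"

definition marking :: "(real^'d) set set \<Rightarrow> ((real^'d) set \<Rightarrow> real) \<Rightarrow> (real^'d) set set \<Rightarrow> bool" where
  "marking \<T> \<eta> M \<longleftrightarrow> M \<subseteq> \<T> \<and> (\<exists>T\<in>M. \<eta> T = Max (\<eta> ` \<T>))"

text \<open>\<open>G k\<close> is the \<open>k\<close>-th mesh with its tags, \<open>elements (G k)\<close> the triangulation itself.  As the
  bisections only ever replace simplices by smaller ones, an element is refined in the \<open>k\<close>-th step
  iff it no longer belongs to the next triangulation.\<close>

definition adaptive_sequence ::
    "(real^'d) set \<Rightarrow> real \<Rightarrow> real \<Rightarrow> real \<Rightarrow> real \<Rightarrow> (real \<Rightarrow> real) \<Rightarrow> (real \<Rightarrow> real) \<Rightarrow>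
     (real \<Rightarrow> real) \<Rightarrow> (real^'d \<Rightarrow> real^'d) \<Rightarrow> (nat \<Rightarrow> 'd::finite tagged_simplex set) \<Rightarrow>
     (nat \<Rightarrow> real^'d \<Rightarrow> real) \<Rightarrow> (nat \<Rightarrow> real^'d \<Rightarrow> real^'d) \<Rightarrow> bool" where
  "adaptive_sequence \<Omega> \<mu> \<gamma> \<epsilon> \<beta> \<alpha> d\<alpha> f body G \<phi> u \<longleftrightarrow>
     initial_mesh \<Omega> (G 0) \<and>
     (\<forall>k. discrete_minimizing_pair \<Omega> \<mu> \<gamma> \<epsilon> \<beta> \<alpha> f body (elements (G k)) (\<phi> k) (u k) \<and>
       (\<exists>M1 M2.
          marking (elements (G k)) (eta1 \<Omega> \<gamma> \<epsilon> d\<alpha> f (elements (G k)) (\<phi> k) (u k)) M1 \<and>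
          marking (elements (G k)) (eta2 \<Omega> \<alpha> body (elements (G k)) (\<phi> k) (u k)) M2 \<and>
          G (Suc k) \<in> refinements \<Omega> (G k) \<and>
          (M1 \<union> M2) \<inter> elements (G (Suc k)) = {}))"

end

theory Submission
  imports Defs
begin

text \<open>
  The functions are extended by zero to the whole space.  A Crouzeix--Raviart function \<open>v\<close> has, on
  every facet \<open>F\<close>, componentwise a root of its jump, so the jump is at most \<open>diam F\<close> times the gradients
  on both sides; likewise for the traces on boundary facets.  Applying this to \<open>\<psi>(v)\<close> with
  \<open>\<psi>(s) = s |s|\<close>, the jump of \<open>\<psi>(v)\<close> is at most \<open>diam F\<close> times gradients times values, and by shape regularity
  the total variation of \<open>\<psi>(v)\<close> along lines is controlled by \<open>\<theta> \<parallel>v\<parallel>\<^sup>2 + \<parallel>\<nabla>v\<parallel>\<^sup>2 / \<theta>\<close> for every \<open>\<theta> > 0\<close>.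
  Since \<open>|s - t|\<^sup>2 \<le> 2 |\<psi>(s) - \<psi>(t)|\<close>, this is an \<open>L\<^sup>2\<close> translation estimate that is uniform in the
  mesh, whatever the local mesh sizes; a translation by more than the diameter of the domain and a
  small \<open>\<theta>\<close> give the discrete Poincare inequality.  Testing the discrete problem with its own
  solution bounds the gradients.  Comparing with averages over small cubes, which converge by weak convergence, the translation
  estimate yields \<open>limsup \<parallel>u\<^sub>k\<parallel> \<le> \<parallel>u\<parallel>\<close>, and together with weak convergence this is strong convergence.
\<close>

section \<open>Shape regularity of bisected simplices\<close>

text \<open>Adaptive meshes need not become fine everywhere, so nothing can be gained from h tending
  to 0. Bounding differences of v itself would mean squaring a sum of jumps along a line, hence
  knowing how many elements of which size a single line crosses. Differences of v |v| are additive
  over the crossings and already quadratic in v, so it is enough to average over all parallel lines: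
  a facet of diameter D is hit from a set of starting points of measure of order t D^(d-1), and its
  jump carries a factor D, so that t D^d, that is t times the volume of an element, remains and the
  mesh size cancels. The role of the Poincare inequality is to remove the norm of v from the
  translation estimate. The gradients are bounded through the pairings of the solutions with the
  force, which converge and hence are bounded.\<close>

lemma midpoint_diff:
  fixes x y z :: "'a::real_vector"
  shows "midpoint x y - x = (1/2) *\<^sub>R (y - x)"
    and "midpoint x y - y = (1/2) *\<^sub>R (x - y)"
    and "midpoint x y - midpoint x z = (1/2) *\<^sub>R (y - z)"
    and "midpoint x y - midpoint y z = (1/2) *\<^sub>R (x - z)"
  using scaleR_left_distrib[of "1/2" "1/2" x] scaleR_left_distrib[of "1/2" "1/2" y]
  by (simp_all add: midpoint_def algebra_simps)

text \<open>Both simplices are images under x to a + f x, where f sends the unit vectors to the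
  edges at \<open>a\<close>: one of the standard simplex, the other of its image under the stretch
  by 1/2 in one coordinate. The determinant of that stretch is the factor 1/2.\<close>

lemma measure_convex_hull_midpoint_wellorder:
  fixes a b :: "real^'n::{finite,wellorder}"
  assumes "length ws + 1 = CARD('n)"
  shows "measure lebesgue (convex hull (insert a (insert (midpoint a b) (set ws))))
       = measure lebesgue (convex hull (insert a (insert b (set ws)))) / 2"
proof -
  \<comment> \<open>\<open>h\<close> numbers the coordinates; the coordinate \<open>k\<close> with
    number 0 is the one sent to the edge towards \<open>b\<close>.\<close>
  obtain h :: "'n::_ \<Rightarrow> nat" where h: "bij_betw h UNIV {..<CARD('n)}"
    using ex_bij_betw_finite_nat[of "UNIV::'n::_ set"] by (auto simp: atLeast0LessThan)
  define f where "f x = (\<Sum>i\<in>UNIV. x $ i *\<^sub>R ((b # ws) ! h i - a))" for x :: "real^'n::_"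
  have lf: "linear f"
    unfolding f_def by (intro linearI) (simp_all add: scaleR_left_distrib sum.distrib scaleR_sum_right)
  have f_axis: "f (axis i c) = c *\<^sub>R ((b # ws) ! h i - a)" for i c
  proof -
    have "f (axis i c) = (\<Sum>j\<in>UNIV. if j = i then c *\<^sub>R ((b # ws) ! h j - a) else 0)"
      unfolding f_def by (intro sum.cong) (auto simp: axis_def)
    then show ?thesis by simp
  qed
  have "0 \<in> h ` UNIV" using h unfolding bij_betw_def by simp
  then obtain k where k: "h k = 0" by (metis imageE)
  have hpos: "i \<noteq> k \<Longrightarrow> h i \<noteq> 0" for i
    using h k unfolding bij_betw_def inj_on_def by force
  have rng: "(\<lambda>i. ws ! (h i - 1)) ` (UNIV - {k}) = set ws"
  proof -
    have "h ` (UNIV - {k}) = {..<CARD('n)} - {0}"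
      using h k unfolding bij_betw_def by (subst inj_on_image_set_diff[of h UNIV]) auto
    then have "(\<lambda>n. n - 1) ` h ` (UNIV - {k}) = (\<lambda>n. n - 1) ` ({..<CARD('n)} - {0})"
      by (rule arg_cong)
    then have "(\<lambda>i. h i - 1) ` (UNIV - {k}) = (\<lambda>n. n - 1) ` ({..<CARD('n)} - {0})"
      by (simp only: image_image)
    also have "\<dots> = {..<length ws}"
      using assms by (auto simp: image_iff intro!: bexI[of _ "Suc _"])
    finally have "(\<lambda>i. h i - 1) ` (UNIV - {k}) = {..<length ws}" .
    then have "(!) ws ` (\<lambda>i. h i - 1) ` (UNIV - {k}) = (!) ws ` {..<length ws}" by simp
    then show ?thesis by (auto simp: set_conv_nth image_image)
  qed
  define S :: "(real^'n::_) set" where "S = convex hull (insert 0 (range (\<lambda>i. axis i 1)))"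
  define s where "s x = (\<chi> i. (if i = k then 1/2 else 1) * x $ i)" for x :: "real^'n::_"
  have ls: "linear s"
    unfolding s_def by (intro linearI) (auto simp: vec_eq_iff algebra_simps)
  have s_axis: "s (axis i 1) = axis i (if i = k then 1/2 else 1)" for i
    unfolding s_def by (auto simp: vec_eq_iff axis_def)
  have Sm: "S \<in> lmeasurable"
    unfolding S_def by (intro lmeasurable_compact finite_imp_compact_convex_hull) simp
  have ssm: "s ` S \<in> lmeasurable"
    by (intro measurable_linear_image ls Sm)
  have gen: "convex hull (insert a (insert y (set ws))) = (+) a ` f ` (convex hull (insert 0 (insert z ((\<lambda>i. axis i 1) ` (UNIV - {k})))))"
    if "a + f z = y" for y z
  proof -
    have "(\<lambda>i. a + f (axis i 1)) ` (UNIV - {k}) = (\<lambda>i. ws ! (h i - 1)) ` (UNIV - {k})"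
      by (intro image_cong) (auto simp: f_axis hpos nth_Cons')
    then have "(\<lambda>i. a + f (axis i 1)) ` (UNIV - {k}) = set ws" by (simp only: rng)
    then have "(+) a ` f ` insert 0 (insert z ((\<lambda>i. axis i 1) ` (UNIV - {k}))) = insert a (insert y (set ws))"
      using that linear_0[OF lf] by (simp add: image_image)
    then show ?thesis
      by (simp only: convex_hull_linear_image[OF lf] convex_hull_translation[symmetric])
  qed
  have 1: "convex hull (insert a (insert b (set ws))) = (+) a ` f ` S"
  proof -
    have "range (\<lambda>i. axis i (1::real)) = insert (axis k 1) ((\<lambda>i. axis i 1) ` (UNIV - {k}))" by auto
    then show ?thesis
      unfolding S_def using gen[of "axis k 1" b] by (simp add: f_axis k)
  qed
  have sS: "s ` S = convex hull (insert 0 (insert (axis k (1/2)) ((\<lambda>i. axis i 1) ` (UNIV - {k}))))"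
  proof -
    have "(\<lambda>i. s (axis i 1)) ` (UNIV - {k}) = (\<lambda>i. axis i 1) ` (UNIV - {k})"
      by (intro image_cong) (auto simp: s_axis)
    moreover have "range (\<lambda>i. axis i (1::real)) = insert (axis k 1) ((\<lambda>i. axis i 1) ` (UNIV - {k}))" by auto
    ultimately show ?thesis unfolding S_def convex_hull_linear_image[OF ls]
      by (simp add: image_image s_axis linear_0[OF ls])
  qed
  have 2: "convex hull (insert a (insert (midpoint a b) (set ws))) = (+) a ` f ` s ` S"
    unfolding sS by (rule gen) (simp add: f_axis k flip: midpoint_diff(1))
  have "measure lebesgue (s ` S) = measure lebesgue S / 2"
    unfolding s_def by (subst measure_stretch[OF Sm]) (simp add: prod.remove[of _ k])
  then show ?thesis
    unfolding 1 2 measure_translation using measure_linear_image[OF lf Sm] measure_linear_image[OF lf ssm]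
    by simp
qed

lemma prod_Basis_cart:
  fixes v :: "real^'n"
  shows "(\<Prod>b\<in>Basis. v \<bullet> b) = (\<Prod>i\<in>UNIV. v $ i)"
proof -
  have B: "(Basis :: (real^'n) set) = range (\<lambda>i. axis i 1)" by (auto simp: Basis_vec_def)
  show ?thesis
    unfolding B by (subst prod.reindex) (auto simp: inj_on_def axis_eq_axis inner_axis)
qed

text \<open>The volume formula for linear images is available for well-ordered index types only; reindexing
  transports its consequences to \<open>'d\<close>.\<close>

lemma measure_reindex:
  fixes p :: "'n::finite \<Rightarrow> 'd::finite"
  assumes p: "bij p" and S: "compact S"
  shows "measure lebesgue ((\<lambda>x::real^'d. \<chi> i. x $ p i) ` S) = measure lebesgue S"
proof -
  define f where "f x = (\<chi> i. x $ p i)" for x :: "real^'d"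
  define g where "g x = (\<chi> i. x $ inv p i)" for x :: "real^'n"
  have lin: "linear f"
    unfolding f_def by (intro linearI) (auto simp: vec_eq_iff)
  have gf: "g (f x) = x" for x
    using p by (simp add: f_def g_def vec_eq_iff bij_is_surj surj_f_inv_f)
  have fm: "f \<in> borel_measurable borel"
    using lin by (intro borel_measurable_continuous_onI linear_continuous_on linear_conv_bounded_linear[THEN iffD1])
  \<comment> \<open>\<open>lborel\<close> is determined by its values on boxes, and relabelling
    coordinates maps a box to a box with the same side lengths.\<close>
  have "lborel = distr lborel borel f"
  proof (rule lborel_eqI)
    fix l u :: "real^'n" assume lu: "\<And>b. b \<in> Basis \<Longrightarrow> l \<bullet> b \<le> u \<bullet> b"
    have lu': "l $ i \<le> u $ i" for i
      using lu[of "axis i 1"] by (auto simp: Basis_vec_def inner_axis)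
    have "f -` box l u = box (g l) (g u)"
    proof -
      have "(\<forall>i. P (p i) i) \<longleftrightarrow> (\<forall>j. P j (inv p j))" for P
        using p bij_inv_eq_iff[OF p] by (metis (full_types))
      from this[of "\<lambda>j i. l $ i < x $ j \<and> x $ j < u $ i" for x]
      show ?thesis by (auto simp: mem_box_cart f_def g_def set_eq_iff)
    qed
    then have "emeasure (distr lborel borel f) (box l u) = emeasure lborel (box (g l) (g u))"
      using fm by (simp add: emeasure_distr)
    also have "\<dots> = (\<Prod>b\<in>Basis. (g u - g l) \<bullet> b)"
      by (rule emeasure_lborel_box) (auto simp: Basis_vec_def inner_axis g_def lu')
    also have "\<dots> = (\<Prod>b\<in>Basis. (u - l) \<bullet> b)"
      unfolding prod_Basis_cart g_def using prod.reindex_bij_betw[OF bij_imp_bij_inv[OF p], of "\<lambda>i. u $ i - l $ i"]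
      by simp
    finally show "emeasure (distr lborel borel f) (box l u) = ennreal (\<Prod>b\<in>Basis. (u - l) \<bullet> b)" .
  qed simp
  moreover have cf: "compact (f ` S)"
    using S lin by (intro compact_continuous_image linear_continuous_on linear_conv_bounded_linear[THEN iffD1])
  ultimately have "emeasure lborel (f ` S) = emeasure (distr lborel borel f) (f ` S)" by simp
  also have "\<dots> = emeasure lborel (f -` (f ` S))"
    using cf fm by (simp add: emeasure_distr borel_compact)
  also have "f -` (f ` S) = S"
    using inj_on_inverseI[of UNIV g f] gf by (simp add: inj_vimage_image_eq)
  finally have "measure lborel (f ` S) = measure lborel S"
    by (simp add: measure_def)
  then show ?thesis
    using S cf by (simp add: f_def measure_completion borel_compact)
qed

lemma measure_convex_hull_midpoint:
  fixes a b :: "real^'d"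
  assumes d: "CARD('d) \<in> {2, 3}" and len: "length ws + 1 = CARD('d)"
  shows "measure lebesgue (convex hull (insert a (insert (midpoint a b) (set ws))))
       = measure lebesgue (convex hull (insert a (insert b (set ws)))) / 2"
proof -
  have transport: ?thesis if p: "bij p" for p :: "'n::{finite,wellorder} \<Rightarrow> 'd"
  proof -
    define f where "f x = (\<chi> i. x $ p i)" for x :: "real^'d"
    have lin: "linear f"
      unfolding f_def by (intro linearI) (auto simp: vec_eq_iff)
    have card: "CARD('n) = CARD('d)" using p by (rule bij_betw_same_card)
    have m: "measure lebesgue (convex hull S) = measure lebesgue (convex hull (f ` S))" if "finite S" for S
      using measure_reindex[OF p finite_imp_compact_convex_hull[OF that]]
      by (simp add: f_def convex_hull_linear_image[OF lin, unfolded f_def])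
    have "f (midpoint a b) = midpoint (f a) (f b)"
      by (simp add: midpoint_def linear_add[OF lin] linear_scale[OF lin])
    then show ?thesis
      using measure_convex_hull_midpoint_wellorder[of "map f ws" "f a" "f b"] card len
      by (simp add: m)
  qed
  \<comment> \<open>The numeral types \<open>2\<close> and \<open>3\<close> are well-ordered, so one
    of them can serve as index type.\<close>
  show ?thesis
  proof (cases "CARD('d) = 2")
    case True
    then have "\<exists>p :: 2 \<Rightarrow> 'd. bij p"
      by (intro finite_same_card_bij) simp_all
    then show ?thesis using transport by blast
  next
    case False
    then have "\<exists>p :: 3 \<Rightarrow> 'd. bij p"
      using d by (intro finite_same_card_bij) simp_all
    then show ?thesis using transport by blast
  qed
qed

lemma simplex_interior_nonempty:
  fixes T :: "'a::euclidean_space set"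
  assumes "int DIM('a) simplex T"
  shows "interior T \<noteq> {}"
proof -
  have "T \<noteq> {}" using aff_dim_simplex[OF assms] aff_dim_empty_eq by force
  then have "rel_interior T \<noteq> {}"
    using convex_simplex[OF assms] by (simp add: rel_interior_eq_empty)
  then show ?thesis
    using aff_dim_simplex[OF assms] by (simp add: interior_rel_interior_gen)
qed

lemma measure_simplex_pos:
  fixes T :: "'a::euclidean_space set"
  assumes "int DIM('a) simplex T"
  shows "measure lebesgue T > 0"
proof -
  have "\<not> negligible T"
    using simplex_interior_nonempty[OF assms] convex_simplex[OF assms] by (simp add: negligible_convex_interior)
  moreover have "T \<in> lmeasurable"
    using compact_simplex[OF assms] by (rule lmeasurable_compact)
  ultimately show ?thesis
    by (simp add: negligible_iff_measure0 zero_less_measure_iff)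
qed

section \<open>An invariant of bisection that controls the shape\<close>

text \<open>For type \<open>0\<close> and whenever \<open>d = 2\<close>, \<open>frame_sq\<close> is the sum of the squared edges on the path \<open>z\<^sub>0, \<dots>, z\<^sub>d\<close>; these edges
  (up to signs and order) are halved by \<open>d\<close> successive bisections.  If \<open>d = 3\<close>, the other types are assigned the value of their
  descendants of type \<open>0\<close>.  With \<open>shape_weight\<close>, the quotient of \<open>frame_sq ^ d\<close> by the squared
  volume is the same for a simplex and its children.\<close>

fun frame_sq :: "'d::finite tagged_simplex \<Rightarrow> real" where
  "frame_sq (zs, t) =
     (if CARD('d) = 2 then (norm (zs!1 - zs!0))\<^sup>2 + (norm (zs!2 - zs!1))\<^sup>2
      else if t = 0 then (norm (zs!1 - zs!0))\<^sup>2 + (norm (zs!2 - zs!1))\<^sup>2 + (norm (zs!3 - zs!2))\<^sup>2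
      else if t = 1 then ((norm (zs!2 - zs!0))\<^sup>2 + (norm (zs!3 - zs!2))\<^sup>2) / 4
                           + (norm (zs!1 - midpoint (zs!0) (zs!3)))\<^sup>2
      else (norm (zs!3 - zs!0))\<^sup>2 / 4 + (norm (zs!1 - midpoint (zs!0) (zs!3)))\<^sup>2
             + (norm (zs!2 - zs!1))\<^sup>2)"

fun shape_weight :: "'d::finite tagged_simplex \<Rightarrow> real" where
  "shape_weight (zs, t) =
     (if CARD('d) = 2 \<or> t = 0 then 1 else if t = 1 then 16 else 4)"

definition tagged_ok :: "'d::finite tagged_simplex \<Rightarrow> bool" where
  "tagged_ok S \<longleftrightarrow> length (fst S) = CARD('d) + 1 \<and> snd S < CARD('d)"

lemma norm_midpoint_diff:
  fixes x y z :: "'a::real_normed_vector"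
  shows "norm (midpoint x y - x) = norm (y - x) / 2"
    and "norm (midpoint x y - y) = norm (y - x) / 2"
    and "norm (x - midpoint x y) = norm (y - x) / 2"
    and "norm (y - midpoint x y) = norm (y - x) / 2"
    and "norm (midpoint x y - midpoint x z) = norm (y - z) / 2"
    and "norm (midpoint x y - midpoint y z) = norm (z - x) / 2"
  by (simp_all only: norm_minus_commute[of _ "midpoint x y"] midpoint_diff norm_scaleR)
    (simp_all add: norm_minus_commute)

text \<open>The parallelogram law for the halves of two sides. For d = 2 it says that a child has
  half the \<open>frame_sq\<close> of its parent.\<close>

lemma apollonius_midpoint:
  fixes p q r :: "'a::real_inner"
  shows "(norm ((1/2) *\<^sub>R (r - p)))\<^sup>2 + (norm (q - midpoint p r))\<^sup>2
       = ((norm (q - p))\<^sup>2 + (norm (r - q))\<^sup>2) / 2"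
proof -
  define x where "x = (1/2) *\<^sub>R (q - p)"
  define y where "y = (1/2) *\<^sub>R (r - q)"
  have "r - p = 2 *\<^sub>R (x + y)" "q - p = 2 *\<^sub>R x" "r - q = 2 *\<^sub>R y"
    by (auto simp: x_def y_def scaleR_add_right)
  moreover have "q - midpoint p r = x - y"
    using scaleR_left_distrib[of "1/2" "1/2" q] by (simp add: x_def y_def midpoint_def algebra_simps)
  ultimately show ?thesis
    by (simp add: power_mult_distrib) (simp add: power2_norm_eq_inner inner_simps inner_commute)
qed

lemma list_of_length_3: "length zs = 3 \<Longrightarrow> \<exists>a b c. zs = [a, b, c]"
  by (auto simp: numeral_3_eq_3 length_Suc_conv)

lemma list_of_length_4: "length zs = 4 \<Longrightarrow> \<exists>a b c d. zs = [a, b, c, d]"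
  by (auto simp: eval_nat_numeral length_Suc_conv)

lemma bisect_tagged_ok:
  fixes S :: "'d::finite tagged_simplex"
  assumes "CARD('d) \<ge> 2" "tagged_ok S" "S' \<in> bisect S"
  shows "tagged_ok S'"
  using assms by (cases S) (auto simp: tagged_ok_def Let_def)

lemma measure_bisect:
  fixes S :: "'d::finite tagged_simplex"
  assumes d: "CARD('d) \<in> {2, 3}" and S: "tagged_ok S" "S' \<in> bisect S"
  shows "measure lebesgue (element_of S') = measure lebesgue (element_of S) / 2"
proof -
  obtain zs t where St: "S = (zs, t)" by (cases S)
  then have len: "length zs = CARD('d) + 1" using S by (simp add: tagged_ok_def)
  define ws where "ws = butlast (tl zs)"
  have lws: "length ws + 1 = CARD('d)" unfolding ws_def using len d by auto
  have d2: "CARD('d) \<ge> 2" using d by auto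
  have ne: "zs \<noteq> []" "tl zs \<noteq> []" using len d2 by (auto simp flip: length_greater_0_conv)
  have "zs = hd zs # ws @ [last zs]"
    unfolding ws_def using ne by (cases zs) (simp_all add: append_butlast_last_id)
  then have "set zs = set (hd zs # ws @ [last zs])" by (rule arg_cong)
  then have el: "element_of S = convex hull (insert (hd zs) (insert (last zs) (set ws)))"
    unfolding element_of_def St by simp
  have "set (take t ws @ rev (drop t ws)) = set ws"
    by (metis append_take_drop_id set_append set_rev)
  then have "element_of S' = convex hull (insert (hd zs) (insert (midpoint (hd zs) (last zs)) (set ws)))
    \<or> element_of S' = convex hull (insert (last zs) (insert (midpoint (last zs) (hd zs)) (set ws)))"
    using S(2) unfolding St element_of_def ws_def[symmetric] bisect.simps Let_def
    by (auto simp: ws_def[symmetric] midpoint_sym)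
  then show ?thesis
    using measure_convex_hull_midpoint[OF d lws, of "hd zs" "last zs"]
      measure_convex_hull_midpoint[OF d lws, of "last zs" "hd zs"]
    by (auto simp: el insert_commute)
qed

text \<open>The factor 1/4 matches the drop of the squared volume. For d = 2,
  \<open>frame_sq\<close> is halved and then squared. For d = 3, \<open>frame_sq\<close> is
  quartered in passing from type 0 to type 1 and constant in the two other passages, while the
  weights run through 1, 16, 4, 1; each passage gives 1/4.\<close>

lemma shape_bisect:
  fixes S :: "'d::finite tagged_simplex"
  assumes d: "CARD('d) \<in> {2, 3}" and S: "tagged_ok S" "S' \<in> bisect S"
  shows "shape_weight S' * frame_sq S' ^ CARD('d)
       = shape_weight S * frame_sq S ^ CARD('d) / 4"
proof -
  obtain zs t where St: "S = (zs, t)" by (cases S)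
  show ?thesis
  proof (cases "CARD('d) = 2")
    case True
    then have "length zs = 3" using S by (simp add: tagged_ok_def St)
    then obtain a b c where zs: "zs = [a, b, c]" using list_of_length_3 by blast
    have t: "t = 0 \<or> t = 1" using S True by (auto simp: tagged_ok_def St)
    have "\<exists>t'. S' = ([a, midpoint a c, b], t') \<or> S' = ([c, midpoint a c, b], t')"
      using S(2) t unfolding St zs by (auto simp: Let_def)
    then obtain t' where S': "S' = ([a, midpoint a c, b], t') \<or> S' = ([c, midpoint a c, b], t')" by blast
    have e: "norm (midpoint a c - a) = norm ((1/2) *\<^sub>R (c - a))" "norm (midpoint a c - c) = norm ((1/2) *\<^sub>R (c - a))"
      by (simp_all only: midpoint_diff) (simp add: norm_minus_commute)
    have "frame_sq S' = (norm ((1/2) *\<^sub>R (c - a)))\<^sup>2 + (norm (b - midpoint a c))\<^sup>2"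
      using S' by (elim disjE) (simp_all only: frame_sq.simps True if_True e nth_Cons_0 nth_Cons_Suc numeral_2_eq_2 One_nat_def simp_thms)
    also have "\<dots> = frame_sq S / 2"
      unfolding apollonius_midpoint by (simp add: St zs True)
    finally have "frame_sq S' = frame_sq S / 2" .
    moreover have "shape_weight S' = shape_weight S"
      using True by (cases S') (simp add: St)
    ultimately have *: "frame_sq S' = frame_sq S / 2" "shape_weight S' = shape_weight S"
      by auto
    show ?thesis unfolding * True by (simp add: power_divide)
  next
    case False
    then have d3: "CARD('d) = 3" using d by auto
    then have "length zs = 4" using S by (simp add: tagged_ok_def St)
    then obtain p q r s where zs: "zs = [p, q, r, s]" using list_of_length_4 by blast
    have "t < 3" using S d3 by (simp add: tagged_ok_def St)
    then consider "t = 0" | "t = 1" | "t = 2" by linarith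
    then show ?thesis
    proof cases
      case 1
      have "S' = ([p, midpoint p s, q, r], 1) \<or> S' = ([s, midpoint p s, r, q], 1)"
        using S(2) 1 d3 unfolding St zs by (auto simp: Let_def)
      then have q: "frame_sq S' = frame_sq S / 4"
        by (elim disjE)
          (simp_all add: St zs d3 1 norm_midpoint_diff power_divide
            norm_minus_commute)
      have w: "shape_weight S' = 16" "shape_weight S = 1"
        using S(2) 1 d3 by (auto simp: St Let_def)
      show ?thesis unfolding q w d3 by (simp add: power_divide)
    next
      case 2
      have "S' = ([p, midpoint p s, q, r], 2) \<or> S' = ([s, midpoint p s, q, r], 2)"
        using S(2) 2 d3 unfolding St zs by (auto simp: Let_def)
      then have q: "frame_sq S' = frame_sq S"
        by (elim disjE)
          (simp_all add: St zs d3 2 norm_midpoint_diff power_divide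
            norm_minus_commute)
      have w: "shape_weight S' = 4" "shape_weight S = 16"
        using S(2) 2 d3 by (auto simp: St Let_def)
      show ?thesis unfolding q w d3 by (simp add: power_divide)
    next
      case 3
      have "S' = ([p, midpoint p s, q, r], 0) \<or> S' = ([s, midpoint p s, q, r], 0)"
        using S(2) 3 d3 unfolding St zs by (auto simp: Let_def)
      then have q: "frame_sq S' = frame_sq S"
        by (elim disjE)
          (simp_all add: St zs d3 3 norm_midpoint_diff power_divide
            norm_minus_commute)
      have w: "shape_weight S' = 1" "shape_weight S = 4"
        using S(2) 3 d3 by (auto simp: St Let_def)
      show ?thesis unfolding q w d3 by (simp add: power_divide)
    qed
  qed
qed

lemma frame_sq_nonneg: "frame_sq S \<ge> 0"
  by (cases S) auto

lemma norm_le_via: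
  fixes x y :: "'a::real_normed_vector"
  assumes "norm (x - y) \<le> a" "norm (y - z) \<le> b" "a + b \<le> c"
  shows "norm (x - z) \<le> c"
  using norm_triangle_ineq[of "x - y" "y - z"] assms by simp

text \<open>Each summand of \<open>frame_sq\<close> bounds one link, and chaining the links puts
  every vertex within 4 Q of the first one; type 1, with two links of length up to 2 Q, is the
  extreme case. A ball of radius 4 Q has diameter 8 Q.\<close>

lemma diameter_shape:
  fixes S :: "'d::finite tagged_simplex"
  assumes d: "CARD('d) \<in> {2, 3}" and S: "tagged_ok S"
  shows "diameter (element_of S) \<le> 8 * sqrt (frame_sq S)"
proof -
  obtain zs t where St: "S = (zs, t)" by (cases S)
  define Q where "Q = sqrt (frame_sq S)"
  have Q2: "Q\<^sup>2 = frame_sq S" unfolding Q_def using frame_sq_nonneg by simp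
  have Q0: "Q \<ge> 0" unfolding Q_def using frame_sq_nonneg by simp
  have le: "norm x \<le> c * Q" if "(norm x)\<^sup>2 \<le> c\<^sup>2 * frame_sq S" "c \<ge> 0" for x :: "real^'d" and c
    by (rule power2_le_imp_le) (use that Q0 in \<open>auto simp: power_mult_distrib Q2\<close>)
  note le1 = le[of _ 1, simplified]
  have sub: "set zs \<subseteq> cball (zs!0) (4 * Q)"
  proof (cases "CARD('d) = 2")
    case True
    then have "length zs = 3" using S by (simp add: tagged_ok_def St)
    then obtain p q r where zs: "zs = [p, q, r]" using list_of_length_3 by blast
    have "norm (q - p) \<le> Q" "norm (r - q) \<le> Q"
      using True by (auto intro!: le1 simp: St zs)
    moreover from this have "norm (r - p) \<le> 2 * Q"
      using norm_le_via[of r q Q p Q "2 * Q"] Q0 by simp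
    ultimately show ?thesis using Q0 by (auto simp: zs dist_norm norm_minus_commute)
  next
    case False
    then have d3: "CARD('d) = 3" using d by auto
    then have "length zs = 4" using S by (simp add: tagged_ok_def St)
    then obtain p q r s where zs: "zs = [p, q, r, s]" using list_of_length_4 by blast
    have "t < 3" using S d3 by (simp add: tagged_ok_def St)
    then consider "t = 0" | "t = 1" | "t = 2" by linarith
    then have "norm (q - p) \<le> 4 * Q \<and> norm (r - p) \<le> 4 * Q \<and> norm (s - p) \<le> 4 * Q"
    proof cases
      case 1
      have a: "norm (q - p) \<le> Q" "norm (r - q) \<le> Q" "norm (s - r) \<le> Q"
        using d3 1 by (auto intro!: le1 simp: St zs)
      then have b: "norm (r - p) \<le> 2 * Q"
        using norm_le_via[of r q Q p Q "2 * Q"] Q0 by simp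
      then have "norm (s - p) \<le> 3 * Q" using a(3)
        using norm_le_via[of s r Q p "2 * Q" "3 * Q"] Q0 by simp
      then show ?thesis using a b Q0 by auto
    next
      case 2
      have a: "norm (r - p) \<le> 2 * Q" "norm (s - r) \<le> 2 * Q" "norm (q - midpoint p s) \<le> Q"
        using d3 2 by (auto intro!: le le1 simp: St zs add_divide_distrib)
      then have b: "norm (s - p) \<le> 4 * Q"
        using norm_le_via[of s r "2 * Q" p "2 * Q" "4 * Q"] Q0 by simp
      have "midpoint p s - p = (1/2) *\<^sub>R (s - p)"
        by (rule midpoint_diff)
      then have "norm (midpoint p s - p) \<le> 2 * Q" using b by simp
      then have "norm (q - p) \<le> 4 * Q" using a Q0
        using norm_le_via[of q "midpoint p s" Q p "2 * Q" "4 * Q"] Q0 by simp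
      then show ?thesis using a b Q0 by auto
    next
      case 3
      have a: "norm (s - p) \<le> 2 * Q" "norm (q - midpoint p s) \<le> Q" "norm (r - q) \<le> Q"
        using d3 3 by (auto intro!: le le1 simp: St zs)
      have "midpoint p s - p = (1/2) *\<^sub>R (s - p)"
        by (rule midpoint_diff)
      then have "norm (midpoint p s - p) \<le> Q" using a by simp
      then have b: "norm (q - p) \<le> 2 * Q" using a Q0
        using norm_le_via[of q "midpoint p s" Q p Q "2 * Q"] Q0 by simp
      then have "norm (r - p) \<le> 3 * Q" using a Q0
        using norm_le_via[of r q Q p "2 * Q" "3 * Q"] Q0 by simp
      then show ?thesis using a b Q0 by auto
    qed
    then show ?thesis using Q0 by (auto simp: zs dist_norm norm_minus_commute)
  qed
  then have "element_of S \<subseteq> cball (zs!0) (4 * Q)"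
    unfolding element_of_def St by (simp add: hull_minimal)
  then have "diameter (element_of S) \<le> diameter (cball (zs!0) (4 * Q))"
    by (intro diameter_subset) auto
  also have "\<dots> = 8 * Q" using Q0 by (simp add: diameter_cball)
  finally show ?thesis unfolding Q_def .
qed

lemma shape_weight_ge_1: "shape_weight S \<ge> 1"
  by (cases S) auto

text \<open>A bisection divides both sides of the inequality by 4, so the children inherit it with
  the same \<open>c\<close>. The induction passes through meshes that need not be conforming, hence
  a statement about single tagged simplices.\<close>

lemma shape_regular_bisection:
  fixes G G' :: "'d::finite tagged_simplex set"
  assumes d: "CARD('d) \<in> {2, 3}" and step: "bisection_step\<^sup>*\<^sup>* G G'"
    and G: "\<And>S. S \<in> G \<Longrightarrow> tagged_ok S \<and>
      shape_weight S * frame_sq S ^ CARD('d) \<le> c * (measure lebesgue (element_of S))\<^sup>2"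
    and S: "S \<in> G'"
  shows "tagged_ok S \<and>
      shape_weight S * frame_sq S ^ CARD('d) \<le> c * (measure lebesgue (element_of S))\<^sup>2"
  using step S
proof (induction arbitrary: S)
  case base
  then show ?case using G by blast
next
  case (step H H')
  from step.hyps(2) obtain R where R: "R \<in> H" "H' = (H - {R}) \<union> bisect R"
    by (auto elim: bisection_step.cases)
  show ?case
  proof (cases "S \<in> bisect R")
    case True
    then show ?thesis
    proof -
      have R': "tagged_ok R" "shape_weight R * frame_sq R ^ CARD('d) \<le> c * (measure lebesgue (element_of R))\<^sup>2"
        using step.IH[OF R(1)] by auto
      have d2: "CARD('d) \<ge> 2" using d by auto
      show ?thesis
        unfolding measure_bisect[OF d R'(1) True] shape_bisect[OF d R'(1) True]
        using R' bisect_tagged_ok[OF d2 R'(1) True] by (simp add: power_divide)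
    qed
  next
    case False
    then show ?thesis using R step by auto
  qed
qed

lemma shape_regular_refinements:
  fixes G :: "'d::finite tagged_simplex set"
  assumes d: "CARD('d) \<in> {2, 3}" and ini: "initial_mesh \<Omega> G"
  shows "\<exists>c>0. \<forall>G' T. bisection_step\<^sup>*\<^sup>* G G' \<longrightarrow> T \<in> elements G' \<longrightarrow>
           diameter T ^ CARD('d) \<le> c * measure lebesgue T"
proof -
  have "finite (elements G)"
    using ini by (auto simp: initial_mesh_def conforming_triangulation_def triangulation_def)
  then have fin: "finite G"
    using ini by (auto simp: initial_mesh_def elements_def dest: finite_imageD)
  define w where "w S = shape_weight S * frame_sq S ^ CARD('d)" for S :: "'d tagged_simplex"
  define \<mu> where "\<mu> S = measure lebesgue (element_of S)" for S :: "'d tagged_simplex"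
  have \<mu>: "\<mu> S > 0" if "S \<in> G" for S
  proof -
    have "int CARD('d) simplex (element_of S)"
      using ini that by (auto simp: initial_mesh_def conforming_triangulation_def elements_def)
    then show ?thesis unfolding \<mu>_def using measure_simplex_pos[of "element_of S"] by simp
  qed
  \<comment> \<open>The sum dominates the quotient of every initial simplex and so replaces a
    maximum over the finite initial mesh.\<close>
  define c where "c = (\<Sum>S\<in>G. w S / (\<mu> S)\<^sup>2)"
  have w0: "w S \<ge> 0" for S
    unfolding w_def using shape_weight_ge_1[of S] frame_sq_nonneg[of S] by simp
  have "w S \<le> c * (\<mu> S)\<^sup>2" if "S \<in> G" for S
  proof -
    have "w S / (\<mu> S)\<^sup>2 \<le> c"
      unfolding c_def by (rule member_le_sum) (use that fin w0 in auto)
    then show ?thesis using \<mu>[OF that] by (simp add: field_simps)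
  qed
  moreover have "tagged_ok S" if "S \<in> G" for S
    using ini that by (auto simp: initial_mesh_def tagged_ok_def)
  ultimately have key: "tagged_ok S \<and> w S \<le> c * (\<mu> S)\<^sup>2" if "bisection_step\<^sup>*\<^sup>* G G'" "S \<in> G'" for S G'
    unfolding w_def \<mu>_def using shape_regular_bisection[OF d that(1) _ that(2)] by blast
  have c0: "c \<ge> 0" unfolding c_def using w0 by (intro sum_nonneg) auto
  \<comment> \<open>8 ^ d comes from \<open>diameter_shape\<close>, the root of c from the root of
    the invariant; the summand 1 makes the constant positive.\<close>
  have "diameter T ^ CARD('d) \<le> (8 ^ CARD('d) * sqrt c + 1) * measure lebesgue T"
    if "bisection_step\<^sup>*\<^sup>* G G'" "T \<in> elements G'" for G' T
  proof -
    from that(2) obtain S where S: "S \<in> G'" "T = element_of S" unfolding elements_def by blast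
    have k: "tagged_ok S" "w S \<le> c * (\<mu> S)\<^sup>2" using key[OF that(1) S(1)] by auto
    have Q: "frame_sq S ^ CARD('d) \<le> w S"
      unfolding w_def using shape_weight_ge_1[of S] frame_sq_nonneg[of S]
      by (simp add: mult_le_cancel_right1 not_less)
    have "diameter T ^ CARD('d) \<le> (8 * sqrt (frame_sq S)) ^ CARD('d)"
      using diameter_shape[OF d k(1)] S by (intro power_mono) (auto simp: diameter_ge_0 element_of_def bounded_convex_hull finite_imp_bounded)
    also have "\<dots> = 8 ^ CARD('d) * sqrt (frame_sq S ^ CARD('d))"
      by (simp add: power_mult_distrib real_sqrt_power)
    also have "\<dots> \<le> 8 ^ CARD('d) * sqrt (c * (\<mu> S)\<^sup>2)"
      using Q k by (intro mult_left_mono real_sqrt_le_mono) auto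
    also have "\<dots> = 8 ^ CARD('d) * sqrt c * \<mu> S"
      by (simp add: real_sqrt_mult \<mu>_def)
    finally show ?thesis unfolding \<mu>_def S(2) distrib_right mult_1 by (rule add_increasing2[OF measure_nonneg])
  qed
  then show ?thesis
    by (intro exI[of _ "8 ^ CARD('d) * sqrt c + 1"]) (use c0 in \<open>auto intro: add_nonneg_pos\<close>)
qed

section \<open>Facets of simplicial meshes\<close>

lemma simplex_polytope: "n simplex S \<Longrightarrow> polytope S"
  unfolding simplex_def polytope_def using aff_independent_finite by blast

text \<open>Project x from \<open>a\<close> onto the hyperplane of F. As x tends to p, so does the
  projection, which is therefore in F eventually; if x is on the side of \<open>a\<close>, it lies
  on the segment from the projection to \<open>a\<close>.\<close>

lemma convex_facet_half_ball:
  fixes T F :: "'a::euclidean_space set"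
  assumes "convex T" "F \<subseteq> T" and H: "affine hull F = {x. n \<bullet> x = c}"
    and a: "a \<in> T" "n \<bullet> a \<noteq> c" and p: "p \<in> rel_interior F"
  shows "\<exists>e>0. \<forall>x\<in>ball p e. (n \<bullet> x - c) * (n \<bullet> a - c) \<ge> 0 \<longrightarrow> x \<in> T"
proof -
  obtain r where r: "r > 0" "ball p r \<inter> affine hull F \<subseteq> F" and pF: "p \<in> F"
    using p by (auto simp: mem_rel_interior_ball)
  \<comment> \<open>\<open>s x\<close> is the height of x over the hyperplane relative to that of
    \<open>a\<close>, and \<open>y x\<close> is the projection from \<open>a\<close>.\<close>
  define s where "s x = (n \<bullet> x - c) / (n \<bullet> a - c)" for x
  define y where "y x = x + (s x / (1 - s x)) *\<^sub>R (x - a)" for x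
  have sp: "s p = 0" using pF H hull_subset[of F affine] by (auto simp: s_def)
  have s: "(s \<longlongrightarrow> s p) (nhds p)"
    unfolding s_def using a by (intro tendsto_intros filterlim_ident) auto
  then have "\<forall>\<^sub>F x in nhds p. s x < 1" unfolding sp by (rule order_tendstoD) simp
  moreover have "(y \<longlongrightarrow> p + (0 / (1 - 0)) *\<^sub>R (p - a)) (nhds p)"
    unfolding y_def using s unfolding sp by (intro tendsto_intros filterlim_ident) auto
  then have "\<forall>\<^sub>F x in nhds p. dist (y x) p < r"
    using r(1) by (simp add: tendstoD)
  ultimately have "\<forall>\<^sub>F x in nhds p. s x < 1 \<and> dist (y x) p < r" by (rule eventually_conj)
  then obtain e where e: "e > 0" "\<And>x. dist x p < e \<Longrightarrow> s x < 1 \<and> dist (y x) p < r"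
    by (auto simp: eventually_nhds_metric)
  have "x \<in> T" if x: "x \<in> ball p e" "(n \<bullet> x - c) * (n \<bullet> a - c) \<ge> 0" for x
  proof -
    have s1: "s x < 1" and d: "dist (y x) p < r" using e(2)[of x] x by (auto simp: dist_commute)
    have s0: "s x \<ge> 0" using x(2) by (simp add: s_def zero_le_divide_iff zero_le_mult_iff)
    have sx: "n \<bullet> x = c + s x * (n \<bullet> a - c)" using a by (simp add: s_def)
    have "n \<bullet> y x = n \<bullet> x + (s x / (1 - s x)) * (n \<bullet> x - n \<bullet> a)"
      by (simp add: y_def inner_simps)
    also have "n \<bullet> x - n \<bullet> a = - ((1 - s x) * (n \<bullet> a - c))"
      unfolding sx by (simp add: algebra_simps)
    also have "(s x / (1 - s x)) * - ((1 - s x) * (n \<bullet> a - c)) = - (s x * (n \<bullet> a - c))"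
      using s1 by simp
    finally have "n \<bullet> y x = c" unfolding sx by simp
    then have "y x \<in> T" using r d H assms(2) by (auto simp: dist_commute)
    moreover have "x = (1 - s x) *\<^sub>R y x + s x *\<^sub>R a"
      using s1 by (simp add: y_def scaleR_add_right) (simp add: algebra_simps)
    ultimately show ?thesis
      using \<open>convex T\<close> a s0 s1 by (metis convexD_alt less_imp_le)
  qed
  then show ?thesis using e(1) by blast
qed

text \<open>The half balls at p contained in \<open>T1\<close> and \<open>T2\<close> lie on opposite
  sides of the hyperplane: otherwise a point near p in the direction of \<open>a1\<close> would be
  in both sets, hence in the hyperplane. Together they fill a ball.\<close>

lemma convex_common_facet_interior:
  fixes T1 T2 :: "'a::euclidean_space set"
  assumes c: "convex T1" "convex T2" and H: "affine hull (T1 \<inter> T2) = {x. n \<bullet> x = c}"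
    and a1: "a1 \<in> T1" "n \<bullet> a1 \<noteq> c" and a2: "a2 \<in> T2" "n \<bullet> a2 \<noteq> c"
    and p: "p \<in> rel_interior (T1 \<inter> T2)"
  shows "p \<in> interior (T1 \<union> T2)"
proof -
  obtain e1 where e1: "e1 > 0" "\<And>x. x \<in> ball p e1 \<Longrightarrow> (n \<bullet> x - c) * (n \<bullet> a1 - c) \<ge> 0 \<Longrightarrow> x \<in> T1"
    using convex_facet_half_ball[OF c(1) Int_lower1 H a1 p] by blast
  obtain e2 where e2: "e2 > 0" "\<And>x. x \<in> ball p e2 \<Longrightarrow> (n \<bullet> x - c) * (n \<bullet> a2 - c) \<ge> 0 \<Longrightarrow> x \<in> T2"
    using convex_facet_half_ball[OF c(2) Int_lower2 H a2 p] by blast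
  define e where "e = min e1 e2"
  have e: "e > 0" "e \<le> e1" "e \<le> e2" using e1 e2 by (auto simp: e_def)
  have pc: "n \<bullet> p = c" using p H rel_interior_subset hull_subset[of "T1 \<inter> T2" affine] by blast
  have "(n \<bullet> a1 - c) * (n \<bullet> a2 - c) < 0"
  proof (rule ccontr)
    assume "\<not> ?thesis"
    then have pos: "(n \<bullet> a1 - c) * (n \<bullet> a2 - c) > 0" using a1 a2 by (auto simp: not_less less_le)
    have "a1 \<noteq> p" using a1 pc by auto
    define x where "x = p + (e / (2 * norm (a1 - p))) *\<^sub>R (a1 - p)"
    have "dist p x = e / 2" using \<open>a1 \<noteq> p\<close> e by (simp add: x_def dist_norm)
    then have xb: "x \<in> ball p e1" "x \<in> ball p e2" using e by auto
    define t where "t = e / (2 * norm (a1 - p))"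
    have t: "t > 0" using \<open>a1 \<noteq> p\<close> e by (simp add: t_def)
    have nx: "n \<bullet> x - c = t * (n \<bullet> a1 - c)"
      unfolding x_def t_def[symmetric] by (simp add: inner_simps pc)
    have "x \<in> T1" using t by (intro e1(2)[rule_format] xb) (simp add: nx mult.assoc)
    moreover have "x \<in> T2" using t pos by (intro e2(2)[rule_format] xb) (simp add: nx mult.assoc)
    ultimately have "n \<bullet> x = c" using H hull_subset[of "T1 \<inter> T2" affine] by blast
    then show False using nx t a1 by simp
  qed
  then have "ball p e \<subseteq> T1 \<union> T2"
  proof (intro subsetI)
    assume *: "(n \<bullet> a1 - c) * (n \<bullet> a2 - c) < 0"
    fix x assume "x \<in> ball p e"
    then have x: "x \<in> ball p e1" "x \<in> ball p e2" using e by auto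
    have "(n \<bullet> x - c) * (n \<bullet> a1 - c) \<ge> 0 \<or> (n \<bullet> x - c) * (n \<bullet> a2 - c) \<ge> 0"
      using * by (auto simp: mult_less_0_iff zero_le_mult_iff)
    then show "x \<in> T1 \<union> T2" using x e1(2) e2(2) by blast
  qed
  then show ?thesis using e(1) by (meson centre_in_ball interior_maximal open_ball subsetD)
qed

locale simplicial_mesh =
  fixes \<T> :: "'a::euclidean_space set set"
  assumes tri: "triangulation \<T>" and full: "T \<in> \<T> \<Longrightarrow> int DIM('a) simplex T"
begin

lemma fin: "finite \<T>"
  using tri by (simp add: triangulation_def)

lemma elem:
  assumes "T \<in> \<T>"
  shows "convex T" "compact T" "polytope T" "aff_dim T = int DIM('a)" "T \<noteq> {}"
  using full[OF assms] convex_simplex compact_simplex simplex_polytope aff_dim_simplex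
  by (auto dest: aff_dim_simplex)

lemma inter_face: "T \<in> \<T> \<Longrightarrow> T' \<in> \<T> \<Longrightarrow> (T \<inter> T') face_of T"
  using tri by (simp add: triangulation_def)

text \<open>The intersection is a face of both elements; a full-dimensional face would be equal to
  each of them.\<close>

lemma aff_dim_inter:
  assumes "T \<in> \<T>" "T' \<in> \<T>" "T \<noteq> T'"
  shows "aff_dim (T \<inter> T') < int DIM('a)"
proof (rule ccontr)
  assume a: "\<not> ?thesis"
  have 1: "T \<inter> T' face_of T" "T \<inter> T' face_of T'"
    using inter_face[of T T'] inter_face[of T' T] assms by (auto simp: Int_commute)
  have "T \<inter> T' = T" "T \<inter> T' = T'"
    using face_of_aff_dim_lt[OF elem(1)[OF assms(1)] 1(1)] face_of_aff_dim_lt[OF elem(1)[OF assms(2)] 1(2)]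
      a elem(4)[OF assms(1)] elem(4)[OF assms(2)] by force+
  then show False using assms by auto
qed

text \<open>The dichotomy behind the line argument: sets of codimension two are missed by almost
  every line of a given direction, so a line passes from one element to another only through a facet
  of both.\<close>

lemma inter_cases:
  assumes "T \<in> \<T>" "T' \<in> \<T>" "T \<noteq> T'"
  shows "aff_dim (T \<inter> T') \<le> int DIM('a) - 2 \<or> (T \<inter> T') facet_of T \<and> (T \<inter> T') facet_of T'"
proof -
  have 1: "T \<inter> T' face_of T" "T \<inter> T' face_of T'"
    using inter_face[of T T'] inter_face[of T' T] assms by (auto simp: Int_commute)
  have "aff_dim (T \<inter> T') = int DIM('a) - 1" if "\<not> aff_dim (T \<inter> T') \<le> int DIM('a) - 2"
    using aff_dim_inter[OF assms] that by simp
  moreover have "T \<inter> T' \<noteq> {}" if "\<not> aff_dim (T \<inter> T') \<le> int DIM('a) - 2"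
    using that DIM_positive[where 'a='a] by (auto simp: aff_dim_empty)
  ultimately show ?thesis
    using 1 elem(4)[OF assms(1)] elem(4)[OF assms(2)] by (auto simp: facet_of_def)
qed

text \<open>F is a face of T \<inter> T'; as a proper face it would force this intersection to be
  full-dimensional.\<close>

lemma facet_inter:
  assumes "T \<in> \<T>" "T' \<in> \<T>" "T \<noteq> T'" "F facet_of T" "F \<subseteq> T'"
  shows "F = T \<inter> T'"
proof (rule ccontr)
  assume ne: "F \<noteq> T \<inter> T'"
  have F: "F face_of T" "aff_dim F = int DIM('a) - 1" "F \<subseteq> T"
    using assms elem(4)[of T] by (auto simp: facet_of_def face_of_imp_subset)
  then have "F face_of (T \<inter> T')"
    using assms(5) by (intro face_of_subset[OF F(1)]) auto
  then have "aff_dim F < aff_dim (T \<inter> T')"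
    using ne elem(1)[OF assms(1)] elem(1)[OF assms(2)] by (intro face_of_aff_dim_lt) (auto intro: convex_Int)
  then show False using aff_dim_inter[OF assms(1-3)] F by simp
qed

lemma common_facet_interior:
  assumes "T \<in> \<T>" "T' \<in> \<T>" "T \<noteq> T'" "F facet_of T" "F \<subseteq> T'" "p \<in> rel_interior F"
  shows "p \<in> interior (T \<union> T')"
proof -
  have FI: "F = T \<inter> T'" using facet_inter assms by blast
  have "aff_dim (T \<inter> T') = int DIM('a) - 1"
    using assms elem(4)[of T] unfolding FI[symmetric] by (simp add: facet_of_def)
  then have "\<exists>n c. n \<noteq> 0 \<and> affine hull (T \<inter> T') = {x. n \<bullet> x = c}"
    by (subst aff_dim_eq_hyperplane[symmetric]) (simp add: of_nat_diff Suc_leI)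
  then obtain n c where n: "n \<noteq> 0" and H: "affine hull (T \<inter> T') = {x. n \<bullet> x = c}"
    by blast
  have ex: "\<exists>a\<in>S. n \<bullet> a \<noteq> c" if "S \<in> \<T>" for S
  proof (rule ccontr)
    assume "\<not> ?thesis"
    then have "S \<subseteq> {x. n \<bullet> x = c}" by auto
    from aff_dim_subset[OF this] show False using elem(4)[OF that] n by simp
  qed
  from ex[OF assms(1)] ex[OF assms(2)] show ?thesis
    using convex_common_facet_interior[OF _ _ H] elem(1) assms FI by blast
qed

text \<open>A relative interior point of F has a neighbourhood inside T \<union> T1, and the
  interior of T2 accumulates there; this would put a nonempty open set into the null set where T2
  meets T and T1. The lemma makes the description in \<open>neighbour\<close> unique.\<close>

lemma facet_at_most_two:
  assumes T: "T \<in> \<T>" "T1 \<in> \<T>" "T2 \<in> \<T>" "T1 \<noteq> T" "T2 \<noteq> T"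
    and F: "F facet_of T" "F \<subseteq> T1" "F \<subseteq> T2"
  shows "T1 = T2"
proof (rule ccontr)
  assume ne: "T1 \<noteq> T2"
  have Fc: "convex F" "F \<noteq> {}"
    using F(1) face_of_imp_convex elem(1)[OF T(1)] by (auto simp: facet_of_def)
  then obtain p where p: "p \<in> rel_interior F" using rel_interior_eq_empty by blast
  then have "p \<in> interior (T \<union> T1)"
    using common_facet_interior[OF T(1,2) _ F(1,2)] T by blast
  then have io: "open (interior (T \<union> T1) \<inter> interior T2)" by auto
  have pT2: "p \<in> closure (interior T2)"
  proof -
    have "p \<in> T2" using p F rel_interior_subset by blast
    moreover have "interior T2 = rel_interior T2"
      using elem(4)[OF T(3)] by (simp add: interior_rel_interior_gen)
    ultimately show ?thesis using elem(1)[OF T(3)] closure_subset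
      by (metis convex_closure_rel_interior subsetD)
  qed
  then have nonempty: "interior (T \<union> T1) \<inter> interior T2 \<noteq> {}"
    using \<open>p \<in> interior (T \<union> T1)\<close> open_Int_closure_eq_empty[of "interior (T \<union> T1)" "interior T2"] by auto
  have "negligible ((T \<inter> T2) \<union> (T1 \<inter> T2))"
    using aff_dim_inter[of T T2] aff_dim_inter[of T1 T2] T ne
    by (intro negligible_Un; subst negligible_convex_interior)
      (auto simp: elem convex_Int interior_rel_interior_gen)
  moreover have "interior (T \<union> T1) \<inter> interior T2 \<subseteq> (T \<inter> T2) \<union> (T1 \<inter> T2)"
    using interior_subset by fast
  ultimately have "negligible (interior (T \<union> T1) \<inter> interior T2)"
    by (rule negligible_subset)
  then show False using io nonempty open_not_negligible by blast
qed

text \<open>Boundary of the union of the elements, not of \<Omega>: at a crack of the domain a facet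
  common to two elements may lie in \<open>frontier \<Omega>\<close>, so
  \<open>boundary_facet_frontier\<close> has no converse.\<close>

definition boundary_facet where
  "boundary_facet T F \<longleftrightarrow> F facet_of T \<and> (\<forall>T'\<in>\<T>. F \<subseteq> T' \<longrightarrow> T' = T)"

text \<open>If F met \<Omega>, so would its relative interior, at a point that belongs to a further
  element T'. The face T \<inter> T' of T then contains a relative interior point of F, hence all of
  F.\<close>

lemma boundary_facet_frontier:
  assumes T: "T \<in> \<T>" and F: "boundary_facet T F" and \<Omega>: "open \<Omega>" "\<Union>\<T> = closure \<Omega>"
  shows "F \<subseteq> frontier \<Omega>"
proof (rule ccontr)
  assume n: "\<not> ?thesis"
  have FT: "F facet_of T" "F \<subseteq> T" "F face_of T"
    using F by (auto simp: boundary_facet_def facet_of_def face_of_imp_subset)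
  have Fc: "convex F"
    using FT face_of_imp_convex by blast
  obtain q where "q \<in> F" "q \<in> \<Omega>"
    using n FT T \<Omega> by (auto simp: frontier_def interior_open)
  then have "\<Omega> \<inter> closure (rel_interior F) \<noteq> {}"
    using convex_closure_rel_interior[OF Fc] closure_subset by auto
  then obtain q' where q': "q' \<in> \<Omega>" "q' \<in> rel_interior F"
    using open_Int_closure_eq_empty[OF \<Omega>(1)] by blast
  have "q' \<notin> interior T"
  proof
    assume "q' \<in> interior T"
    moreover have "interior T = rel_interior T"
      using elem(4)[OF T] by (simp add: interior_rel_interior_gen)
    moreover have "F \<noteq> T" using FT(1) elem(4)[OF T] by (auto simp: facet_of_def)
    ultimately show False
      using face_of_disjoint_rel_interior[OF FT(3)] q' rel_interior_subset by blast
  qed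
  moreover have "q' \<in> interior T" if "q' \<notin> \<Union>(\<T> - {T})"
  proof -
    have "closed (\<Union>(\<T> - {T}))"
      using fin elem(2) by (intro closed_Union) (auto intro: compact_imp_closed)
    then have "open (\<Omega> - \<Union>(\<T> - {T}))" using \<Omega>(1) by auto
    moreover have "\<Omega> - \<Union>(\<T> - {T}) \<subseteq> T" using \<Omega>(2) closure_subset by blast
    ultimately have "\<Omega> - \<Union>(\<T> - {T}) \<subseteq> interior T" by (rule interior_maximal[rotated])
    then show ?thesis using that q' by blast
  qed
  ultimately obtain T' where T': "T' \<in> \<T>" "T' \<noteq> T" "q' \<in> T'" by blast
  have "F \<subseteq> T \<inter> T'"
    using inter_face[OF T T'(1)] FT(2)
    by (rule subset_of_face_of) (use q' T' FT rel_interior_subset in blast)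
  then show False using F T' by (auto simp: boundary_facet_def)
qed

text \<open>The boundary of T is the union of its facets, and the relative boundary of a facet is a
  union of faces of codimension two.\<close>

lemma facet_through_point:
  assumes T: "T \<in> \<T>" and p: "p \<in> T" "p \<notin> interior T"
    and gen: "\<And>F. F face_of T \<Longrightarrow> aff_dim F \<le> int DIM('a) - 2 \<Longrightarrow> p \<notin> F"
  obtains F where "F facet_of T" "p \<in> rel_interior F"
proof -
  have "interior T = rel_interior T"
    using elem(4)[OF T] by (simp add: interior_rel_interior_gen)
  then have "p \<in> T - rel_interior T" using p by auto
  then obtain F where F: "F facet_of T" "p \<in> F"
    using rel_boundary_of_polyhedron[OF polytope_imp_polyhedron[OF elem(3)[OF T]]] by auto
  then have FT: "F face_of T" "aff_dim F = int DIM('a) - 1"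
    using elem(4)[OF T] by (auto simp: facet_of_def)
  have "p \<in> rel_interior F"
  proof (rule ccontr)
    assume "\<not> ?thesis"
    then have "p \<in> F - rel_interior F" using F by auto
    then obtain E where E: "E facet_of F" "p \<in> E"
      using rel_boundary_of_polyhedron[OF polytope_imp_polyhedron[OF face_of_polytope_polytope[OF elem(3)[OF T] FT(1)]]] by auto
    then have "E face_of T" "aff_dim E = int DIM('a) - 2"
      using FT face_of_trans by (auto simp: facet_of_def)
    then show False using gen[of E] E by simp
  qed
  then show ?thesis using F that by blast
qed

text \<open>If a second element contained the facet through p, then p would be interior to the union
  of the two.\<close>

lemma boundary_facet_through_point:
  assumes T: "T \<in> \<T>" and p: "p \<in> T" "p \<notin> interior (\<Union>\<T>)"
    and gen: "\<And>F. F face_of T \<Longrightarrow> aff_dim F \<le> int DIM('a) - 2 \<Longrightarrow> p \<notin> F"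
  obtains F where "boundary_facet T F" "p \<in> F"
proof -
  have "p \<notin> interior T" using T p interior_mono[of T "\<Union>\<T>"] by blast
  then obtain F where F: "F facet_of T" "p \<in> rel_interior F"
    using facet_through_point[OF T p(1) _ gen] by blast
  have "T' = T" if "T' \<in> \<T>" "F \<subseteq> T'" for T'
  proof (rule ccontr)
    assume "T' \<noteq> T"
    then have "p \<in> interior (T \<union> T')"
      using common_facet_interior[OF T that(1) _ F(1) that(2) F(2)] by blast
    then show False
      using p(2) T that(1) interior_mono[of "T \<union> T'" "\<Union>\<T>"] by blast
  qed
  then show ?thesis using F rel_interior_subset that[of F] by (auto simp: boundary_facet_def)
qed

end

section \<open>Sweeps of sets along a direction\<close>

definition signed_square :: "real \<Rightarrow> real" where
  "signed_square s = s * \<bar>s\<bar>"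

lemma abs_signed_square [simp]: "\<bar>signed_square x\<bar> = x\<^sup>2"
  by (simp add: signed_square_def abs_mult power2_eq_square)

lemma signed_square_0 [simp]: "signed_square 0 = 0"
  by (simp add: signed_square_def)

lemma signed_square_diff_same_sign:
  assumes "x * y \<ge> 0"
  shows "\<bar>signed_square x - signed_square y\<bar> = \<bar>x - y\<bar> * (\<bar>x\<bar> + \<bar>y\<bar>)"
proof -
  have "signed_square x - signed_square y = (x - y) * (\<bar>x\<bar> + \<bar>y\<bar>)"
    using assms by (auto simp: signed_square_def abs_if algebra_simps zero_le_mult_iff)
  then show ?thesis by (simp add: abs_mult)
qed

lemma signed_square_diff_opposite_sign:
  assumes "x * y < 0"
  shows "\<bar>signed_square x - signed_square y\<bar> = x\<^sup>2 + y\<^sup>2"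
proof -
  have "signed_square x - signed_square y = x\<^sup>2 + y\<^sup>2 \<or> signed_square x - signed_square y = - (x\<^sup>2 + y\<^sup>2)"
    using assms by (auto simp: mult_less_0_iff signed_square_def power2_eq_square)
  then show ?thesis
    using abs_of_nonneg[OF sum_power2_ge_zero[of x y]] by (elim disjE) (simp_all only: abs_minus_cancel)
qed

lemma signed_square_diff_le: "\<bar>signed_square x - signed_square y\<bar> \<le> \<bar>x - y\<bar> * (\<bar>x\<bar> + \<bar>y\<bar>)"
proof (cases "x * y \<ge> 0")
  case False
  then have "\<bar>x - y\<bar> = \<bar>x\<bar> + \<bar>y\<bar>" by (auto simp: not_le mult_less_0_iff)
  moreover have "x\<^sup>2 + y\<^sup>2 \<le> (\<bar>x\<bar> + \<bar>y\<bar>) * (\<bar>x\<bar> + \<bar>y\<bar>)"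
    by (simp add: algebra_simps power2_eq_square abs_mult_self)
  ultimately show ?thesis using False by (simp add: signed_square_diff_opposite_sign)
qed (simp add: signed_square_diff_same_sign)

text \<open>For equal signs |x - y| is at most |x| + |y|; for opposite signs the parallelogram
  identity applies. The factor 2 is attained at x = -y.\<close>

lemma power2_diff_le_signed_square: "(x - y)\<^sup>2 \<le> 2 * \<bar>signed_square x - signed_square y\<bar>"
proof (cases "x * y \<ge> 0")
  case True
  have "(x - y)\<^sup>2 = \<bar>x - y\<bar> * \<bar>x - y\<bar>" by (simp add: power2_eq_square)
  moreover have "\<bar>x - y\<bar> * \<bar>x - y\<bar> \<le> \<bar>x - y\<bar> * (\<bar>x\<bar> + \<bar>y\<bar>)"
    by (intro mult_left_mono) auto
  moreover have "0 \<le> \<bar>x - y\<bar> * (\<bar>x\<bar> + \<bar>y\<bar>)" by simp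
  ultimately show ?thesis unfolding signed_square_diff_same_sign[OF True] by linarith
next
  case False
  moreover have "(x - y)\<^sup>2 + (x + y)\<^sup>2 = 2 * (x\<^sup>2 + y\<^sup>2)" by (simp add: power2_eq_square algebra_simps)
  then have "(x - y)\<^sup>2 \<le> 2 * (x\<^sup>2 + y\<^sup>2)" using zero_le_power2[of "x + y"] by linarith
  ultimately show ?thesis by (simp add: signed_square_diff_opposite_sign)
qed

lemma power2_add_le: "(a + b)\<^sup>2 \<le> 2 * (a\<^sup>2 + (b :: real)\<^sup>2)"
  using zero_le_power2[of "a - b"] by (simp add: power2_eq_square algebra_simps)

lemma sum_indicator_unique:
  fixes f :: "'a set \<Rightarrow> 'b::semiring_1"
  assumes "finite \<Q>" "P \<in> \<Q>" "x \<in> P" "\<And>Q. Q \<in> \<Q> \<Longrightarrow> x \<in> Q \<Longrightarrow> Q = P"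
  shows "(\<Sum>Q\<in>\<Q>. indicator Q x * f Q) = f P"
proof -
  have "(\<Sum>Q\<in>\<Q>. indicator Q x * f Q) = (\<Sum>Q\<in>\<Q>. if Q = P then f P else 0)"
  proof (intro sum.cong refl)
    fix Q assume Q: "Q \<in> \<Q>"
    show "indicator Q x * f Q = (if Q = P then f P else 0)"
    proof (cases "Q = P")
      case False
      then have "x \<notin> Q" using assms(4)[OF Q] by blast
      then show ?thesis using False by simp
    qed (use assms(3) in simp)
  qed
  then show ?thesis using assms(1,2) by simp
qed

lemma nn_integral_lborel_translate:
  fixes f :: "'a::euclidean_space \<Rightarrow> ennreal"
  assumes [measurable]: "f \<in> borel_measurable borel"
  shows "(\<integral>\<^sup>+x. f (x + c) \<partial>lborel) = (\<integral>\<^sup>+x. f x \<partial>lborel)"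
proof -
  have "(\<integral>\<^sup>+x. f x \<partial>lborel) = (\<integral>\<^sup>+x. f x \<partial>distr lborel borel ((+) c))"
    by (simp only: lborel_distr_plus)
  also have "\<dots> = (\<integral>\<^sup>+x. f (c + x) \<partial>lborel)"
    by (rule nn_integral_distr) auto
  finally show ?thesis by (simp only: add.commute)
qed

lemma negligible_aff_dim_less:
  fixes S :: "'a::euclidean_space set"
  assumes "aff_dim S < int DIM('a)"
  shows "negligible S"
proof -
  have "interior (affine hull S) = {}"
    using assms by (simp add: interior_rel_interior_gen)
  then have "negligible (affine hull S)"
    using negligible_convex_interior[OF affine_imp_convex[OF affine_affine_hull]] by blast
  then show ?thesis by (rule negligible_subset) (rule hull_subset)
qed

text \<open>Restrict the integral to the homothetic copy of \<open>T\<close> of ratio \<open>1/4\<close> centred at a maximum point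
  of the absolute value, where the function keeps at least half its maximum.\<close>

lemma affine_sup_le_l2:
  fixes T :: "'a::euclidean_space set" and a :: 'a and b :: real
  assumes T: "convex T" "compact T" and p: "p \<in> T"
  shows "(a \<bullet> p + b)\<^sup>2 * measure lborel T \<le> 4 ^ (DIM('a) + 1) * (LINT x:T|lborel. (a \<bullet> x + b)\<^sup>2)"
proof -
  let ?v = "\<lambda>x. a \<bullet> x + b"
  obtain q where q: "q \<in> T" "\<And>x. x \<in> T \<Longrightarrow> \<bar>?v x\<bar> \<le> \<bar>?v q\<bar>"
  proof -
    have "continuous_on T (\<lambda>x. \<bar>?v x\<bar>)" by (intro continuous_intros)
    then show ?thesis
      using continuous_attains_sup[OF T(2), of "\<lambda>x. \<bar>?v x\<bar>"] p that by blast
  qed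
  define f where "f x = (1/4) *\<^sub>R x + (3/4) *\<^sub>R q" for x
  have sub: "f ` T \<subseteq> T"
    unfolding f_def using q(1) T(1) by (auto intro!: convexD)
  have cf: "compact (f ` T)"
    unfolding f_def by (intro compact_continuous_image T continuous_intros)
  have meas: "measure lborel (f ` T) = (1/4) ^ DIM('a) * measure lborel T"
    using measure_lebesgue_affine[of "1/4" "(3/4) *\<^sub>R q" T] T cf
    by (simp add: f_def[abs_def] measure_completion borel_compact power_one_over)
  have quarter: "\<bar>Q\<bar> / 2 \<le> \<bar>Y\<bar>" if "Y = 1/4 * X + 3/4 * Q" "\<bar>X\<bar> \<le> \<bar>Q\<bar>" for X Y Q :: real
    using that by (auto simp: abs_if split: if_splits)
  have big: "(?v q)\<^sup>2 / 4 \<le> (?v y)\<^sup>2" if "y \<in> f ` T" for y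
  proof -
    from that obtain x where x: "x \<in> T" "y = f x" by blast
    have "?v y = (1/4) * ?v x + (3/4) * ?v q" unfolding x f_def by (simp add: inner_simps field_simps)
    then have "\<bar>?v q\<bar> / 2 \<le> \<bar>?v y\<bar>" using q(2)[OF x(1)] quarter by blast
    then have "(\<bar>?v q\<bar> / 2)\<^sup>2 \<le> \<bar>?v y\<bar>\<^sup>2" by (intro power_mono) auto
    then show ?thesis by (simp add: power_divide)
  qed
  have int: "set_integrable lborel S (\<lambda>x. (?v x)\<^sup>2)" if "compact S" for S
    using that by (intro borel_integrable_compact[unfolded set_integrable_def[symmetric]])
      (auto simp: set_integrable_def intro!: borel_integrable_compact continuous_intros)
  have fin: "emeasure lborel (f ` T) < \<infinity>" using cf by (rule emeasure_compact_finite)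
  have "(?v q)\<^sup>2 / 4 * measure lborel (f ` T) = (LINT x:f ` T|lborel. (?v q)\<^sup>2 / 4)"
    using fin cf by (subst set_integral_const) (auto simp: borel_compact)
  also have "\<dots> \<le> (LINT x:f ` T|lborel. (?v x)\<^sup>2)"
    using big fin cf
    by (intro set_integral_mono int) (auto simp: set_integrable_def borel_compact)
  also have "\<dots> \<le> (LINT x:T|lborel. (?v x)\<^sup>2)"
    unfolding set_lebesgue_integral_def using int[OF cf] int[OF T(2)] sub unfolding set_integrable_def
    by (intro integral_mono) (auto simp: indicator_def)
  \<comment> \<open>The volume of the copy contributes 4 ^ d, the squared half of the maximum
    another 4.\<close>
  finally have "(?v q)\<^sup>2 * measure lborel T \<le> 4 ^ (DIM('a) + 1) * (LINT x:T|lborel. (?v x)\<^sup>2)"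
    unfolding meas by (simp add: power_one_over field_simps)
  moreover have "(?v p)\<^sup>2 \<le> (?v q)\<^sup>2" using q(2)[OF p] by (simp add: abs_le_square_iff)
  then have "(?v p)\<^sup>2 * measure lborel T \<le> (?v q)\<^sup>2 * measure lborel T"
    by (rule mult_right_mono) simp
  ultimately show ?thesis by linarith
qed

lemma measure_subset_cball_le:
  fixes S :: "'a::euclidean_space set"
  assumes "S \<subseteq> cball p r" "r \<ge> 0" "S \<in> lmeasurable"
  shows "measure lebesgue S \<le> (2 * r) ^ DIM('a)"
proof -
  have "cball p r \<subseteq> cbox (p - r *\<^sub>R One) (p + r *\<^sub>R One)"
  proof
    fix x assume "x \<in> cball p r"
    then have "\<bar>(x - p) \<bullet> i\<bar> \<le> r" if "i \<in> Basis" for i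
      using Basis_le_norm[OF that, of "x - p"] by (simp add: dist_norm norm_minus_commute)
    then show "x \<in> cbox (p - r *\<^sub>R One) (p + r *\<^sub>R One)"
      by (auto simp: mem_box inner_simps abs_le_iff) fastforce+
  qed
  then have "measure lebesgue S \<le> measure lebesgue (cbox (p - r *\<^sub>R One) (p + r *\<^sub>R One))"
    using assms by (intro measure_mono_fmeasurable) auto
  also have "\<dots> = (\<Prod>i\<in>(Basis::'a set). 2 * r)"
  proof -
    have "measure lebesgue (cbox (p - r *\<^sub>R One) (p + r *\<^sub>R One))
      = (\<Prod>i\<in>Basis. (p + r *\<^sub>R One) \<bullet> i - (p - r *\<^sub>R One) \<bullet> i)"
      using \<open>r \<ge> 0\<close> by (simp only: measure_lborel_cbox_eq measure_completion sets_lborel borel_closed[OF closed_cbox]) (simp add: inner_simps)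
    also have "\<dots> = (\<Prod>i\<in>(Basis::'a set). 2 * r)"
      by (intro prod.cong refl) (simp add: inner_simps)
    finally show ?thesis .
  qed
  finally show ?thesis by simp
qed

section \<open>Starting points whose path meets a given set\<close>

text \<open>The Minkowski sum of S and the segment from - t e to 0. Its measure is the integral over
  all starting points x of the indicator that the path from x to x + t e meets S.\<close>

definition sweep :: "real \<Rightarrow> 'a::real_vector \<Rightarrow> 'a set \<Rightarrow> 'a set" where
  "sweep t e S = {x. \<exists>s\<in>{0..t}. x + s *\<^sub>R e \<in> S}"

lemma compact_sweep:
  fixes e :: "'a::euclidean_space"
  assumes "compact S"
  shows "compact (sweep t e S)"
proof -
  have "sweep t e S = (\<lambda>(y, s). y - s *\<^sub>R e) ` (S \<times> {0..t})"
    unfolding sweep_def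
  proof (intro set_eqI iffI)
    fix x assume "x \<in> {x. \<exists>s\<in>{0..t}. x + s *\<^sub>R e \<in> S}"
    then obtain s where "s \<in> {0..t}" "x + s *\<^sub>R e \<in> S" by blast
    then show "x \<in> (\<lambda>(y, s). y - s *\<^sub>R e) ` (S \<times> {0..t})"
      by (intro image_eqI[of _ _ "(x + s *\<^sub>R e, s)"]) auto
  next
    fix x assume "x \<in> (\<lambda>(y, s). y - s *\<^sub>R e) ` (S \<times> {0..t})"
    then obtain y s where "y \<in> S" "s \<in> {0..t}" "x = y - s *\<^sub>R e" by auto
    then show "x \<in> {x. \<exists>s\<in>{0..t}. x + s *\<^sub>R e \<in> S}" by (intro CollectI bexI[of _ s]) auto
  qed
  moreover have "compact ((\<lambda>(y, s). y - s *\<^sub>R e) ` (S \<times> {0..t}))"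
    using assms by (intro compact_continuous_image compact_Times) (auto intro!: continuous_intros simp: case_prod_unfold)
  ultimately show ?thesis by simp
qed

lemma sweep_subset_cball:
  fixes e :: "'a::real_normed_vector"
  assumes "norm e = 1" "p \<in> S" "bounded S"
  shows "sweep t e S \<subseteq> cball p (diameter S + t)"
proof
  fix x assume "x \<in> sweep t e S"
  then obtain s where s: "0 \<le> s" "s \<le> t" "x + s *\<^sub>R e \<in> S" by (auto simp: sweep_def)
  have "dist p x \<le> dist p (x + s *\<^sub>R e) + dist (x + s *\<^sub>R e) x" by (rule dist_triangle)
  also have "dist (x + s *\<^sub>R e) x = s" using s assms by (simp add: dist_norm)
  also have "dist p (x + s *\<^sub>R e) \<le> diameter S" using assms s by (intro diameter_bounded_bound) auto
  finally show "x \<in> cball p (diameter S + t)" using s by simp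
qed

text \<open>The sweep lies in a ball of radius 2 D, hence in a cube of side 4 D.\<close>

lemma measure_sweep_le:
  fixes e :: "'a::euclidean_space"
  assumes e: "norm e = 1" and S: "compact S" "S \<noteq> {}" and t: "0 \<le> t" "diameter S \<le> D" "t \<le> D"
  shows "measure lebesgue (sweep t e S) \<le> (4 * D) ^ DIM('a)"
proof -
  obtain p where p: "p \<in> S" using S by blast
  have D0: "diameter S \<ge> 0" by (simp add: S compact_imp_bounded diameter_ge_0)
  have "measure lebesgue (sweep t e S) \<le> (2 * (diameter S + t)) ^ DIM('a)"
    using t D0 by (intro measure_subset_cball_le[OF sweep_subset_cball[OF e p]])
      (auto simp: S compact_imp_bounded intro!: lmeasurable_compact compact_sweep)
  also have "\<dots> \<le> (4 * D) ^ DIM('a)" using t D0 by (intro power_mono) auto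
  finally show ?thesis .
qed

text \<open>For a facet this says that \<open>e\<close> is parallel to its affine hull.\<close>

definition meets_line_twice :: "'a::real_vector \<Rightarrow> 'a set \<Rightarrow> bool" where
  "meets_line_twice e S \<longleftrightarrow> (\<exists>y\<in>S. \<exists>s. s \<noteq> 0 \<and> y + s *\<^sub>R e \<in> S)"

text \<open>These lines lie in the affine hull of S and one further point p + e with p in S, whose
  dimension exceeds that of S by at most one.\<close>

lemma negligible_lines_through:
  fixes e :: "'a::euclidean_space"
  assumes "aff_dim S \<le> int DIM('a) - 2"
  shows "negligible {x. \<exists>s. x + s *\<^sub>R e \<in> S}"
proof (cases "S = {}")
  case False
  then obtain p where p: "p \<in> S" by blast
  let ?A = "affine hull (insert (p + e) S)"
  have "aff_dim ?A < int DIM('a)"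
    using assms by (simp add: aff_dim_insert)
  moreover have "{x. \<exists>s. x + s *\<^sub>R e \<in> S} \<subseteq> ?A"
  proof clarify
    fix x s assume "x + s *\<^sub>R e \<in> S"
    then have "(x + s *\<^sub>R e) + (- s) *\<^sub>R ((p + e) - p) \<in> ?A"
      using p by (intro mem_affine_3_minus) (auto intro: hull_inc)
    then show "x \<in> ?A" by simp
  qed
  ultimately show ?thesis using negligible_aff_dim_less negligible_subset by blast
qed auto

text \<open>Here \<open>e\<close> is a direction of the affine hull of S, so the lines stay in this
  hull.\<close>

lemma negligible_lines_through_parallel:
  fixes e :: "'a::euclidean_space"
  assumes "aff_dim S < int DIM('a)" "meets_line_twice e S"
  shows "negligible {x. \<exists>s. x + s *\<^sub>R e \<in> S}"
proof -
  obtain y r where y: "y \<in> S" "r \<noteq> 0" "y + r *\<^sub>R e \<in> S" using assms by (auto simp: meets_line_twice_def)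
  have "{x. \<exists>s. x + s *\<^sub>R e \<in> S} \<subseteq> affine hull S"
  proof clarify
    fix x s assume "x + s *\<^sub>R e \<in> S"
    then have "(x + s *\<^sub>R e) + (- s / r) *\<^sub>R ((y + r *\<^sub>R e) - y) \<in> affine hull S"
      using y by (intro mem_affine_3_minus) (auto intro: hull_inc)
    then show "x \<in> affine hull S" using y by simp
  qed
  moreover have "negligible (affine hull S)" using assms by (intro negligible_aff_dim_less) simp
  ultimately show ?thesis using negligible_subset by blast
qed

text \<open>About \<open>D / t\<close> translates of the sweep are almost disjoint and fit into a ball of
  radius \<open>2 D\<close>.\<close>

lemma measure_sweep_thin_le:
  fixes e :: "'a::euclidean_space"
  assumes e: "norm e = 1" and S: "compact S" "S \<noteq> {}" "aff_dim S < int DIM('a)"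
    and t: "0 < t" "diameter S \<le> D" "t \<le> D"
  shows "measure lebesgue (sweep t e S) \<le> 2 * t * (4 * D) ^ DIM('a) / D"
proof (cases "meets_line_twice e S")
  case True
  have "sweep t e S \<subseteq> {x. \<exists>s. x + s *\<^sub>R e \<in> S}" by (auto simp: sweep_def)
  then have "negligible (sweep t e S)"
    using negligible_lines_through_parallel[OF S(3) True] negligible_subset by blast
  then show ?thesis using t by (simp add: negligible_imp_measure0)
next
  case False
  \<comment> \<open>So many translates by multiples of t fit into the sweep of length D; rounding
    down costs at most a factor 2 because D / t is at least 1.\<close>
  define N where "N = nat \<lfloor>D / t\<rfloor>"
  have q1: "D / t \<ge> 1" using t by simp
  have N1: "real N \<le> D / t" "D / t < real N + 1" unfolding N_def using q1 by linarith+
  then have "N \<ge> 1" using q1 by linarith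
  have N2: "real N \<ge> D / (2 * t)" 
  proof -
    have "D / (2 * t) = (D / t) / 2" by simp
    then show ?thesis using N1 \<open>N \<ge> 1\<close> by linarith
  qed
  define A where "A k = (+) (- (real k * t) *\<^sub>R e) ` sweep t e S" for k
  have sm: "sweep t e S \<in> lmeasurable" using S by (intro lmeasurable_compact compact_sweep)
  have A: "x \<in> A k \<longleftrightarrow> (\<exists>s\<in>{real k * t..real k * t + t}. x + s *\<^sub>R e \<in> S)" for x k
  proof -
    have "x \<in> A k \<longleftrightarrow> x + (real k * t) *\<^sub>R e \<in> sweep t e S"
    proof
      assume "x \<in> A k"
      then show "x + (real k * t) *\<^sub>R e \<in> sweep t e S" by (auto simp: A_def)
    next
      assume "x + (real k * t) *\<^sub>R e \<in> sweep t e S"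
      then show "x \<in> A k" unfolding A_def by (intro image_eqI[of _ _ "x + (real k * t) *\<^sub>R e"]) auto
    qed
    also have "\<dots> \<longleftrightarrow> (\<exists>s\<in>{0..t}. x + (real k * t + s) *\<^sub>R e \<in> S)"
      by (simp add: sweep_def algebra_simps)
    also have "\<dots> \<longleftrightarrow> (\<exists>s\<in>(+) (real k * t) ` {0..t}. x + s *\<^sub>R e \<in> S)" by (simp only: bex_simps)
    also have "(+) (real k * t) ` {0..t} = {real k * t..real k * t + t}" by simp
    finally show ?thesis .
  qed
  have sub: "(\<Union>k<N. A k) \<subseteq> sweep D e S"
  proof clarify
    fix x k assume k: "k < N" "x \<in> A k"
    then obtain s where s: "real k * t \<le> s" "s \<le> real k * t + t" "x + s *\<^sub>R e \<in> S" by (auto simp: A)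
    have "(real k + 1) * t \<le> real N * t" using k t by (intro mult_right_mono) auto
    also have "\<dots> \<le> D" using N1 t by (simp add: field_simps)
    finally have "s \<le> D" using s by (simp add: algebra_simps)
    moreover have "0 \<le> real k * t" using t by simp
    then have "0 \<le> s" using s by linarith
    ultimately show "x \<in> sweep D e S" using s by (auto simp: sweep_def)
  qed
  \<comment> \<open>A line in direction \<open>e\<close> meets S at most once, so the parameters
    from both translates agree; this forces s = k t, and the overlap lies in a translate of the null
    set S.\<close>
  have disj: "negligible (A j \<inter> A k)" if "j < k" for j k
  proof -
    have "A j \<inter> A k \<subseteq> (+) (- (real k * t) *\<^sub>R e) ` S"
    proof
      fix x assume "x \<in> A j \<inter> A k"
      then obtain s s' where s: "s \<le> real j * t + t" "x + s *\<^sub>R e \<in> S"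
        "real k * t \<le> s'" "x + s' *\<^sub>R e \<in> S" by (auto simp: A)
      have "x + s' *\<^sub>R e = (x + s *\<^sub>R e) + (s' - s) *\<^sub>R e" by (simp add: algebra_simps)
      then have "(x + s *\<^sub>R e) + (s' - s) *\<^sub>R e \<in> S" using s by (simp only:)
      then have "s' - s = 0" using False s(2) unfolding meets_line_twice_def by blast
      then have "s' = s" by simp
      moreover have "(real j + 1) * t \<le> real k * t" using that t by (intro mult_right_mono) auto
      ultimately have "s = real k * t" using s by (simp add: algebra_simps)
      then show "x \<in> (+) (- (real k * t) *\<^sub>R e) ` S"
        using s by (intro image_eqI[of _ _ "x + s *\<^sub>R e"]) auto
    qed
    moreover have "negligible ((+) (- (real k * t) *\<^sub>R e) ` S)"
      using negligible_aff_dim_less[OF S(3)] by (rule negligible_translation)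
    ultimately show ?thesis by (rule negligible_subset[rotated])
  qed
  have "pairwise (\<lambda>j k. negligible (A j \<inter> A k)) {..<N}"
  proof (rule pairwiseI)
    fix j k :: nat assume "j \<noteq> k"
    then consider "j < k" | "k < j" by linarith
    then show "negligible (A j \<inter> A k)" using disj[of j k] disj[of k j] by cases (simp_all add: Int_commute)
  qed
  moreover have Am: "A k \<in> lmeasurable" for k
    unfolding A_def using sm by (rule measurable_translation)
  ultimately have "measure lebesgue (\<Union>k<N. A k) = (\<Sum>k<N. measure lebesgue (A k))"
    by (intro measure_negligible_finite_Union_image) auto
  also have "\<dots> = real N * measure lebesgue (sweep t e S)"
    unfolding A_def by (simp only: measure_translation sum_constant card_lessThan)
  finally have "real N * measure lebesgue (sweep t e S) = measure lebesgue (\<Union>k<N. A k)" by simp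
  also have "\<dots> \<le> measure lebesgue (sweep D e S)"
    using sub Am S by (intro measure_mono_fmeasurable) (auto intro!: lmeasurable_compact compact_sweep sets.finite_UN fmeasurableD)
  also have "\<dots> \<le> (4 * D) ^ DIM('a)" using t S e by (intro measure_sweep_le) auto
  finally have le: "real N * measure lebesgue (sweep t e S) \<le> (4 * D) ^ DIM('a)" .
  have "D / (2 * t) * measure lebesgue (sweep t e S) \<le> real N * measure lebesgue (sweep t e S)"
    using N2 by (intro mult_right_mono) auto
  with le have "D / (2 * t) * measure lebesgue (sweep t e S) \<le> (4 * D) ^ DIM('a)" by linarith
  then show ?thesis using t by (simp add: field_simps)
qed

section \<open>Variation of broken affine functions along lines\<close>

text \<open>One component of a Crouzeix--Raviart function, with gradient \<open>a T\<close> and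
  constant part \<open>b T\<close> on T. The vanishing facet means enter through these two bounds,
  each of which expresses a root on the facet.\<close>

locale broken_affine = simplicial_mesh +
  fixes a :: "'a::euclidean_space set \<Rightarrow> 'a" and b :: "'a set \<Rightarrow> real"
  assumes jump_bound: "\<lbrakk>T \<in> \<T>; T' \<in> \<T>; T \<noteq> T'; (T \<inter> T') facet_of T; p \<in> T \<inter> T'\<rbrakk> \<Longrightarrow>
      \<bar>(a T \<bullet> p + b T) - (a T' \<bullet> p + b T')\<bar> \<le> diameter (T \<inter> T') * (norm (a T) + norm (a T'))"
    and boundary_bound: "\<lbrakk>T \<in> \<T>; boundary_facet T F; p \<in> F\<rbrakk> \<Longrightarrow>
      \<bar>a T \<bullet> p + b T\<bar> \<le> diameter F * norm (a T)"
begin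

definition val :: "'a set \<Rightarrow> 'a \<Rightarrow> real" where
  "val T p = a T \<bullet> p + b T"

text \<open>The bound of \<open>affine_sup_le_l2\<close> for the squared supremum on T. Weighted
  with the volumes, it sums up to exactly a multiple of the squared norm, which the supremum itself
  does not.\<close>

definition sup_sq :: "'a set \<Rightarrow> real" where
  "sup_sq T = 4 ^ (DIM('a) + 1) * (LINT x:T|lborel. (val T x)\<^sup>2) / measure lborel T"

text \<open>\<open>energy \<theta> T\<close> dominates \<open>2 |\<nabla>v| sup |v|\<close> on \<open>T\<close>; a small \<open>\<theta>\<close> makes the
  contribution of the function small compared with that of its gradient.\<close>

definition energy :: "real \<Rightarrow> 'a set \<Rightarrow> real" where
  "energy \<theta> T = \<theta> * sup_sq T + (norm (a T))\<^sup>2 / \<theta>"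

text \<open>On common faces the values of all adjacent elements are added up; these faces form a
  null set.\<close>

definition fun_of :: "'a \<Rightarrow> real" where
  "fun_of x = (\<Sum>T\<in>\<T>. indicator T x * val T x)"

text \<open>The line argument evaluates the function at every point of a line, also on facets, where
  \<open>fun_of\<close> is a sum of several values; choosing one element per point repairs
  this.\<close>

definition chosen :: "'a \<Rightarrow> 'a set" where
  "chosen p = (SOME T. T \<in> \<T> \<and> p \<in> T)"

definition chosen_sq :: "'a \<Rightarrow> real" where
  "chosen_sq p = (if p \<in> \<Union>\<T> then signed_square (val (chosen p) p) else 0)"

lemma chosen: "p \<in> \<Union>\<T> \<Longrightarrow> chosen p \<in> \<T> \<and> p \<in> chosen p"
  unfolding chosen_def by (rule someI_ex) blast

lemma measure_pos: "T \<in> \<T> \<Longrightarrow> measure lborel T > 0"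
  using measure_simplex_pos[OF full, of T] measure_completion[of T lborel] borel_compact[OF elem(2)[of T]] by simp

lemma bounded_elem: "T \<in> \<T> \<Longrightarrow> bounded T"
  by (simp add: compact_imp_bounded elem)

lemma val_sq_le:
  assumes "T \<in> \<T>" "p \<in> T"
  shows "(val T p)\<^sup>2 \<le> sup_sq T"
  using affine_sup_le_l2[OF elem(1,2)[OF assms(1)] assms(2), of "a T" "b T"] measure_pos[OF assms(1)]
  by (simp add: sup_sq_def val_def field_simps)

lemma abs_val_le: "T \<in> \<T> \<Longrightarrow> p \<in> T \<Longrightarrow> \<bar>val T p\<bar> \<le> sqrt (sup_sq T)"
  using val_sq_le real_sqrt_le_mono[of "(val T p)\<^sup>2" "sup_sq T"] by simp

lemma sup_sq_nonneg: "T \<in> \<T> \<Longrightarrow> sup_sq T \<ge> 0"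
  using val_sq_le elem(5) by (meson ex_in_conv order_trans zero_le_power2)

lemma energy_nonneg: "T \<in> \<T> \<Longrightarrow> \<theta> > 0 \<Longrightarrow> energy \<theta> T \<ge> 0"
  by (simp add: energy_def sup_sq_nonneg)

lemma two_mult_le_weighted:
  fixes x y :: real
  assumes "\<theta> > 0"
  shows "2 * x * y \<le> \<theta> * y\<^sup>2 + x\<^sup>2 / \<theta>"
proof -
  have "0 \<le> (\<theta> * y - x)\<^sup>2 / \<theta>" using assms by simp
  also have "\<dots> = \<theta> * y\<^sup>2 + x\<^sup>2 / \<theta> - 2 * x * y"
    using assms by (simp add: power2_eq_square field_simps)
  finally show ?thesis by simp
qed

lemma grad_sup_le_energy:
  assumes "T \<in> \<T>" "\<theta> > 0"
  shows "2 * norm (a T) * sqrt (sup_sq T) \<le> energy \<theta> T"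
  using two_mult_le_weighted[OF assms(2), of "norm (a T)" "sqrt (sup_sq T)"] sup_sq_nonneg[OF assms(1)]
  by (simp add: energy_def)

lemma signed_square_val_lipschitz:
  assumes T: "T \<in> \<T>" and \<theta>: "\<theta> > 0" and pq: "p \<in> T" "q \<in> T"
  shows "\<bar>signed_square (val T p) - signed_square (val T q)\<bar> \<le> energy \<theta> T * dist p q"
proof -
  have "\<bar>signed_square (val T p) - signed_square (val T q)\<bar>
      \<le> \<bar>val T p - val T q\<bar> * (\<bar>val T p\<bar> + \<bar>val T q\<bar>)" by (rule signed_square_diff_le)
  also have "\<dots> \<le> (norm (a T) * dist p q) * (2 * sqrt (sup_sq T))"
  proof (rule mult_mono)
    have "val T p - val T q = a T \<bullet> (p - q)" by (simp add: val_def inner_simps)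
    then show "\<bar>val T p - val T q\<bar> \<le> norm (a T) * dist p q"
      by (simp add: dist_norm Cauchy_Schwarz_ineq2)
  qed (use abs_val_le[OF T pq(1)] abs_val_le[OF T pq(2)] in auto)
  also have "\<dots> = (2 * norm (a T) * sqrt (sup_sq T)) * dist p q" by simp
  also have "\<dots> \<le> energy \<theta> T * dist p q"
    using grad_sup_le_energy[OF T \<theta>] by (intro mult_right_mono) auto
  finally show ?thesis .
qed

lemma signed_square_jump:
  assumes T: "T \<in> \<T>" "T' \<in> \<T>" "T \<noteq> T'" and F: "(T \<inter> T') facet_of T" and p: "p \<in> T" "p \<in> T'"
    and \<theta>: "\<theta> > 0"
  shows "\<bar>signed_square (val T p) - signed_square (val T' p)\<bar>
     \<le> diameter T * energy \<theta> T + diameter T' * energy \<theta> T'"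
proof -
  define D where "D = diameter (T \<inter> T')"
  define g where "g = norm (a T)" define g' where "g' = norm (a T')"
  define m where "m = sqrt (sup_sq T)" define m' where "m' = sqrt (sup_sq T')"
  have D: "0 \<le> D" "D \<le> diameter T" "D \<le> diameter T'"
    unfolding D_def using T bounded_elem
    by (auto intro!: diameter_ge_0 diameter_subset intro: bounded_subset)
  have "\<bar>signed_square (val T p) - signed_square (val T' p)\<bar>
      \<le> \<bar>val T p - val T' p\<bar> * (\<bar>val T p\<bar> + \<bar>val T' p\<bar>)" by (rule signed_square_diff_le)
  also have "\<dots> \<le> (D * (g + g')) * (m + m')"
    unfolding D_def g_def g'_def m_def m'_def
    using jump_bound[OF T F] p abs_val_le[OF T(1) p(1)] abs_val_le[OF T(2) p(2)] D(1)
    by (intro mult_mono) (auto simp: val_def D_def)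
  also have "\<dots> = D * ((g + g') * (m + m'))" by simp
  also have "\<dots> \<le> D * (energy \<theta> T + energy \<theta> T')"
  proof (rule mult_left_mono[OF _ D(1)])
    \<comment> \<open>Young's inequality for the sums; the factor 2 on the left pays for the one
      lost in separating the mixed squares.\<close>
    have "2 * (g + g') * (m + m') \<le> \<theta> * (m + m')\<^sup>2 + (g + g')\<^sup>2 / \<theta>"
      by (rule two_mult_le_weighted[OF \<theta>])
    moreover have "\<theta> * (m + m')\<^sup>2 \<le> \<theta> * (2 * (m\<^sup>2 + m'\<^sup>2))"
      using power2_add_le[of m m'] \<theta> by (intro mult_left_mono) auto
    moreover have "(g + g')\<^sup>2 / \<theta> \<le> (2 * (g\<^sup>2 + g'\<^sup>2)) / \<theta>"
      using power2_add_le[of g g'] \<theta> by (intro divide_right_mono) auto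
    moreover have "\<theta> * (2 * (m\<^sup>2 + m'\<^sup>2)) + (2 * (g\<^sup>2 + g'\<^sup>2)) / \<theta>
      = 2 * (\<theta> * (m\<^sup>2 + m'\<^sup>2) + (g\<^sup>2 + g'\<^sup>2) / \<theta>)" by (simp add: algebra_simps)
    moreover have "2 * (g + g') * (m + m') = 2 * ((g + g') * (m + m'))" by simp
    ultimately have "(g + g') * (m + m') \<le> \<theta> * (m\<^sup>2 + m'\<^sup>2) + (g\<^sup>2 + g'\<^sup>2) / \<theta>" by linarith
    then show "(g + g') * (m + m') \<le> energy \<theta> T + energy \<theta> T'"
      using sup_sq_nonneg[OF T(1)] sup_sq_nonneg[OF T(2)]
      by (simp add: energy_def g_def g'_def m_def m'_def add_divide_distrib algebra_simps)
  qed
  also have "\<dots> \<le> diameter T * energy \<theta> T + diameter T' * energy \<theta> T'"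
    using D energy_nonneg[OF T(1) \<theta>] energy_nonneg[OF T(2) \<theta>]
    by (simp add: distrib_left add_mono mult_right_mono)
  finally show ?thesis .
qed

lemma signed_square_boundary:
  assumes T: "T \<in> \<T>" and F: "boundary_facet T F" "p \<in> F" and \<theta>: "\<theta> > 0"
  shows "\<bar>signed_square (val T p)\<bar> \<le> diameter T * energy \<theta> T"
proof -
  have FT: "F \<subseteq> T" using F by (auto simp: boundary_facet_def facet_of_def face_of_imp_subset)
  have D: "0 \<le> diameter F" "diameter F \<le> diameter T"
    using T FT bounded_elem by (auto intro!: diameter_ge_0 diameter_subset intro: bounded_subset)
  have "\<bar>signed_square (val T p)\<bar> = \<bar>val T p\<bar> * \<bar>val T p\<bar>" by (simp add: power2_eq_square)
  also have "\<dots> \<le> (diameter F * norm (a T)) * sqrt (sup_sq T)"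
    using boundary_bound[OF T F] abs_val_le[OF T, of p] FT F(2)
    by (intro mult_mono) (auto simp: val_def)
  also have "\<dots> \<le> (diameter T * norm (a T)) * sqrt (sup_sq T)"
    using D sup_sq_nonneg[OF T] by (intro mult_right_mono) auto
  also have "\<dots> = diameter T * (norm (a T) * sqrt (sup_sq T))" by simp
  also have "\<dots> \<le> diameter T * energy \<theta> T"
  proof (rule mult_left_mono)
    have "0 \<le> norm (a T) * sqrt (sup_sq T)" using sup_sq_nonneg[OF T] by simp
    then show "norm (a T) * sqrt (sup_sq T) \<le> energy \<theta> T"
      using grad_sup_le_energy[OF T \<theta>] by linarith
  qed (use D in linarith)
  finally show ?thesis .
qed

text \<open>Every other line in direction \<open>e\<close> meets each facet in at most one point and
  misses all faces of codimension two.\<close>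

definition bad_lines :: "'a \<Rightarrow> 'a set" where
  "bad_lines e = (\<Union>T\<in>\<T>. \<Union>F\<in>{F. F face_of T \<and>
      (aff_dim F \<le> int DIM('a) - 2 \<or> F facet_of T \<and> meets_line_twice e F)}. {x. \<exists>s. x + s *\<^sub>R e \<in> F})"

lemma negligible_bad_lines: "negligible (bad_lines e)"
proof -
  have "negligible {x. \<exists>s. x + s *\<^sub>R e \<in> F}"
    if "T \<in> \<T>" "aff_dim F \<le> int DIM('a) - 2 \<or> F facet_of T \<and> meets_line_twice e F" for T F
    using that negligible_lines_through[of F e] negligible_lines_through_parallel[of F e] elem(4)[of T]
    by (auto simp: facet_of_def)
  moreover have "finite {F. F face_of T \<and>
      (aff_dim F \<le> int DIM('a) - 2 \<or> F facet_of T \<and> meets_line_twice e F)}" if "T \<in> \<T>" for T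
    by (rule finite_subset[OF _ finite_polytope_faces[OF elem(3)[OF that]]]) auto
  ultimately show ?thesis
    unfolding bad_lines_def using fin by (intro negligible_Union finite_imageI) (auto intro!: negligible_Union)
qed

text \<open>A number rather than a proposition, so that hits can be weighted and added.\<close>

definition meets :: "'a \<Rightarrow> 'a \<Rightarrow> 'a set \<Rightarrow> real set \<Rightarrow> real" where
  "meets x e F I = of_bool (\<exists>s\<in>I. x + s *\<^sub>R e \<in> F)"

text \<open>Inside an element the function changes at most at the rate
  \<open>energy \<theta> T\<close>; at a crossed facet it jumps by at most the sum of diameter times
  energy over the elements involved. The bisection principle for intervals replaces an enumeration
  of the crossings: the bound is additive over adjacent intervals and holds on short intervals
  around every parameter.\<close>

lemma chosen_sq_diff_le:
  assumes e: "norm e = 1" and \<theta>: "\<theta> > 0" and t: "t \<ge> 0" and x: "x \<notin> bad_lines e"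
  shows "\<bar>chosen_sq (x + t *\<^sub>R e) - chosen_sq x\<bar>
    \<le> (\<Sum>T\<in>\<T>. energy \<theta> T * (t * meets x e T {0..t}
          + (\<Sum>F | F facet_of T. 2 * diameter T * meets x e F {0..t})))"
proof -
  define L where "L = (\<Sum>T\<in>\<T>. energy \<theta> T * meets x e T {0..t})"
  \<comment> \<open>Two half-open intervals: a hit at an end point is counted by at least one of
    them, while adjacent intervals never count the same hit twice.\<close>
  define X where "X \<alpha> \<beta> = (\<Sum>T\<in>\<T>. \<Sum>F | F facet_of T. diameter T * energy \<theta> T *
      (meets x e F {\<alpha>..<\<beta>} + meets x e F {\<alpha><..\<beta>}))" for \<alpha> \<beta>
  define P where "P \<alpha> \<beta> \<longleftrightarrow> (0 \<le> \<alpha> \<and> \<alpha> \<le> \<beta> \<and> \<beta> \<le> t \<longrightarrow>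
      \<bar>chosen_sq (x + \<beta> *\<^sub>R e) - chosen_sq (x + \<alpha> *\<^sub>R e)\<bar> \<le> (\<beta> - \<alpha>) * L + X \<alpha> \<beta>)" for \<alpha> \<beta>
  have DE: "diameter T * energy \<theta> T \<ge> 0" if "T \<in> \<T>" for T
    using energy_nonneg[OF that \<theta>] diameter_ge_0[OF bounded_elem[OF that]] by simp
  have m01: "meets x e F I \<ge> 0" "meets x e F I \<le> 1" for F I by (auto simp: meets_def)
  have finF: "finite {F. F facet_of T}" if "T \<in> \<T>" for T
    by (rule finite_subset[OF _ finite_polytope_faces[OF elem(3)[OF that]]]) (auto simp: facet_of_def)
  have "P 0 t"
  proof (rule Bolzano[OF t])
    fix \<alpha> \<beta> \<delta> assume P: "P \<alpha> \<beta>" "P \<beta> \<delta>" and le: "\<alpha> \<le> \<beta>" "\<beta> \<le> \<delta>"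
    \<comment> \<open>A line that hits a facet in two disjoint parameter sets meets it twice and is
      therefore bad.\<close>
    have split: "meets x e F A + meets x e F B \<le> meets x e F (A \<union> B)"
      if "T \<in> \<T>" "F facet_of T" "A \<inter> B = {}" for T F A B
    proof -
      have "False" if h: "s \<in> A" "x + s *\<^sub>R e \<in> F" "s' \<in> B" "x + s' *\<^sub>R e \<in> F" for s s'
      proof -
        have ne: "s' - s \<noteq> 0" using h \<open>A \<inter> B = {}\<close> by auto
        have "(x + s *\<^sub>R e) + (s' - s) *\<^sub>R e \<in> F" using h by (simp add: algebra_simps)
        then have "meets_line_twice e F" unfolding meets_line_twice_def using h(2) ne by blast
        then have "x \<in> bad_lines e"
          unfolding bad_lines_def using h(2) \<open>T \<in> \<T>\<close> \<open>F facet_of T\<close> by (auto simp: facet_of_def)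
        then show False using x by blast
      qed
      then show ?thesis unfolding meets_def by (auto simp: of_bool_def)
    qed
    have "X \<alpha> \<beta> + X \<beta> \<delta> \<le> X \<alpha> \<delta>"
      unfolding X_def sum.distrib[symmetric]
    proof (intro sum_mono)
      fix T F assume T: "T \<in> \<T>" and F: "F \<in> {F. F facet_of T}"
      have "meets x e F {\<alpha>..<\<beta>} + meets x e F {\<beta>..<\<delta>} \<le> meets x e F {\<alpha>..<\<delta>}"
        using split[OF T, of F "{\<alpha>..<\<beta>}" "{\<beta>..<\<delta>}"] F le by (simp add: ivl_disj_un ivl_disj_int)
      moreover have "meets x e F {\<alpha><..\<beta>} + meets x e F {\<beta><..\<delta>} \<le> meets x e F {\<alpha><..\<delta>}"
        using split[OF T, of F "{\<alpha><..\<beta>}" "{\<beta><..\<delta>}"] F le by (simp add: ivl_disj_un ivl_disj_int)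
      ultimately have "(meets x e F {\<alpha>..<\<beta>} + meets x e F {\<alpha><..\<beta>}) + (meets x e F {\<beta>..<\<delta>} + meets x e F {\<beta><..\<delta>})
        \<le> meets x e F {\<alpha>..<\<delta>} + meets x e F {\<alpha><..\<delta>}" by linarith
      from mult_left_mono[OF this DE[OF T]]
      show "diameter T * energy \<theta> T * (meets x e F {\<alpha>..<\<beta>} + meets x e F {\<alpha><..\<beta>}) +
         diameter T * energy \<theta> T * (meets x e F {\<beta>..<\<delta>} + meets x e F {\<beta><..\<delta>})
         \<le> diameter T * energy \<theta> T * (meets x e F {\<alpha>..<\<delta>} + meets x e F {\<alpha><..\<delta>})"
        by (simp only: distrib_left)
    qed
    then show "P \<alpha> \<delta>"
      using P le unfolding P_def by (auto simp: left_diff_distrib)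
  next
    fix s0 assume s0: "0 \<le> s0" "s0 \<le> t"
    define p where "p = x + s0 *\<^sub>R e"
    \<comment> \<open>The elements that miss p form a closed set, so close to p only elements
      containing p occur.\<close>
    define U where "U = \<Union>{T\<in>\<T>. p \<notin> T}"
    have "closed U" unfolding U_def using fin elem(2) by (intro closed_Union) (auto intro: compact_imp_closed)
    moreover have "p \<notin> U" by (auto simp: U_def)
    ultimately obtain d1 where d1: "d1 > 0" "ball p d1 \<inter> U = {}"
      by (metis Compl_iff disjoint_eq_subset_Compl open_Compl open_contains_ball)
    \<comment> \<open>Read backwards: a point outside the mesh within distance d2 of p shows that p
      is not interior to the union of the elements.\<close>
    obtain d2 where d2: "d2 > 0" "p \<in> interior (\<Union>\<T>) \<Longrightarrow> ball p d2 \<subseteq> \<Union>\<T>"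
      by (metis mem_interior zero_less_one)
    define d where "d = min d1 d2"
    have d: "d > 0" "d \<le> d1" "d \<le> d2" using d1 d2 by (auto simp: d_def)
    \<comment> \<open>The path meets every element through p, so \<open>L\<close> dominates the
      Lipschitz rate of each of them.\<close>
    have hit_L: "energy \<theta> T \<le> L" if "T \<in> \<T>" "p \<in> T" for T
    proof -
      have "meets x e T {0..t} = 1" using that s0 by (auto simp: meets_def p_def)
      then have "energy \<theta> T = energy \<theta> T * meets x e T {0..t}" by simp
      also have "\<dots> \<le> L" unfolding L_def
        by (rule member_le_sum[OF that(1)]) (use fin m01 energy_nonneg[OF _ \<theta>] in auto)
      finally show ?thesis .
    qed
    have gen: "p \<notin> F" if "T \<in> \<T>" "F face_of T" "aff_dim F \<le> int DIM('a) - 2" for T F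
      using x that unfolding bad_lines_def p_def by blast
    have "P \<alpha> \<beta>" if ab: "\<alpha> \<le> s0" "s0 \<le> \<beta>" "\<beta> - \<alpha> < d" for \<alpha> \<beta>
    proof (cases "\<alpha> = \<beta>")
      case True
      have "X \<beta> \<beta> \<ge> 0" unfolding X_def by (intro sum_nonneg mult_nonneg_nonneg[OF DE] add_nonneg_nonneg m01)
      then show ?thesis using True by (simp add: P_def)
    next
      case False
      then have lt: "\<alpha> < \<beta>" using ab by linarith
      have inner_le: "diameter T * energy \<theta> T \<le> (\<Sum>F | F facet_of T. diameter T * energy \<theta> T *
          (meets x e F {\<alpha>..<\<beta>} + meets x e F {\<alpha><..\<beta>}))" if "T \<in> \<T>" "F facet_of T" "p \<in> F" for T F
      proof -
        have "s0 \<in> {\<alpha>..<\<beta>} \<or> s0 \<in> {\<alpha><..\<beta>}" using ab lt by auto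
        then have "meets x e F {\<alpha>..<\<beta>} = 1 \<or> meets x e F {\<alpha><..\<beta>} = 1"
          using that(3) unfolding meets_def p_def by fastforce
        then have "1 \<le> meets x e F {\<alpha>..<\<beta>} + meets x e F {\<alpha><..\<beta>}"
          using m01(1)[of F "{\<alpha>..<\<beta>}"] m01(1)[of F "{\<alpha><..\<beta>}"] by linarith
        from mult_left_mono[OF this DE[OF that(1)]]
        have "diameter T * energy \<theta> T \<le> diameter T * energy \<theta> T *
          (meets x e F {\<alpha>..<\<beta>} + meets x e F {\<alpha><..\<beta>})" by simp
        also have "\<dots> \<le> (\<Sum>F | F facet_of T. diameter T * energy \<theta> T *
          (meets x e F {\<alpha>..<\<beta>} + meets x e F {\<alpha><..\<beta>}))"
          by (rule member_le_sum) (use that finF DE[OF that(1)] m01 in auto)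
        finally show ?thesis .
      qed
      have inner_nonneg: "0 \<le> (\<Sum>F | F facet_of T. diameter T * energy \<theta> T *
          (meets x e F {\<alpha>..<\<beta>} + meets x e F {\<alpha><..\<beta>}))" if "T \<in> \<T>" for T
        by (intro sum_nonneg mult_nonneg_nonneg[OF DE[OF that]] add_nonneg_nonneg m01)
      have one: "diameter T * energy \<theta> T \<le> X \<alpha> \<beta>" if "T \<in> \<T>" "F facet_of T" "p \<in> F" for T F
        using inner_le[OF that] member_le_sum[OF that(1) inner_nonneg fin] unfolding X_def by fastforce
      have two: "diameter T * energy \<theta> T + diameter T' * energy \<theta> T' \<le> X \<alpha> \<beta>"
        if "T \<in> \<T>" "T' \<in> \<T>" "T \<noteq> T'" "F facet_of T" "F' facet_of T'" "p \<in> F" "p \<in> F'" for T T' F F'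
      proof -
        have "(\<Sum>T\<in>{T, T'}. \<Sum>F | F facet_of T. diameter T * energy \<theta> T *
          (meets x e F {\<alpha>..<\<beta>} + meets x e F {\<alpha><..\<beta>})) \<le> X \<alpha> \<beta>"
          unfolding X_def by (rule sum_mono2[OF fin]) (use that inner_nonneg in auto)
        then show ?thesis using inner_le[of T F] inner_le[of T' F'] that by simp
      qed
      have X0: "X \<alpha> \<beta> \<ge> 0" unfolding X_def by (intro sum_nonneg inner_nonneg)
      \<comment> \<open>The piece active at \<open>q\<close>, evaluated at \<open>p\<close>: this
        separates the change inside an element (\<open>smooth\<close>) from the jump at
        \<open>p\<close> (\<open>cross\<close>).\<close>
      define w where "w q = (if q \<in> \<Union>\<T> then signed_square (val (chosen q) p) else 0)" for q
      have near: "q \<in> T \<Longrightarrow> T \<in> \<T> \<Longrightarrow> p \<in> T" if "q \<in> ball p d" for q T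
      proof (rule ccontr)
        assume "q \<in> T" "T \<in> \<T>" "p \<notin> T"
        then have "q \<in> U" unfolding U_def by blast
        moreover have "q \<in> ball p d1" using d(2) that by simp
        ultimately show False using d1(2) by blast
      qed
      have inball: "x + s *\<^sub>R e \<in> ball p d" if "\<alpha> \<le> s" "s \<le> \<beta>" for s
      proof -
        have "p - (x + s *\<^sub>R e) = (s0 - s) *\<^sub>R e" by (simp add: p_def algebra_simps)
        then have "dist p (x + s *\<^sub>R e) = \<bar>s0 - s\<bar>" using e by (simp add: dist_norm)
        then show ?thesis using that ab by auto
      qed
      have L0: "L \<ge> 0" unfolding L_def using energy_nonneg[OF _ \<theta>] m01 by (intro sum_nonneg mult_nonneg_nonneg) auto
      have smooth: "\<bar>chosen_sq (x + s *\<^sub>R e) - w (x + s *\<^sub>R e)\<bar> \<le> L * \<bar>s - s0\<bar>" if "\<alpha> \<le> s" "s \<le> \<beta>" for s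
      proof (cases "x + s *\<^sub>R e \<in> \<Union>\<T>")
        case True
        define q where "q = x + s *\<^sub>R e"
        have T: "chosen q \<in> \<T>" "q \<in> chosen q" using chosen[of q] True by (auto simp: q_def)
        have pT: "p \<in> chosen q" using near[OF inball[OF that]] T by (auto simp: q_def)
        have "q - p = (s - s0) *\<^sub>R e" by (simp add: p_def q_def algebra_simps)
        then have dq: "dist q p = \<bar>s - s0\<bar>" using e by (simp add: dist_norm)
        have "\<bar>signed_square (val (chosen q) q) - signed_square (val (chosen q) p)\<bar> \<le> energy \<theta> (chosen q) * dist q p"
          by (rule signed_square_val_lipschitz[OF T(1) \<theta> T(2) pT])
        also have "\<dots> \<le> L * dist q p" using hit_L[OF T(1) pT] by (intro mult_right_mono) auto
        finally show ?thesis using True by (simp add: chosen_sq_def w_def q_def[symmetric] dq)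
      next
        case False
        then show ?thesis using L0 by (auto simp: chosen_sq_def w_def)
      qed
      have facet_p: "(T \<inter> T') facet_of T \<and> (T \<inter> T') facet_of T'" if "T \<in> \<T>" "T' \<in> \<T>" "T \<noteq> T'" "p \<in> T" "p \<in> T'" for T T'
        using inter_cases[OF that(1-3)] gen[OF that(1) inter_face[OF that(1,2)]] that(4,5) by blast
      have cross: "\<bar>w q - w q'\<bar> \<le> X \<alpha> \<beta>" if q: "q \<in> ball p d" "q' \<in> ball p d" for q q'
      proof -
        have out: "\<bar>signed_square (val (chosen q1) p)\<bar> \<le> X \<alpha> \<beta>"
          if "q1 \<in> ball p d" "q2 \<in> ball p d" "q1 \<in> \<Union>\<T>" "q2 \<notin> \<Union>\<T>" for q1 q2
        proof -
          have T: "chosen q1 \<in> \<T>" "q1 \<in> chosen q1" using chosen[of q1] that by auto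
          have pT: "p \<in> chosen q1" using near[OF that(1)] T by auto
          have "q2 \<in> ball p d2" using that(2) d(3) by simp
          then have "p \<notin> interior (\<Union>\<T>)" using d2(2) that(4) by blast
          then obtain F where F: "boundary_facet (chosen q1) F" "p \<in> F"
            using boundary_facet_through_point[OF T(1) pT _ gen[OF T(1)]] by blast
          then show ?thesis
            using signed_square_boundary[OF T(1) F \<theta>] one[OF T(1) _ F(2)]
            by (auto simp: boundary_facet_def)
        qed
        consider "q \<in> \<Union>\<T>" "q' \<in> \<Union>\<T>" | "q \<in> \<Union>\<T>" "q' \<notin> \<Union>\<T>" | "q \<notin> \<Union>\<T>" "q' \<in> \<Union>\<T>"
          | "q \<notin> \<Union>\<T>" "q' \<notin> \<Union>\<T>" by blast
        then show ?thesis
        proof cases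
          case 1
          have T: "chosen q \<in> \<T>" "q \<in> chosen q" "chosen q' \<in> \<T>" "q' \<in> chosen q'"
            using chosen 1 by auto
          have pT: "p \<in> chosen q" "p \<in> chosen q'" using near[OF q(1)] near[OF q(2)] T by auto
          show ?thesis
          proof (cases "chosen q = chosen q'")
            case False
            note F = facet_p[OF T(1,3) False pT]
            show ?thesis
              using signed_square_jump[OF T(1,3) False _ pT \<theta>]
                two[OF T(1,3) False, of "chosen q \<inter> chosen q'" "chosen q \<inter> chosen q'"] F pT
              unfolding w_def if_P[OF 1(1)] if_P[OF 1(2)] by auto
          next
            case True
            then have "w q = w q'" unfolding w_def if_P[OF 1(1)] if_P[OF 1(2)] by simp
            then show ?thesis using X0 by simp
          qed
        next
          case 2
          then show ?thesis
            using out[OF q] unfolding w_def if_P[OF 2(1)] if_not_P[OF 2(2)] by simp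
        next
          case 3
          then show ?thesis
            using out[OF q(2,1)] unfolding w_def if_P[OF 3(2)] if_not_P[OF 3(1)] by simp
        next
          case 4
          then show ?thesis using X0 unfolding w_def if_not_P[OF 4(1)] if_not_P[OF 4(2)] by simp
        qed
      qed
      show ?thesis unfolding P_def
      proof (intro impI)
        assume "0 \<le> \<alpha> \<and> \<alpha> \<le> \<beta> \<and> \<beta> \<le> t"
        have 1: "\<bar>chosen_sq (x + \<beta> *\<^sub>R e) - w (x + \<beta> *\<^sub>R e)\<bar> \<le> L * (\<beta> - s0)"
          using smooth[of \<beta>] ab lt by simp
        have 2: "\<bar>chosen_sq (x + \<alpha> *\<^sub>R e) - w (x + \<alpha> *\<^sub>R e)\<bar> \<le> L * (s0 - \<alpha>)"
          using smooth[of \<alpha>] ab lt by simp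
        have 3: "\<bar>w (x + \<beta> *\<^sub>R e) - w (x + \<alpha> *\<^sub>R e)\<bar> \<le> X \<alpha> \<beta>"
          using lt by (intro cross inball) auto
        have "L * (\<beta> - s0) + L * (s0 - \<alpha>) = (\<beta> - \<alpha>) * L" by (simp add: algebra_simps)
        with 1 2 3 show "\<bar>chosen_sq (x + \<beta> *\<^sub>R e) - chosen_sq (x + \<alpha> *\<^sub>R e)\<bar> \<le> (\<beta> - \<alpha>) * L + X \<alpha> \<beta>"
          by linarith
      qed
    qed
    then show "\<exists>d>0. \<forall>\<alpha> \<beta>. \<alpha> \<le> s0 \<and> s0 \<le> \<beta> \<and> \<beta> - \<alpha> < d \<longrightarrow> P \<alpha> \<beta>" using d by blast
  qed
  then have "\<bar>chosen_sq (x + t *\<^sub>R e) - chosen_sq x\<bar> \<le> t * L + X 0 t"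
    using t by (simp add: P_def)
  \<comment> \<open>Both half-open intervals are contained in the closed one, whence the factor
    2.\<close>
  also have "X 0 t \<le> (\<Sum>T\<in>\<T>. \<Sum>F | F facet_of T. diameter T * energy \<theta> T * (2 * meets x e F {0..t}))"
    unfolding X_def
  proof (intro sum_mono mult_left_mono)
    fix T F
    have "meets x e F {0..<t} \<le> meets x e F {0..t}" "meets x e F {0<..t} \<le> meets x e F {0..t}"
      unfolding meets_def by (auto simp: of_bool_def)
    then show "meets x e F {0..<t} + meets x e F {0<..t} \<le> 2 * meets x e F {0..t}" by linarith
  qed (use DE in auto)
  finally show ?thesis
    unfolding L_def by (simp add: sum_distrib_left sum.distrib distrib_left algebra_simps)
qed

end

section \<open>Integration over parallel lines and the translation estimate\<close>

lemma card_facets_simplex: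
  fixes T :: "'a::euclidean_space set"
  assumes "n simplex T"
  shows "int (card {F. F facet_of T}) \<le> n + 1"
proof -
  obtain C where C: "\<not> affine_dependent C" "int (card C) = n + 1" "T = convex hull C"
    using assms by (auto simp: simplex_def)
  have f: "finite C" using C(1) by (rule aff_independent_finite)
  have sub: "{F. F facet_of T} \<subseteq> (\<lambda>u. convex hull (C - {u})) ` C"
    unfolding C(3) using facet_of_convex_hull_affine_independent[OF C(1)] by auto
  have "card {F. F facet_of T} \<le> card C" using surj_card_le[OF f sub] .
  then show "int (card {F. F facet_of T}) \<le> n + 1" using C(2) by linarith
qed

lemma has_bochner_integral_indicator_compact:
  fixes S :: "'a::euclidean_space set"
  assumes "compact S"
  shows "has_bochner_integral lborel (indicator S :: 'a \<Rightarrow> real) (measure lborel S)"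
  using assms has_bochner_integral_real_indicator[of S lborel] emeasure_compact_finite[OF assms]
  by (simp add: borel_compact)

text \<open>Sweeps are measured by (4 D) ^ n; the element counts once and each of its at most n + 1
  facets four times, which makes 1 + 4 (n + 1) in all.\<close>

definition shape_const :: "nat \<Rightarrow> real" where
  "shape_const n = 4 ^ n * (4 * real n + 5)"

lemma shape_const_pos: "shape_const n > 0"
  by (simp add: shape_const_def)

context broken_affine
begin

definition skeleton :: "'a set" where
  "skeleton = (\<Union>T\<in>\<T>. frontier T)"

lemma negligible_skeleton: "negligible skeleton"
  unfolding skeleton_def using fin elem(1) by (intro negligible_Union) (auto intro: negligible_convex_frontier)

lemma in_interior:
  assumes "T \<in> \<T>" "p \<in> T" "p \<notin> skeleton"
  shows "p \<in> interior T"
proof -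
  have "p \<notin> frontier T" using assms(1,3) unfolding skeleton_def by blast
  moreover have "p \<in> closure T" using assms(2) closure_subset by blast
  ultimately show ?thesis unfolding frontier_def by blast
qed

lemma elem_unique:
  assumes "T \<in> \<T>" "T' \<in> \<T>" "p \<in> T" "p \<in> T'" "p \<notin> skeleton"
  shows "T = T'"
proof (rule ccontr)
  assume ne: "T \<noteq> T'"
  have "p \<in> interior (T \<inter> T')"
    using in_interior assms by simp
  moreover have "interior (T \<inter> T') = {}"
    using aff_dim_inter[OF assms(1,2) ne] by (simp add: interior_rel_interior_gen)
  ultimately show False by blast
qed

lemma sum_indicator_elem:
  fixes f :: "'a set \<Rightarrow> real"
  assumes "T \<in> \<T>" "p \<in> T" "p \<notin> skeleton"
  shows "(\<Sum>T\<in>\<T>. indicator T p * f T) = f T"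
  using sum_indicator_unique[OF fin assms(1,2)] elem_unique[OF _ assms(1) _ assms(2,3)] by blast

lemma fun_of_in:
  assumes "T \<in> \<T>" "p \<in> T" "p \<notin> skeleton"
  shows "fun_of p = val T p"
  unfolding fun_of_def by (rule sum_indicator_elem[OF assms])

lemma fun_of_outside: "p \<notin> \<Union>\<T> \<Longrightarrow> fun_of p = 0"
  unfolding fun_of_def by (intro sum.neutral) auto

lemma chosen_sq_eq:
  assumes "p \<notin> skeleton"
  shows "chosen_sq p = signed_square (fun_of p)"
proof (cases "p \<in> \<Union>\<T>")
  case True
  then show ?thesis using chosen[OF True] fun_of_in[of "chosen p" p] assms
    unfolding chosen_sq_def if_P[OF True] by simp
next
  case False
  show ?thesis unfolding chosen_sq_def if_not_P[OF False] fun_of_outside[OF False] by simp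
qed

lemma borel_measurable_fun_of [measurable]: "fun_of \<in> borel_measurable borel"
proof -
  have "(\<lambda>x. indicator T x * val T x) \<in> borel_measurable borel" if "T \<in> \<T>" for T
  proof -
    have [measurable]: "T \<in> sets borel" using elem(2)[OF that] by (rule borel_compact)
    show ?thesis unfolding val_def by measurable
  qed
  then show ?thesis unfolding fun_of_def[abs_def] by (intro borel_measurable_sum) auto
qed

lemma borel_measurable_signed_square [measurable]: "signed_square \<in> borel_measurable borel"
  unfolding signed_square_def[abs_def] by measurable

definition sq_norm :: real where
  "sq_norm = (\<Sum>T\<in>\<T>. LINT x:T|lborel. (val T x)\<^sup>2)"

definition sq_grad :: real where
  "sq_grad = (\<Sum>T\<in>\<T>. measure lborel T * (norm (a T))\<^sup>2)"

lemma sq_norm_nonneg: "sq_norm \<ge> 0"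
  unfolding sq_norm_def set_lebesgue_integral_def by (intro sum_nonneg integral_nonneg_AE) auto

lemma sq_grad_nonneg: "sq_grad \<ge> 0"
  unfolding sq_grad_def by (intro sum_nonneg) auto

lemma diameter_pos: "T \<in> \<T> \<Longrightarrow> diameter T > 0"
proof (rule ccontr)
  assume T: "T \<in> \<T>" and "\<not> diameter T > 0"
  then have d0: "diameter T = 0" using diameter_ge_0[OF bounded_elem[OF T]] by simp
  obtain p where p: "p \<in> T" using elem(5)[OF T] by blast
  have "T \<subseteq> {p}"
    using diameter_bounded_bound[OF bounded_elem[OF T] p] d0 by auto
  then have "measure lebesgue T \<le> measure lebesgue {p}"
    using elem(2)[OF T] by (intro measure_mono_fmeasurable) (auto intro: lmeasurable_compact fmeasurableD)
  then show False using measure_simplex_pos[OF full[OF T]] by simp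
qed

text \<open>The diameter in front of each facet term cancels the denominator in
  \<open>measure_sweep_thin_le\<close>; what remains is a multiple of t D ^ d, which shape
  regularity bounds by t times the volume of T.\<close>

lemma sweep_bound:
  assumes e: "norm e = 1" and t: "0 < t" "t \<le> diameter T" and T: "T \<in> \<T>"
    and c: "diameter T ^ DIM('a) \<le> c * measure lborel T"
  shows "t * measure lborel (sweep t e T) + (\<Sum>F | F facet_of T. 2 * diameter T * measure lborel (sweep t e F))
    \<le> t * (shape_const DIM('a) * c * measure lborel T)"
proof -
  let ?D = "diameter T" and ?d = "DIM('a)"
  have D: "?D > 0" by (rule diameter_pos[OF T])
  have eq: "measure lborel (sweep t e S) = measure lebesgue (sweep t e S)" if "compact S" for S
    using compact_sweep[OF that] by (simp add: measure_completion borel_compact)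
  have "measure lborel (sweep t e T) \<le> (4 * ?D) ^ ?d"
    unfolding eq[OF elem(2)[OF T]] using t by (intro measure_sweep_le[OF e elem(2,5)[OF T]]) auto
  then have 1: "t * measure lborel (sweep t e T) \<le> t * (4 * ?D) ^ ?d"
    using t by (intro mult_left_mono) auto
  have 2: "2 * ?D * measure lborel (sweep t e F) \<le> 4 * (t * (4 * ?D) ^ ?d)" if F: "F facet_of T" for F
  proof -
    have F': "F face_of T" "F \<noteq> {}" "aff_dim F < int ?d" "F \<subseteq> T"
      using F elem(4)[OF T] by (auto simp: facet_of_def face_of_imp_subset)
    have cF: "compact F" using F' elem[OF T] face_of_imp_compact by blast
    have "measure lborel (sweep t e F) \<le> 2 * t * (4 * ?D) ^ ?d / ?D"
      unfolding eq[OF cF] using t diameter_subset[OF F'(4) bounded_elem[OF T]]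
      by (intro measure_sweep_thin_le[OF e cF F'(2,3)]) auto
    then have "2 * ?D * measure lborel (sweep t e F) \<le> 2 * ?D * (2 * t * (4 * ?D) ^ ?d / ?D)"
      using D by (intro mult_left_mono) auto
    also have "\<dots> = 4 * (t * (4 * ?D) ^ ?d)" using D by simp
    finally show ?thesis .
  qed
  have "(\<Sum>F | F facet_of T. 2 * ?D * measure lborel (sweep t e F))
      \<le> (\<Sum>F | F facet_of T. 4 * (t * (4 * ?D) ^ ?d))"
    using 2 by (intro sum_mono) auto
  also have "\<dots> = real (card {F. F facet_of T}) * (4 * (t * (4 * ?D) ^ ?d))" by simp
  also have "\<dots> \<le> (real ?d + 1) * (4 * (t * (4 * ?D) ^ ?d))"
    using card_facets_simplex[OF full[OF T]] t D by (intro mult_right_mono) auto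
  finally have "t * measure lborel (sweep t e T) + (\<Sum>F | F facet_of T. 2 * ?D * measure lborel (sweep t e F))
     \<le> t * (4 * ?D) ^ ?d + (real ?d + 1) * (4 * (t * (4 * ?D) ^ ?d))" using 1 by linarith
  also have "\<dots> = t * (shape_const DIM('a) * ?D ^ ?d)" by (simp add: shape_const_def power_mult_distrib algebra_simps)
  also have "\<dots> \<le> t * (shape_const DIM('a) * (c * measure lborel T))"
    using t c shape_const_pos[of ?d] by (intro mult_left_mono) auto
  finally show ?thesis by (simp add: mult.assoc)
qed

lemma energy_measure:
  assumes "T \<in> \<T>"
  shows "energy \<theta> T * measure lborel T
    = \<theta> * 4 ^ (DIM('a) + 1) * (LINT x:T|lborel. (val T x)\<^sup>2) + measure lborel T * (norm (a T))\<^sup>2 / \<theta>"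
  using measure_pos[OF assms] by (simp add: energy_def sup_sq_def field_simps)

text \<open>The volume-weighted sum of \<open>energy \<theta> T\<close> over the mesh, times the
  constants of \<open>sweep_bound\<close>.\<close>

definition variation_bound :: "real \<Rightarrow> real \<Rightarrow> real" where
  "variation_bound c \<theta> = shape_const DIM('a) * c * (\<theta> * 4 ^ (DIM('a) + 1) * sq_norm + sq_grad / \<theta>)"

text \<open>Integrating \<open>chosen_sq_diff_le\<close> over x turns the indicators
  \<open>meets\<close> into measures of sweeps. The restriction on t is inherited from
  \<open>measure_sweep_thin_le\<close>, used with D the diameter of each element.\<close>

lemma variation_small_step:
  assumes e: "norm e = 1" and \<theta>: "\<theta> > 0" and t: "0 < t" "\<And>T. T \<in> \<T> \<Longrightarrow> t \<le> diameter T"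
    and c: "\<And>T. T \<in> \<T> \<Longrightarrow> diameter T ^ DIM('a) \<le> c * measure lborel T"
  shows "(\<integral>\<^sup>+x. ennreal \<bar>signed_square (fun_of (x + t *\<^sub>R e)) - signed_square (fun_of x)\<bar> \<partial>lborel)
     \<le> ennreal (t * variation_bound c \<theta>)"
proof -
  define h where "h x = (\<Sum>T\<in>\<T>. energy \<theta> T * (t * indicator (sweep t e T) x
          + (\<Sum>F | F facet_of T. 2 * diameter T * indicator (sweep t e F) x)))" for x
  have meets: "meets x e S {0..t} = indicator (sweep t e S) x" for x S
    by (simp add: meets_def sweep_def indicator_def)
  \<comment> \<open>Excluded are the bad lines and the x for which x or x + t e lies on the
    skeleton, where \<open>chosen_sq\<close> need not agree with \<open>fun_of\<close>.\<close>
  have "AE x in lebesgue. x \<notin> bad_lines e \<union> skeleton \<union> (+) (- t *\<^sub>R e) ` skeleton"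
    by (rule AE_not_in) (intro null_sets.Un negligible_iff_null_sets[THEN iffD1]
        negligible_bad_lines negligible_skeleton negligible_translation)
  then have "AE x in lebesgue. \<bar>signed_square (fun_of (x + t *\<^sub>R e)) - signed_square (fun_of x)\<bar> \<le> h x"
  proof eventually_elim
    case (elim x)
    have "x + t *\<^sub>R e \<notin> skeleton"
    proof
      assume "x + t *\<^sub>R e \<in> skeleton"
      then have "x \<in> (+) (- t *\<^sub>R e) ` skeleton" by (intro image_eqI[of _ _ "x + t *\<^sub>R e"]) auto
      then show False using elim by blast
    qed
    then show ?case
      using chosen_sq_diff_le[OF e \<theta>, of t x] elim t(1) chosen_sq_eq[of x] chosen_sq_eq[of "x + t *\<^sub>R e"]
      by (simp add: h_def meets)
  qed
  then have AE: "AE x in lborel. ennreal \<bar>signed_square (fun_of (x + t *\<^sub>R e)) - signed_square (fun_of x)\<bar> \<le> ennreal (h x)"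
    unfolding AE_completion_iff by eventually_elim (rule ennreal_leI)
  have cF: "compact F" if "T \<in> \<T>" "F facet_of T" for F T
    using that elem[of T] face_of_imp_compact by (auto simp: facet_of_def)
  have hb: "has_bochner_integral lborel h (\<Sum>T\<in>\<T>. energy \<theta> T * (t * measure lborel (sweep t e T)
          + (\<Sum>F | F facet_of T. 2 * diameter T * measure lborel (sweep t e F))))"
    unfolding h_def[abs_def] using elem(2) cF
    by (intro has_bochner_integral_sum has_bochner_integral_mult_right has_bochner_integral_add
        has_bochner_integral_indicator_compact compact_sweep) auto
  have h0: "h x \<ge> 0" for x
    unfolding h_def using energy_nonneg[OF _ \<theta>] t(1) diameter_pos less_imp_le
    by (intro sum_nonneg mult_nonneg_nonneg add_nonneg_nonneg) (auto simp: less_imp_le)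
  have "(\<integral>\<^sup>+x. ennreal (h x) \<partial>lborel) = ennreal (integral\<^sup>L lborel h)"
    using hb h0 by (intro nn_integral_eq_integral) (auto simp: has_bochner_integral_iff)
  also have "integral\<^sup>L lborel h = (\<Sum>T\<in>\<T>. energy \<theta> T * (t * measure lborel (sweep t e T)
          + (\<Sum>F | F facet_of T. 2 * diameter T * measure lborel (sweep t e F))))"
    using hb by (simp add: has_bochner_integral_iff)
  also have "\<dots> \<le> (\<Sum>T\<in>\<T>. energy \<theta> T * (t * (shape_const DIM('a) * c * measure lborel T)))"
    using energy_nonneg[OF _ \<theta>] sweep_bound[OF e t(1) t(2) _ c] by (intro sum_mono mult_left_mono) auto
  also have "\<dots> = (\<Sum>T\<in>\<T>. t * shape_const DIM('a) * c * (energy \<theta> T * measure lborel T))"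
    by (intro sum.cong) auto
  also have "\<dots> = (\<Sum>T\<in>\<T>. t * shape_const DIM('a) * c * (\<theta> * 4 ^ (DIM('a) + 1) * (LINT x:T|lborel. (val T x)\<^sup>2)
      + measure lborel T * (norm (a T))\<^sup>2 / \<theta>))"
    by (intro sum.cong refl arg_cong2[where f = "(*)"] energy_measure)
  also have "\<dots> = t * shape_const DIM('a) * c * (\<theta> * 4 ^ (DIM('a) + 1) * sq_norm + sq_grad / \<theta>)"
    unfolding sq_norm_def sq_grad_def
    by (simp only: sum_distrib_left[symmetric] sum.distrib sum_divide_distrib[symmetric])
  finally have "(\<integral>\<^sup>+x. ennreal (h x) \<partial>lborel) \<le> ennreal (t * variation_bound c \<theta>)"
    by (simp add: variation_bound_def mult.assoc ennreal_leI)
  then show ?thesis using nn_integral_mono_AE[OF AE] by (rule order_trans[rotated])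
qed

text \<open>Divide the translation into steps no longer than the smallest element. As the bound is
  linear in t, adding up the steps costs nothing, whatever their number.\<close>

lemma variation_translate:
  assumes e: "norm e = 1" and \<theta>: "\<theta> > 0" and t: "0 \<le> t"
    and c: "\<And>T. T \<in> \<T> \<Longrightarrow> diameter T ^ DIM('a) \<le> c * measure lborel T" "c \<ge> 0"
  shows "(\<integral>\<^sup>+x. ennreal \<bar>signed_square (fun_of (x + t *\<^sub>R e)) - signed_square (fun_of x)\<bar> \<partial>lborel)
     \<le> ennreal (t * variation_bound c \<theta>)"
proof (cases "t = 0")
  case False
  define \<delta> where "\<delta> = Min (insert 1 (diameter ` \<T>))"
  have \<delta>: "\<delta> > 0" "\<And>T. T \<in> \<T> \<Longrightarrow> \<delta> \<le> diameter T"
    unfolding \<delta>_def using fin diameter_pos by auto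
  obtain N :: nat where N: "t / \<delta> < real N" using reals_Archimedean2 by blast
  have "N > 0" using N t \<delta> by (intro gr0I) (auto simp: divide_less_0_iff)
  define s where "s = t / real N"
  have s: "s > 0" "s \<le> \<delta>" "t = real N * s"
    using N \<open>N > 0\<close> t False \<delta> by (auto simp: s_def field_simps)
  define g where "g x = signed_square (fun_of x)" for x
  have [measurable]: "g \<in> borel_measurable borel" unfolding g_def[abs_def] by measurable
  have V: "variation_bound c \<theta> \<ge> 0"
    unfolding variation_bound_def using c \<theta> sq_norm_nonneg sq_grad_nonneg shape_const_pos[of "DIM('a)"] by simp
  have "(\<integral>\<^sup>+x. ennreal \<bar>g (x + (real n * s) *\<^sub>R e) - g x\<bar> \<partial>lborel) \<le> ennreal (real n * (s * variation_bound c \<theta>))" for n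
  proof (induction n)
    case (Suc n)
    have "(\<integral>\<^sup>+x. ennreal \<bar>g (x + (real (Suc n) * s) *\<^sub>R e) - g x\<bar> \<partial>lborel)
      \<le> (\<integral>\<^sup>+x. ennreal \<bar>g (x + (real n * s) *\<^sub>R e + s *\<^sub>R e) - g (x + (real n * s) *\<^sub>R e)\<bar>
           + ennreal \<bar>g (x + (real n * s) *\<^sub>R e) - g x\<bar> \<partial>lborel)"
    proof (rule nn_integral_mono)
      fix x
      have "x + (real (Suc n) * s) *\<^sub>R e = x + (real n * s) *\<^sub>R e + s *\<^sub>R e" by (simp add: algebra_simps)
      then have "\<bar>g (x + (real (Suc n) * s) *\<^sub>R e) - g x\<bar>
        \<le> \<bar>g (x + (real n * s) *\<^sub>R e + s *\<^sub>R e) - g (x + (real n * s) *\<^sub>R e)\<bar> + \<bar>g (x + (real n * s) *\<^sub>R e) - g x\<bar>"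
        by (simp only:)
      then show "ennreal \<bar>g (x + (real (Suc n) * s) *\<^sub>R e) - g x\<bar>
        \<le> ennreal \<bar>g (x + (real n * s) *\<^sub>R e + s *\<^sub>R e) - g (x + (real n * s) *\<^sub>R e)\<bar>
           + ennreal \<bar>g (x + (real n * s) *\<^sub>R e) - g x\<bar>"
        by (simp add: ennreal_leI flip: ennreal_plus)
    qed
    also have "\<dots> = (\<integral>\<^sup>+x. ennreal \<bar>g (x + (real n * s) *\<^sub>R e + s *\<^sub>R e) - g (x + (real n * s) *\<^sub>R e)\<bar> \<partial>lborel)
           + (\<integral>\<^sup>+x. ennreal \<bar>g (x + (real n * s) *\<^sub>R e) - g x\<bar> \<partial>lborel)"
      by (rule nn_integral_add; measurable)
    also have "(\<integral>\<^sup>+x. ennreal \<bar>g (x + (real n * s) *\<^sub>R e + s *\<^sub>R e) - g (x + (real n * s) *\<^sub>R e)\<bar> \<partial>lborel)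
       = (\<integral>\<^sup>+x. ennreal \<bar>g (x + s *\<^sub>R e) - g x\<bar> \<partial>lborel)"
      by (rule nn_integral_lborel_translate[of "\<lambda>x. ennreal \<bar>g (x + s *\<^sub>R e) - g x\<bar>"]; measurable)
    also have "\<dots> \<le> ennreal (s * variation_bound c \<theta>)"
      unfolding g_def using s \<delta> c(1) by (intro variation_small_step[OF e \<theta>]) (auto intro: order_trans)
    also note Suc.IH
    also have "ennreal (s * variation_bound c \<theta>) + ennreal (real n * (s * variation_bound c \<theta>))
       = ennreal (real (Suc n) * (s * variation_bound c \<theta>))"
      using V s by (subst ennreal_plus[symmetric]) (auto simp: algebra_simps)
    finally show ?case by (simp add: add_mono)
  qed simp
  from this[of N] show ?thesis unfolding g_def using s(3) by (simp add: mult.assoc)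
qed simp

lemma l2_translate:
  assumes "norm e = 1" and "\<theta> > 0" and "0 \<le> t"
    and "\<And>T. T \<in> \<T> \<Longrightarrow> diameter T ^ DIM('a) \<le> c * measure lborel T" "c \<ge> 0"
  shows "(\<integral>\<^sup>+x. ennreal ((fun_of (x + t *\<^sub>R e) - fun_of x)\<^sup>2) \<partial>lborel) \<le> ennreal (2 * t * variation_bound c \<theta>)"
proof -
  have "(\<integral>\<^sup>+x. ennreal ((fun_of (x + t *\<^sub>R e) - fun_of x)\<^sup>2) \<partial>lborel)
    \<le> (\<integral>\<^sup>+x. 2 * ennreal \<bar>signed_square (fun_of (x + t *\<^sub>R e)) - signed_square (fun_of x)\<bar> \<partial>lborel)"
    using power2_diff_le_signed_square
    by (intro nn_integral_mono) (auto simp flip: ennreal_numeral ennreal_mult intro!: ennreal_leI)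
  also have "\<dots> = 2 * (\<integral>\<^sup>+x. ennreal \<bar>signed_square (fun_of (x + t *\<^sub>R e)) - signed_square (fun_of x)\<bar> \<partial>lborel)"
    by (rule nn_integral_cmult; measurable)
  also have "\<dots> \<le> 2 * ennreal (t * variation_bound c \<theta>)"
    by (intro mult_left_mono variation_translate assms) auto
  also have "\<dots> = ennreal (2 * (t * variation_bound c \<theta>))"
    by (simp add: ennreal_mult' )
  finally show ?thesis by (simp only: mult.assoc)
qed

end

section \<open>Discrete Poincare inequality\<close>

text \<open>With q = 4 ^ (n + 1), translating by 2 R + 1 gives \<open>sq_norm\<close> \<le> A
  (\<theta> q \<open>sq_norm\<close> + \<open>sq_grad\<close> / \<theta>). For \<theta> = 1 / (2 A q
  + 1) at most half of \<open>sq_norm\<close> stands on the right; absorbing it leaves this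
  constant.\<close>

definition poincare_const :: "nat \<Rightarrow> real \<Rightarrow> real \<Rightarrow> real" where
  "poincare_const n R c = (let A = (2 * R + 1) * (shape_const n * c) in 2 * A * (2 * A * 4 ^ (n + 1) + 1))"

text \<open>From the translation estimate with \<theta> = 1, once the Poincare inequality has
  replaced the norm by the gradient.\<close>

definition translate_const :: "nat \<Rightarrow> real \<Rightarrow> real \<Rightarrow> real" where
  "translate_const n R c = 2 * (shape_const n * c * (4 ^ (n + 1) * poincare_const n R c + 1))"

lemma poincare_const_nonneg: "R \<ge> 0 \<Longrightarrow> c \<ge> 0 \<Longrightarrow> poincare_const n R c \<ge> 0"
  using shape_const_pos[of n] by (simp add: poincare_const_def Let_def)

lemma translate_const_nonneg: "R \<ge> 0 \<Longrightarrow> c \<ge> 0 \<Longrightarrow> translate_const n R c \<ge> 0"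
  using shape_const_pos[of n] poincare_const_nonneg[of R c n] by (simp add: translate_const_def)

context broken_affine
begin

lemma AE_not_skeleton: "AE x in lborel. x \<notin> skeleton"
proof -
  have "AE x in lebesgue. x \<notin> skeleton"
    by (rule AE_not_in) (use negligible_skeleton in \<open>simp add: negligible_iff_null_sets\<close>)
  then show ?thesis by (simp only: AE_completion_iff)
qed

lemma has_bochner_integral_fun_of_sq: "has_bochner_integral lborel (\<lambda>x. (fun_of x)\<^sup>2) sq_norm"
proof -
  have int: "set_integrable lborel T (\<lambda>x. (val T x)\<^sup>2)" if "T \<in> \<T>" for T
    unfolding set_integrable_def val_def using elem(2)[OF that]
    by (intro borel_integrable_compact) (auto intro!: continuous_intros)
  have "has_bochner_integral lborel (\<lambda>x. \<Sum>T\<in>\<T>. indicator T x *\<^sub>R (val T x)\<^sup>2) sq_norm"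
    unfolding sq_norm_def set_lebesgue_integral_def
    using int by (intro has_bochner_integral_sum has_bochner_integral_integrable) (auto simp: set_integrable_def)
  moreover have "AE x in lborel. (\<Sum>T\<in>\<T>. indicator T x *\<^sub>R (val T x)\<^sup>2) = (fun_of x)\<^sup>2"
    using AE_not_skeleton
  proof eventually_elim
    case (elim x)
    show ?case
    proof (cases "x \<in> \<Union>\<T>")
      case True
      then obtain P where P: "P \<in> \<T>" "x \<in> P" by blast
      then show ?thesis
        using sum_indicator_elem[OF P elim, of "\<lambda>T. (val T x)\<^sup>2"] fun_of_in[OF P elim] by simp
    next
      case False
      then have "(\<Sum>T\<in>\<T>. indicator T x *\<^sub>R (val T x)\<^sup>2) = 0" by (intro sum.neutral) auto
      then show ?thesis using False by (simp add: fun_of_outside)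
    qed
  qed
  ultimately show ?thesis
    using has_bochner_integral_cong_AE[of "\<lambda>x. \<Sum>T\<in>\<T>. indicator T x *\<^sub>R (val T x)\<^sup>2" lborel "\<lambda>x. (fun_of x)\<^sup>2" sq_norm]
    by (auto simp: has_bochner_integral_iff)
qed

text \<open>A translation that moves the mesh off itself turns the translation estimate into a
  Poincare inequality; the small weight absorbs the function term.\<close>

lemma poincare:
  assumes R: "\<Union>\<T> \<subseteq> cball 0 R" "R \<ge> 0"
    and c: "\<And>T. T \<in> \<T> \<Longrightarrow> diameter T ^ DIM('a) \<le> c * measure lborel T" "c \<ge> 0"
  shows "sq_norm \<le> poincare_const DIM('a) R c * sq_grad"
proof -
  define t where "t = 2 * R + 1"
  define A where "A = t * (shape_const DIM('a) * c)"
  define q where "q = (4 :: real) ^ (DIM('a) + 1)"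
  define \<theta> where "\<theta> = 1 / (2 * A * q + 1)"
  have A0: "A \<ge> 0" unfolding A_def t_def using R c shape_const_pos[of "DIM('a)"] by simp
  have q0: "q > 0" by (simp add: q_def)
  have den: "2 * A * q + 1 > 0" using A0 q0 by (simp add: add_nonneg_pos)
  have \<theta>: "\<theta> > 0" using den by (simp add: \<theta>_def)
  obtain e :: 'a where e: "e \<in> Basis" using nonempty_Basis by blast
  then have ne: "norm e = 1" by simp
  have far: "(fun_of x)\<^sup>2 \<le> \<bar>signed_square (fun_of (x + t *\<^sub>R e)) - signed_square (fun_of x)\<bar>" for x
  proof (cases "fun_of x = 0")
    case False
    then have "x \<in> cball 0 R" using fun_of_outside[of x] R by blast
    then have "norm (t *\<^sub>R e) - norm x > R" using ne R by (simp add: t_def)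
    then have "norm (x + t *\<^sub>R e) > R" using norm_diff_ineq[of "t *\<^sub>R e" x] by (simp add: add.commute)
    then have "x + t *\<^sub>R e \<notin> \<Union>\<T>" using R by auto
    then show ?thesis by (simp add: fun_of_outside)
  qed simp
  have "ennreal sq_norm = (\<integral>\<^sup>+x. ennreal ((fun_of x)\<^sup>2) \<partial>lborel)"
    using has_bochner_integral_fun_of_sq nn_integral_eq_integral[of lborel "\<lambda>x. (fun_of x)\<^sup>2"]
    by (simp add: has_bochner_integral_iff)
  also have "\<dots> \<le> (\<integral>\<^sup>+x. ennreal \<bar>signed_square (fun_of (x + t *\<^sub>R e)) - signed_square (fun_of x)\<bar> \<partial>lborel)"
    using far by (intro nn_integral_mono ennreal_leI) auto
  also have "\<dots> \<le> ennreal (t * variation_bound c \<theta>)"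
    using R c by (intro variation_translate ne \<theta>) (auto simp: t_def)
  finally have "sq_norm \<le> t * variation_bound c \<theta>"
  proof -
    assume "ennreal sq_norm \<le> ennreal (t * variation_bound c \<theta>)"
    moreover have "0 \<le> t * variation_bound c \<theta>"
      unfolding variation_bound_def t_def
      using R c \<theta> sq_norm_nonneg sq_grad_nonneg shape_const_pos[of "DIM('a)"] by simp
    ultimately show ?thesis by (simp add: ennreal_le_iff)
  qed
  also have "\<dots> = (A * q * \<theta>) * sq_norm + A * (2 * A * q + 1) * sq_grad"
    unfolding variation_bound_def A_def q_def \<theta>_def by (simp add: algebra_simps)
  also have "A * q * \<theta> \<le> 1 / 2"
    using den A0 q0 by (simp add: \<theta>_def pos_divide_le_eq)
  then have "(A * q * \<theta>) * sq_norm \<le> 1 / 2 * sq_norm"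
    by (rule mult_right_mono[OF _ sq_norm_nonneg])
  finally have "sq_norm \<le> 2 * (A * (2 * A * q + 1) * sq_grad)" by simp
  then show ?thesis
    by (simp add: poincare_const_def Let_def A_def q_def t_def mult.assoc)
qed

lemma l2_translate_grad:
  assumes e: "norm e = 1" and t: "0 \<le> t" and R: "\<Union>\<T> \<subseteq> cball 0 R" "R \<ge> 0"
    and c: "\<And>T. T \<in> \<T> \<Longrightarrow> diameter T ^ DIM('a) \<le> c * measure lborel T" "c \<ge> 0"
  shows "(\<integral>\<^sup>+x. ennreal ((fun_of (x + t *\<^sub>R e) - fun_of x)\<^sup>2) \<partial>lborel)
    \<le> ennreal (t * (translate_const DIM('a) R c * sq_grad))"
proof -
  have "(\<integral>\<^sup>+x. ennreal ((fun_of (x + t *\<^sub>R e) - fun_of x)\<^sup>2) \<partial>lborel) \<le> ennreal (2 * t * variation_bound c 1)"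
    by (intro l2_translate e t c) auto
  also have "\<dots> \<le> ennreal (t * (translate_const DIM('a) R c * sq_grad))"
  proof (rule ennreal_leI)
    have "4 ^ (DIM('a) + 1) * sq_norm \<le> 4 ^ (DIM('a) + 1) * (poincare_const DIM('a) R c * sq_grad)"
      by (intro mult_left_mono poincare R c) auto
    then have "1 * 4 ^ (DIM('a) + 1) * sq_norm + sq_grad / 1
      \<le> (4 ^ (DIM('a) + 1) * poincare_const DIM('a) R c + 1) * sq_grad"
      by (simp add: algebra_simps)
    then have "variation_bound c 1 \<le> shape_const DIM('a) * c * ((4 ^ (DIM('a) + 1) * poincare_const DIM('a) R c + 1) * sq_grad)"
      unfolding variation_bound_def using c shape_const_pos[of "DIM('a)"] by (intro mult_left_mono) auto
    then have "2 * t * variation_bound c 1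
      \<le> 2 * t * (shape_const DIM('a) * c * ((4 ^ (DIM('a) + 1) * poincare_const DIM('a) R c + 1) * sq_grad))"
      using t by (intro mult_left_mono) auto
    also have "\<dots> = t * (translate_const DIM('a) R c * sq_grad)"
      unfolding translate_const_def by (simp only: mult_ac)
    finally show "2 * t * variation_bound c 1 \<le> t * (translate_const DIM('a) R c * sq_grad)" .
  qed
  finally show ?thesis .
qed

end

section \<open>Crouzeix--Raviart functions\<close>

lemma integrable_continuous_compact:
  fixes f :: "'a::euclidean_space \<Rightarrow> 'b::euclidean_space"
  assumes "compact S" "continuous_on S f"
  shows "integrable (lebesgue_on S) f"
proof -
  have "integrable lborel (\<lambda>x. indicator S x *\<^sub>R f x)" using assms by (rule borel_integrable_compact)
  then have "integrable lebesgue (\<lambda>x. indicator S x *\<^sub>R f x)"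
    by (subst integrable_completion) (auto dest: borel_measurable_integrable)
  then show ?thesis
    using assms(1) by (simp add: integrable_restrict_space borel_compact)
qed

text \<open>For the positive volume: a point x near a relative interior point p of F has its
  projection within twice its distance from p, hence in F; so a ball about p lies in the
  slab.\<close>

lemma
  fixes F :: "(real^'d) set"
  assumes F: "compact F" "convex F" "F \<noteq> {}"
  shows compact_face_slab: "compact (face_slab F)"
    and measure_face_slab_pos: "measure lebesgue (face_slab F) > 0"
    and continuous_face_proj: "continuous_on S (face_proj F)"
proof -
  have aff: "convex (affine hull F)" "closed (affine hull F)" "affine hull F \<noteq> {}"
    using F(3) by (auto simp: affine_imp_convex)
  show cont: "continuous_on S (face_proj F)" for S
    unfolding face_proj_def by (rule continuous_on_closest_point[OF aff])
  have "closed {x. face_proj F x \<in> F}"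
    using closed_vimage[OF compact_imp_closed[OF F(1)] cont[of UNIV]] by (simp add: vimage_def)
  moreover have "closed {x. dist x (face_proj F x) \<le> 1/2}"
    by (intro closed_Collect_le continuous_intros cont)
  ultimately have cl: "closed (face_slab F)"
    unfolding face_slab_def by (simp add: Collect_conj_eq closed_Int)
  have "bounded (face_slab F)"
  proof -
    obtain B where B: "\<And>y. y \<in> F \<Longrightarrow> norm y \<le> B" using compact_imp_bounded[OF F(1)] by (auto simp: bounded_iff)
    have "norm x \<le> B + 1/2" if "x \<in> face_slab F" for x
    proof -
      have "face_proj F x \<in> F" "norm (x - face_proj F x) \<le> 1/2"
        using that by (auto simp: face_slab_def dist_norm)
      then show ?thesis using B norm_triangle_sub[of x "face_proj F x"] by fastforce
    qed
    then show ?thesis unfolding bounded_iff by blast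
  qed
  with cl show comp: "compact (face_slab F)" by (simp add: compact_eq_bounded_closed)
  obtain p where p: "p \<in> rel_interior F" using F rel_interior_eq_empty by blast
  then obtain r where r: "r > 0" "ball p r \<inter> affine hull F \<subseteq> F" and pF: "p \<in> F"
    by (auto simp: mem_rel_interior_ball)
  define e where "e = min (r / 2) (1 / 2)"
  have "ball p e \<subseteq> face_slab F"
  proof
    fix x assume "x \<in> ball p e"
    then have x: "dist x p < r / 2" "dist x p < 1 / 2" by (auto simp: e_def dist_commute)
    have pa: "p \<in> affine hull F" using pF by (rule hull_inc)
    have d: "dist x (face_proj F x) \<le> dist x p"
      unfolding face_proj_def by (rule closest_point_le[OF aff(2) pa])
    have "dist p (face_proj F x) \<le> dist p x + dist x (face_proj F x)" by (rule dist_triangle)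
    then have "dist p (face_proj F x) < r" using d x by (simp add: dist_commute)
    moreover have "face_proj F x \<in> affine hull F"
      unfolding face_proj_def by (rule closest_point_in_set[OF aff(2,3)])
    ultimately have "face_proj F x \<in> F" using r by auto
    then show "x \<in> face_slab F" using d x by (simp add: face_slab_def)
  qed
  moreover have "e > 0" using r by (simp add: e_def)
  ultimately have "\<not> negligible (face_slab F)"
    using open_not_negligible[OF open_ball, of p e] negligible_subset[of "face_slab F" "ball p e"] by auto
  then show "measure lebesgue (face_slab F) > 0"
    using lmeasurable_compact[OF comp] by (simp add: negligible_iff_measure0 zero_less_measure_iff)
qed

lemma face_mean_pos:
  fixes F :: "(real^'d) set" and g :: "real^'d \<Rightarrow> real"
  assumes F: "compact F" "convex F" "F \<noteq> {}" and g: "continuous_on F g" "\<And>p. p \<in> F \<Longrightarrow> g p > 0"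
  shows "(\<integral>x. g (face_proj F x) \<partial>lebesgue_on (face_slab F)) > 0"
proof -
  let ?S = "face_slab F"
  have S: "compact ?S" "measure lebesgue ?S > 0"
    using compact_face_slab[OF F] measure_face_slab_pos[OF F] by auto
  obtain q where q: "q \<in> F" "\<And>p. p \<in> F \<Longrightarrow> g q \<le> g p"
    using continuous_attains_inf[OF F(1,3) g(1)] by blast
  have sub: "face_proj F ` ?S \<subseteq> F" by (auto simp: face_slab_def)
  have int: "integrable (lebesgue_on ?S) (\<lambda>x. g (face_proj F x))"
    using S(1) continuous_on_compose2[OF g(1) continuous_face_proj[OF F] sub]
    by (rule integrable_continuous_compact)
  have intc: "integrable (lebesgue_on ?S) (\<lambda>x. g q)"
    using S(1) by (intro integrable_continuous_compact continuous_intros)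
  have "0 < g q * measure lebesgue ?S" using g(2)[OF q(1)] S by simp
  also have "\<dots> = (\<integral>x. g q \<partial>lebesgue_on ?S)"
    using S(1) by (simp add: measure_restrict_space borel_compact mult.commute)
  also have "\<dots> \<le> (\<integral>x. g (face_proj F x) \<partial>lebesgue_on ?S)"
    using q(2) by (intro integral_mono intc int) (auto simp: face_slab_def)
  finally show ?thesis .
qed

text \<open>A continuous function without zeros has one sign on the connected set F, and then its
  integral cannot vanish.\<close>

lemma face_mean_zero_root:
  fixes F :: "(real^'d) set" and g :: "real^'d \<Rightarrow> real"
  assumes F: "compact F" "convex F" "F \<noteq> {}" and g: "continuous_on F g"
    and zero: "(\<integral>x. g (face_proj F x) \<partial>lebesgue_on (face_slab F)) = 0"
  shows "\<exists>q\<in>F. g q = 0"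
proof (rule ccontr)
  assume nz: "\<not> ?thesis"
  have conn: "connected (g ` F)"
    using connected_continuous_image[OF g convex_connected[OF F(2)]] .
  have "(\<forall>p\<in>F. g p > 0) \<or> (\<forall>p\<in>F. - g p > 0)"
  proof (rule ccontr)
    assume "\<not> ?thesis"
    then obtain p p' where "p \<in> F" "g p \<le> 0" "p' \<in> F" "- g p' \<le> 0" by (auto simp: not_less)
    then have "0 \<in> g ` F" using connectedD_interval[OF conn, of "g p" "g p'" 0] by simp
    then show False using nz by auto
  qed
  then show False
  proof
    assume "\<forall>p\<in>F. g p > 0"
    then show False using face_mean_pos[OF F g] zero by simp
  next
    assume "\<forall>p\<in>F. - g p > 0"
    then show False using face_mean_pos[OF F continuous_on_minus[OF g]] zero by simp
  qed
qed

text \<open>\<open>J\<close> stands for the jump, defined by limits from inside the elements, and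
  \<open>h\<close> for its affine formula on F.\<close>

lemma face_integral_component_root:
  fixes F :: "(real^'d) set" and J h :: "real^'d \<Rightarrow> real^'n"
  assumes F: "compact F" "convex F" "F \<noteq> {}" and h: "continuous_on F h"
    and J: "\<And>p. p \<in> F \<Longrightarrow> J p = h p" and zero: "face_integral F J = 0"
  shows "\<exists>q\<in>F. h q $ i = 0"
proof (rule face_mean_zero_root[OF F])
  show "continuous_on F (\<lambda>x. h x $ i)" using h by (intro continuous_intros)
  have sub: "face_proj F ` face_slab F \<subseteq> F" by (auto simp: face_slab_def)
  have int: "integrable (lebesgue_on (face_slab F)) (\<lambda>x. h (face_proj F x))"
    using compact_face_slab[OF F] continuous_on_compose2[OF h continuous_face_proj[OF F] sub]
    by (rule integrable_continuous_compact)
  have "face_integral F J = (\<integral>x. h (face_proj F x) \<partial>lebesgue_on (face_slab F))"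
    unfolding face_integral_def
    by (intro Bochner_Integration.integral_cong) (auto simp: face_slab_def J)
  then have "(\<integral>x. h (face_proj F x) \<partial>lebesgue_on (face_slab F)) \<bullet> axis i 1 = 0" using zero by simp
  then have "(\<integral>x. h (face_proj F x) \<bullet> axis i 1 \<partial>lebesgue_on (face_slab F)) = 0"
    using int by (simp add: integral_inner_left)
  then show "(\<integral>x. h (face_proj F x) $ i \<partial>lebesgue_on (face_slab F)) = 0" by (simp add: inner_axis)
qed

lemma affine_root_bound:
  fixes a p q :: "'a::euclidean_space"
  assumes "bounded F" "p \<in> F" "q \<in> F" "a \<bullet> q + b = 0"
  shows "\<bar>a \<bullet> p + b\<bar> \<le> diameter F * norm a"
proof -
  have "a \<bullet> p + b = a \<bullet> (p - q)" using assms(4) by (simp add: inner_diff_right)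
  also have "\<bar>\<dots>\<bar> \<le> norm a * dist p q" by (simp add: dist_norm Cauchy_Schwarz_ineq2)
  also have "\<dots> \<le> norm a * diameter F"
    using diameter_bounded_bound[OF assms(1-3)] by (intro mult_left_mono) auto
  finally show ?thesis by (simp add: mult.commute)
qed

section \<open>Crouzeix--Raviart functions as broken affine functions\<close>

lemma trace_from_affine:
  fixes T :: "(real^'d) set" and v :: "real^'d \<Rightarrow> 'b::euclidean_space"
  assumes T: "convex T" "closed T" "interior T \<noteq> {}" and L: "linear L"
    and v: "\<And>x. x \<in> interior T \<Longrightarrow> v x = L x + c" and p: "p \<in> T"
  shows "trace_from T v p = L p + c"
proof -
  have "T = closure (interior T)" using T by (simp add: convex_closure_interior)
  then have "p \<in> closure (interior T)" using p by blast
  moreover have "p islimpt interior T" if "p \<in> interior T"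
    using interior_limit_point[of p "interior T"] that by simp
  ultimately have "p islimpt interior T" unfolding closure_def by blast
  then have nb: "at p within interior T \<noteq> bot" by (simp add: trivial_limit_within)
  have "((\<lambda>x. L x + c) \<longlongrightarrow> L p + c) (at p within interior T)"
    using L by (intro tendsto_intros bounded_linear.tendsto[of L]) (simp add: linear_conv_bounded_linear)
  moreover have "\<forall>\<^sub>F x in at p within interior T. L x + c = v x"
    using v by (auto simp: eventually_at_filter)
  ultimately have "(v \<longlongrightarrow> L p + c) (at p within interior T)" by (rule Lim_transform_eventually)
  then show ?thesis unfolding trace_from_def using nb by (intro tendsto_Lim)
qed

lemma jac_affine:
  fixes v :: "real^'d \<Rightarrow> real^'d"
  assumes L: "linear L" and v: "\<And>x. x \<in> interior T \<Longrightarrow> v x = L x + c" and x: "x \<in> interior T"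
  shows "jac v x = matrix L"
proof -
  have "((\<lambda>x. L x + c) has_derivative L) (at x)"
    using L by (auto intro!: derivative_eq_intros bounded_linear_imp_has_derivative simp: linear_conv_bounded_linear)
  then have "(v has_derivative L) (at x)"
    by (rule has_derivative_transform_within_open[OF _ open_interior x]) (simp add: v)
  then have "frechet_derivative v (at x) = L" by (rule frechet_derivative_at[symmetric])
  then show ?thesis by (simp add: jac_def)
qed

lemma conforming_simplicial_mesh:
  fixes \<T> :: "(real^'d) set set"
  shows "conforming_triangulation \<Omega> \<T> \<Longrightarrow> simplicial_mesh \<T>"
  by (auto simp: conforming_triangulation_def simplicial_mesh_def)

text \<open>Each component of the jump has a root on the facet, in general a different one for each
  component, hence the fixed \<open>i\<close>. An affine function with a root is bounded by the
  diameter times its gradient.\<close>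

lemma CR_broken_affine:
  fixes v :: "real^'d \<Rightarrow> real^'d" and L :: "(real^'d) set \<Rightarrow> real^'d \<Rightarrow> real^'d" and C :: "(real^'d) set \<Rightarrow> real^'d"
  assumes \<T>: "conforming_triangulation \<Omega> \<T>" and \<Omega>: "open \<Omega>" and v: "v \<in> CR_space \<Omega> \<T>"
    and L: "\<And>T. T \<in> \<T> \<Longrightarrow> linear (L T)" "\<And>T x. T \<in> \<T> \<Longrightarrow> x \<in> interior T \<Longrightarrow> v x = L T x + C T"
  shows "broken_affine \<T> (\<lambda>T. matrix (L T) $ i) (\<lambda>T. C T $ i)"
proof -
  interpret simplicial_mesh \<T> using \<T> by (rule conforming_simplicial_mesh)
  have cover: "\<Union>\<T> = closure \<Omega>" using \<T> by (simp add: conforming_triangulation_def)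
  define a where "a T = matrix (L T) $ i" for T
  define b where "b T = C T $ i" for T
  have val: "(L T p + C T) $ i = a T \<bullet> p + b T" if "T \<in> \<T>" for T p
  proof -
    have "L T p = matrix (L T) *v p" using matrix_vector_mul(2)[OF L(1)[OF that]] by (rule fun_cong[THEN sym])
    then have "L T p $ i = a T \<bullet> p" by (simp add: a_def matrix_vector_mul_component)
    then show ?thesis by (simp add: b_def)
  qed
  have trace: "trace_from T v p = L T p + C T" if T: "T \<in> \<T>" "p \<in> T" for T p
    using elem(1,2)[OF T(1)] simplex_interior_nonempty[of T] full[OF T(1)] compact_imp_closed
    by (intro trace_from_affine L T) auto
  have contL: "continuous_on S (\<lambda>p. L T p + C T)" if "T \<in> \<T>" for S T
    using L(1)[OF that] by (intro continuous_intros linear_continuous_on) (simp add: linear_conv_bounded_linear)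
  have zero: "face_integral F (jump \<Omega> \<T> T F v) = 0" if "T \<in> \<T>" "F facet_of T" for T F
    using v that by (auto simp: CR_space_def)
  have facet: "compact F" "convex F" "F \<noteq> {}" "F \<subseteq> T" "bounded F" if "T \<in> \<T>" "F facet_of T" for T F
  proof -
    have "F face_of T" "F \<noteq> {}" using that by (auto simp: facet_of_def)
    then show "compact F" "convex F" "F \<noteq> {}" "F \<subseteq> T"
      using elem[OF that(1)] face_of_imp_compact face_of_imp_convex face_of_imp_subset by blast+
    then show "bounded F" by (simp add: compact_imp_bounded)
  qed
  have frontier_bound: "\<bar>a T \<bullet> p + b T\<bar> \<le> diameter F * norm (a T)"
    if T: "T \<in> \<T>" "F facet_of T" "F \<subseteq> frontier \<Omega>" "p \<in> F" for T F p
  proof -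
    note f = facet[OF T(1,2)]
    have "\<exists>q\<in>F. (L T q + C T) $ i = 0"
      using zero[OF T(1,2)] f(4) trace[OF T(1)] T(3)
      by (intro face_integral_component_root[OF f(1-3) contL[OF T(1)]]) (auto simp: jump_def)
    then obtain q where "q \<in> F" "a T \<bullet> q + b T = 0" using val[OF T(1)] by auto
    then show ?thesis using affine_root_bound[OF f(5) T(4)] by blast
  qed
  show ?thesis
    unfolding a_def[symmetric] b_def[symmetric]
  proof
    fix T T' p assume T: "T \<in> \<T>" "T' \<in> \<T>" "T \<noteq> T'" and F: "(T \<inter> T') facet_of T" and p: "p \<in> T \<inter> T'"
    define E where "E = T \<inter> T'"
    have "aff_dim E = int DIM(real^'d) - 1" using F elem(4)[OF T(1)] by (simp add: facet_of_def E_def)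
    then have F': "E facet_of T" "E facet_of T'"
      using F inter_cases[OF T] by (auto simp: E_def)
    note f = facet[OF T(1) F'(1)]
    have dE: "diameter E \<ge> 0" using f(5) by (rule diameter_ge_0)
    have "\<bar>(a T \<bullet> p + b T) - (a T' \<bullet> p + b T')\<bar> \<le> diameter E * (norm (a T) + norm (a T'))"
    \<comment> \<open>The first case is a crack: there \<open>jump\<close> is the trace from the
      element considered, so each of the two traces has a root of its own.\<close>
    proof (cases "E \<subseteq> frontier \<Omega>")
      case True
      have "\<bar>(a T \<bullet> p + b T) - (a T' \<bullet> p + b T')\<bar> \<le> \<bar>a T \<bullet> p + b T\<bar> + \<bar>a T' \<bullet> p + b T'\<bar>"
        by (rule abs_triangle_ineq4)
      also have "\<dots> \<le> diameter E * norm (a T) + diameter E * norm (a T')"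
        using frontier_bound[OF T(1) F'(1) True] frontier_bound[OF T(2) F'(2) True] p
        by (intro add_mono) (auto simp: E_def)
      finally show ?thesis by (simp add: distrib_left)
    next
      case False
      have nb: "neighbour \<T> T E = T'"
        unfolding neighbour_def
      proof (rule the_equality)
        show "T' \<in> \<T> \<and> T' \<noteq> T \<and> E facet_of T'" using T F' by auto
        fix S assume "S \<in> \<T> \<and> S \<noteq> T \<and> E facet_of S"
        then show "S = T'"
          using facet_at_most_two[OF T(1) _ T(2) _ _ F'(1), of S] T(3) facet(4)[OF _ , of S E]
          by (auto simp: E_def)
      qed
      have "\<exists>q\<in>E. ((L T q + C T) - (L T' q + C T')) $ i = 0"
        using zero[OF T(1) F'(1)] trace[OF T(1)] trace[OF T(2)] False nb
        by (intro face_integral_component_root[OF f(1-3) continuous_on_diff[OF contL[OF T(1)] contL[OF T(2)]]])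
          (auto simp: jump_def E_def)
      then obtain q where q: "q \<in> E" "((L T q + C T) - (L T' q + C T')) $ i = 0" by blast
      then have "(a T - a T') \<bullet> q + (b T - b T') = 0"
        using val[OF T(1), of q] val[OF T(2), of q] by (simp add: inner_diff_left)
      then have "\<bar>(a T - a T') \<bullet> p + (b T - b T')\<bar> \<le> diameter E * norm (a T - a T')"
        using p q by (intro affine_root_bound[OF f(5)]) (auto simp: E_def)
      also have "\<dots> \<le> diameter E * (norm (a T) + norm (a T'))"
        using dE by (intro mult_left_mono norm_triangle_ineq4)
      finally show ?thesis by (simp add: inner_diff_left algebra_simps)
    qed
    then show "\<bar>(a T \<bullet> p + b T) - (a T' \<bullet> p + b T')\<bar> \<le> diameter (T \<inter> T') * (norm (a T) + norm (a T'))"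
      by (simp add: E_def)
  next
    fix T F p assume T: "T \<in> \<T>" and F: "boundary_facet T F" and p: "p \<in> F"
    have "F facet_of T" using F by (simp add: boundary_facet_def)
    moreover have "F \<subseteq> frontier \<Omega>" by (rule boundary_facet_frontier[OF T F \<Omega> cover])
    ultimately show "\<bar>a T \<bullet> p + b T\<bar> \<le> diameter F * norm (a T)"
      using frontier_bound T p by blast
  qed
qed

section \<open>Averages over cubes\<close>

lemma ennreal_two_mult_add:
  "b \<ge> 0 \<Longrightarrow> c \<ge> 0 \<Longrightarrow> 2 * ennreal b + 2 * ennreal c = ennreal (2 * b + 2 * c)"
  by (simp add: ennreal_mult')

lemma ennreal_le_two_mult_add:
  "a \<le> 2 * b + 2 * c \<Longrightarrow> b \<ge> 0 \<Longrightarrow> c \<ge> 0 \<Longrightarrow> ennreal a \<le> 2 * ennreal b + 2 * ennreal c"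
  unfolding ennreal_two_mult_add by (rule ennreal_leI)

lemma set_nn_integral_eq_set_integral:
  fixes f :: "'a \<Rightarrow> real"
  assumes "set_integrable M Q f" "\<And>x. 0 \<le> f x"
  shows "(\<integral>\<^sup>+x\<in>Q. ennreal (f x) \<partial>M) = ennreal (LINT x:Q|M. f x)"
proof -
  have "(\<integral>\<^sup>+x\<in>Q. ennreal (f x) \<partial>M) = (\<integral>\<^sup>+x. ennreal (indicator Q x *\<^sub>R f x) \<partial>M)"
    by (intro nn_integral_cong) (simp add: indicator_def)
  also have "\<dots> = ennreal (LINT x:Q|M. f x)"
    unfolding set_lebesgue_integral_def
    using assms by (intro nn_integral_eq_integral) (auto simp: set_integrable_def)
  finally show ?thesis .
qed

section \<open>Translations by arbitrary vectors\<close>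

text \<open>The squared difference is of order t, the rate delivered by the variation estimate; a
  common \<open>K\<close> for a sequence is the equicontinuity condition of the Kolmogorov--Riesz
  theorem.\<close>

definition translation_bound :: "real \<Rightarrow> ('a::euclidean_space \<Rightarrow> real) \<Rightarrow> bool" where
  "translation_bound K w \<longleftrightarrow> (\<forall>e\<in>Basis. \<forall>t\<ge>0.
     (\<integral>\<^sup>+x. ennreal ((w (x + t *\<^sub>R e) - w x)\<^sup>2) \<partial>lborel) \<le> ennreal (t * K))"

lemma translation_bound_mono:
  assumes "translation_bound K w" "K \<le> K'"
  shows "translation_bound K' w"
  unfolding translation_bound_def
proof (intro ballI allI impI)
  fix e t assume e: "e \<in> (Basis :: 'a set)" and t: "(0::real) \<le> t"
  have "ennreal (t * K) \<le> ennreal (t * K')" using t assms(2) by (intro ennreal_leI mult_left_mono)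
  then show "(\<integral>\<^sup>+x. ennreal ((w (x + t *\<^sub>R e) - w x)\<^sup>2) \<partial>lborel) \<le> ennreal (t * K')"
    using assms(1) e t unfolding translation_bound_def by (blast intro: order_trans)
qed

text \<open>Translate in one coordinate after the other. The square of a sum is at most twice the
  sum of the squares, so the constants grow from 4 ^ k to 2 + 2 4 ^ k, which is at most 4 ^ (k +
  1).\<close>

lemma translate_by_vector:
  fixes w :: "'a::euclidean_space \<Rightarrow> real"
  assumes [measurable]: "w \<in> borel_measurable borel" and C: "C \<ge> 0"
    and tr: "translation_bound C w"
    and z: "\<And>i. i \<in> Basis \<Longrightarrow> \<bar>z \<bullet> i\<bar> \<le> \<delta>" and \<delta>: "\<delta> \<ge> 0"
  shows "(\<integral>\<^sup>+x. ennreal ((w (x + z) - w x)\<^sup>2) \<partial>lborel) \<le> ennreal (4 ^ DIM('a) * (C * \<delta>))"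
proof -
  have one: "(\<integral>\<^sup>+x. ennreal ((w (x + t *\<^sub>R e) - w x)\<^sup>2) \<partial>lborel) \<le> ennreal (C * \<delta>)"
    if e: "e \<in> Basis" and t: "\<bar>t\<bar> \<le> \<delta>" for e t
  proof -
    have "(\<integral>\<^sup>+x. ennreal ((w (x + t *\<^sub>R e) - w x)\<^sup>2) \<partial>lborel)
      = (\<integral>\<^sup>+x. ennreal ((w (x + \<bar>t\<bar> *\<^sub>R e) - w x)\<^sup>2) \<partial>lborel)"
    proof (cases "t \<ge> 0")
      \<comment> \<open>A negative translation is shifted back to a positive one; the square does
        not see the sign.\<close>
      case False
      have "(\<integral>\<^sup>+x. ennreal ((w (x + t *\<^sub>R e) - w x)\<^sup>2) \<partial>lborel)
        = (\<integral>\<^sup>+x. ennreal ((w ((x + (- t) *\<^sub>R e) + t *\<^sub>R e) - w (x + (- t) *\<^sub>R e))\<^sup>2) \<partial>lborel)"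
        by (rule nn_integral_lborel_translate[of "\<lambda>x. ennreal ((w (x + t *\<^sub>R e) - w x)\<^sup>2)", symmetric]; measurable)
      also have "\<dots> = (\<integral>\<^sup>+x. ennreal ((w (x + \<bar>t\<bar> *\<^sub>R e) - w x)\<^sup>2) \<partial>lborel)"
        using False by (intro nn_integral_cong) (simp add: power2_commute)
      finally show ?thesis .
    qed simp
    also have "\<dots> \<le> ennreal (\<bar>t\<bar> * C)" using tr e by (simp add: translation_bound_def)
    also have "\<dots> \<le> ennreal (C * \<delta>)"
      using mult_right_mono[OF t C] by (intro ennreal_leI) (simp add: mult.commute)
    finally show ?thesis .
  qed
  have "(\<integral>\<^sup>+x. ennreal ((w (x + (\<Sum>i\<in>S. (z \<bullet> i) *\<^sub>R i)) - w x)\<^sup>2) \<partial>lborel) \<le> ennreal (4 ^ card S * (C * \<delta>))"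
    if "finite S" "S \<subseteq> Basis" for S
    using that
  proof (induction S)
    case (insert i S)
    define y where "y = (\<Sum>i\<in>S. (z \<bullet> i) *\<^sub>R i)"
    have "(\<integral>\<^sup>+x. ennreal ((w (x + (\<Sum>i\<in>insert i S. (z \<bullet> i) *\<^sub>R i)) - w x)\<^sup>2) \<partial>lborel)
      = (\<integral>\<^sup>+x. ennreal ((w ((x + y) + (z \<bullet> i) *\<^sub>R i) - w x)\<^sup>2) \<partial>lborel)"
      using insert.hyps by (simp add: y_def algebra_simps)
    also have "\<dots> \<le> (\<integral>\<^sup>+x. 2 * ennreal ((w ((x + y) + (z \<bullet> i) *\<^sub>R i) - w (x + y))\<^sup>2) + 2 * ennreal ((w (x + y) - w x)\<^sup>2) \<partial>lborel)"
    proof (rule nn_integral_mono)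
      fix x
      have "(w ((x + y) + (z \<bullet> i) *\<^sub>R i) - w x)\<^sup>2
        \<le> 2 * (w ((x + y) + (z \<bullet> i) *\<^sub>R i) - w (x + y))\<^sup>2 + 2 * (w (x + y) - w x)\<^sup>2"
        using power2_add_le[of "w ((x + y) + (z \<bullet> i) *\<^sub>R i) - w (x + y)" "w (x + y) - w x"] by simp
      then show "ennreal ((w ((x + y) + (z \<bullet> i) *\<^sub>R i) - w x)\<^sup>2)
        \<le> 2 * ennreal ((w ((x + y) + (z \<bullet> i) *\<^sub>R i) - w (x + y))\<^sup>2) + 2 * ennreal ((w (x + y) - w x)\<^sup>2)"
        by (rule ennreal_le_two_mult_add) simp_all
    qed
    also have "\<dots> = 2 * (\<integral>\<^sup>+x. ennreal ((w ((x + y) + (z \<bullet> i) *\<^sub>R i) - w (x + y))\<^sup>2) \<partial>lborel)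
        + 2 * (\<integral>\<^sup>+x. ennreal ((w (x + y) - w x)\<^sup>2) \<partial>lborel)"
      by (simp add: nn_integral_add nn_integral_cmult)
    also have "(\<integral>\<^sup>+x. ennreal ((w ((x + y) + (z \<bullet> i) *\<^sub>R i) - w (x + y))\<^sup>2) \<partial>lborel)
      = (\<integral>\<^sup>+x. ennreal ((w (x + (z \<bullet> i) *\<^sub>R i) - w x)\<^sup>2) \<partial>lborel)"
      by (rule nn_integral_lborel_translate[of "\<lambda>x. ennreal ((w (x + (z \<bullet> i) *\<^sub>R i) - w x)\<^sup>2)"]; measurable)
    also have "\<dots> \<le> ennreal (C * \<delta>)" using insert.prems z by (intro one) auto
    also have "(\<integral>\<^sup>+x. ennreal ((w (x + y) - w x)\<^sup>2) \<partial>lborel) \<le> ennreal (4 ^ card S * (C * \<delta>))"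
      unfolding y_def using insert by auto
    also have "2 * ennreal (C * \<delta>) + 2 * ennreal (4 ^ card S * (C * \<delta>)) = ennreal (2 * (C * \<delta>) + 2 * (4 ^ card S * (C * \<delta>)))"
      using C \<delta> by (intro ennreal_two_mult_add) auto
    also have "\<dots> \<le> ennreal (4 ^ card (insert i S) * (C * \<delta>))"
    proof (rule ennreal_leI)
      have "1 * (C * \<delta>) \<le> 4 ^ card S * (C * \<delta>)" using C \<delta> by (intro mult_right_mono) auto
      then show "2 * (C * \<delta>) + 2 * (4 ^ card S * (C * \<delta>)) \<le> 4 ^ card (insert i S) * (C * \<delta>)"
        using card_insert_disjoint[OF insert.hyps] by (simp only: power_Suc mult.assoc)
    qed
    finally show ?case by (simp add: add_mono mult_left_mono)
  qed (use C \<delta> in simp)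
  from this[of Basis] show ?thesis by (simp add: euclidean_representation)
qed

section \<open>Grid cubes and the variance on them\<close>

text \<open>Grid cubes as classes of points with equal rounded coordinates: they are half-open, and
  two of them are equal or disjoint by construction.\<close>

definition cube_of :: "real \<Rightarrow> 'a::euclidean_space \<Rightarrow> 'a set" where
  "cube_of \<delta> p = {x. \<forall>i\<in>Basis. \<lfloor>x \<bullet> i / \<delta>\<rfloor> = \<lfloor>p \<bullet> i / \<delta>\<rfloor>}"

lemma cube_of_iff:
  assumes "\<delta> > 0"
  shows "x \<in> cube_of \<delta> p \<longleftrightarrow> (\<forall>i\<in>Basis. of_int \<lfloor>p \<bullet> i / \<delta>\<rfloor> * \<delta> \<le> x \<bullet> i \<and> x \<bullet> i < (of_int \<lfloor>p \<bullet> i / \<delta>\<rfloor> + 1) * \<delta>)"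
  using assms by (auto simp: cube_of_def floor_eq_iff field_simps)

lemma cube_of_eq: "q \<in> cube_of \<delta> p \<Longrightarrow> cube_of \<delta> q = cube_of \<delta> p"
  by (auto simp: cube_of_def)

lemma self_in_cube_of: "p \<in> cube_of \<delta> p"
  by (simp add: cube_of_def)

lemma cube_of_diff_le:
  assumes \<delta>: "\<delta> > 0" and "x \<in> cube_of \<delta> p" "y \<in> cube_of \<delta> p" "i \<in> Basis"
  shows "\<bar>(y - x) \<bullet> i\<bar> \<le> \<delta>"
proof -
  have "of_int \<lfloor>p \<bullet> i / \<delta>\<rfloor> * \<delta> \<le> x \<bullet> i" "x \<bullet> i < of_int \<lfloor>p \<bullet> i / \<delta>\<rfloor> * \<delta> + \<delta>"
    "of_int \<lfloor>p \<bullet> i / \<delta>\<rfloor> * \<delta> \<le> y \<bullet> i" "y \<bullet> i < of_int \<lfloor>p \<bullet> i / \<delta>\<rfloor> * \<delta> + \<delta>"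
    using assms by (auto simp: cube_of_iff[OF \<delta>] algebra_simps)
  then show ?thesis by (simp add: inner_diff_left abs_le_iff)
qed

text \<open>The cube lies between an open and a closed box of the same volume.\<close>

lemma
  fixes p :: "'a::euclidean_space"
  assumes \<delta>: "\<delta> > 0"
  shows borel_cube_of: "cube_of \<delta> p \<in> sets borel"
    and emeasure_cube_of: "emeasure lborel (cube_of \<delta> p) = ennreal (\<delta> ^ DIM('a))"
    and bounded_cube_of: "bounded (cube_of \<delta> p)"
proof -
  define l where "l = (\<Sum>i\<in>Basis. (of_int \<lfloor>p \<bullet> i / \<delta>\<rfloor> * \<delta>) *\<^sub>R i)"
  define u where "u = (\<Sum>i\<in>Basis. ((of_int \<lfloor>p \<bullet> i / \<delta>\<rfloor> + 1) * \<delta>) *\<^sub>R i)"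
  have l: "l \<bullet> i = of_int \<lfloor>p \<bullet> i / \<delta>\<rfloor> * \<delta>" and u: "u \<bullet> i = (of_int \<lfloor>p \<bullet> i / \<delta>\<rfloor> + 1) * \<delta>"
    if "i \<in> Basis" for i using that by (simp_all add: l_def u_def)
  have sub: "box l u \<subseteq> cube_of \<delta> p" "cube_of \<delta> p \<subseteq> cbox l u"
    by (auto simp: cube_of_iff[OF \<delta>] mem_box l u less_imp_le)
  have "cube_of \<delta> p = (\<Inter>i\<in>Basis. {x. l \<bullet> i \<le> x \<bullet> i} \<inter> {x. x \<bullet> i < u \<bullet> i})"
    by (auto simp: cube_of_iff[OF \<delta>] l u)
  also have "\<dots> \<in> sets borel"
    by (intro sets.finite_INT finite_Basis nonempty_Basis sets.Int) measurable
  finally show m: "cube_of \<delta> p \<in> sets borel" .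
  show "bounded (cube_of \<delta> p)" using sub(2) bounded_cbox bounded_subset by blast
  have lu: "l \<bullet> i \<le> u \<bullet> i" "(u - l) \<bullet> i = \<delta>" if "i \<in> Basis" for i
    using that \<delta> by (simp_all add: l u inner_diff_left algebra_simps)
  have "emeasure lborel (box l u) = ennreal (\<delta> ^ DIM('a))" "emeasure lborel (cbox l u) = ennreal (\<delta> ^ DIM('a))"
    using lu by (simp_all add: emeasure_lborel_box_eq emeasure_lborel_cbox_eq)
  moreover have "emeasure lborel (box l u) \<le> emeasure lborel (cube_of \<delta> p)"
    using m by (intro emeasure_mono sub) simp
  moreover have "emeasure lborel (cube_of \<delta> p) \<le> emeasure lborel (cbox l u)"
    by (intro emeasure_mono sub) simp
  ultimately show "emeasure lborel (cube_of \<delta> p) = ennreal (\<delta> ^ DIM('a))" by simp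
qed

lemma finite_cubes:
  fixes R :: real
  assumes "\<delta> > 0"
  shows "finite (cube_of \<delta> ` cball (0::'a::euclidean_space) R)"
proof -
  define N where "N = \<lceil>R / \<delta>\<rceil>"
  define F where "F p = (\<lambda>i\<in>(Basis::'a set). \<lfloor>p \<bullet> i / \<delta>\<rfloor>)" for p :: 'a
  define Q where "Q f = {x::'a. \<forall>i\<in>Basis. \<lfloor>x \<bullet> i / \<delta>\<rfloor> = f i}" for f :: "'a \<Rightarrow> int"
  have "F p \<in> PiE Basis (\<lambda>_. {- N - 1..N})" if "p \<in> cball 0 R" for p
  proof -
    have "- N - 1 \<le> \<lfloor>p \<bullet> i / \<delta>\<rfloor> \<and> \<lfloor>p \<bullet> i / \<delta>\<rfloor> \<le> N" if i: "i \<in> Basis" for i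
    proof -
      have "\<bar>p \<bullet> i\<bar> \<le> R" using Basis_le_norm[OF i, of p] \<open>p \<in> cball 0 R\<close> by simp
      then have "\<bar>p \<bullet> i / \<delta>\<bar> \<le> R / \<delta>" using assms by (simp add: divide_right_mono)
      also have "\<dots> \<le> of_int N" unfolding N_def by (rule le_of_int_ceiling)
      finally have "p \<bullet> i / \<delta> \<le> of_int N" "- of_int N \<le> p \<bullet> i / \<delta>" by linarith+
      then show ?thesis by linarith
    qed
    then show ?thesis by (auto simp: F_def)
  qed
  then have "F ` cball 0 R \<subseteq> PiE Basis (\<lambda>_. {- N - 1..N})" by blast
  then have "finite (F ` cball 0 R)"
    by (rule finite_subset) (intro finite_PiE, auto)
  then have "finite (Q ` F ` cball 0 R)" by simp
  moreover have "Q (F p) = cube_of \<delta> p" for p by (auto simp: Q_def F_def cube_of_def)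
  ultimately show ?thesis by (simp add: image_image)
qed

text \<open>Expand the square. The identity expresses the deviation of w from its mean over Q by
  differences of values, that is by translations; nonnegativity of the same expression yields the
  third claim, the Cauchy--Schwarz inequality.\<close>

lemma variance_double_integral:
  fixes w :: "'a::euclidean_space \<Rightarrow> real"
  assumes [measurable]: "w \<in> borel_measurable borel" "Q \<in> sets borel"
    and w2: "set_integrable lborel Q (\<lambda>x. (w x)\<^sup>2)" and fin: "emeasure lborel Q = ennreal m" "m \<ge> 0"
  shows "set_integrable lborel Q w"
    and "(\<integral>\<^sup>+x\<in>Q. (\<integral>\<^sup>+y\<in>Q. ennreal ((w x - w y)\<^sup>2) \<partial>lborel) \<partial>lborel)
       = ennreal (2 * m * (LINT x:Q|lborel. (w x)\<^sup>2) - 2 * (LINT x:Q|lborel. w x)\<^sup>2)"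
    and "(LINT x:Q|lborel. w x)\<^sup>2 \<le> m * (LINT x:Q|lborel. (w x)\<^sup>2)"
proof -
  have c: "set_integrable lborel Q (\<lambda>x. c)" for c :: real
    using fin by (simp add: set_integrable_def)
  have mQ: "measure lborel Q = m" using fin by (simp add: measure_def)
  \<comment> \<open>On a set of finite measure 1 + w^2 is an integrable majorant of |w|.\<close>
  have "set_integrable lborel Q (\<lambda>x. 1 + (w x)\<^sup>2)"
    by (intro set_integral_add c w2)
  then show w1: "set_integrable lborel Q w"
    unfolding set_integrable_def
  proof (rule Bochner_Integration.integrable_bound)
    have "\<bar>w x\<bar> \<le> \<bar>1 + (w x)\<^sup>2\<bar>" for x
      using two_realpow_ge_one[of 0] zero_le_power2[of "\<bar>w x\<bar> - 1"] by (simp add: power2_eq_square algebra_simps)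
    then show "AE x in lborel. norm (indicat_real Q x *\<^sub>R w x) \<le> norm (indicat_real Q x *\<^sub>R (1 + (w x)\<^sup>2))"
      by (auto simp: indicator_def)
  qed measurable
  define A where "A = (LINT x:Q|lborel. (w x)\<^sup>2)"
  define B where "B = (LINT x:Q|lborel. w x)"
  have inner: "(\<integral>\<^sup>+y\<in>Q. ennreal ((w x - w y)\<^sup>2) \<partial>lborel) = ennreal (m * (w x)\<^sup>2 - 2 * B * w x + A)" for x
  proof -
    have "(\<integral>\<^sup>+y\<in>Q. ennreal ((w x - w y)\<^sup>2) \<partial>lborel) = (\<integral>\<^sup>+y\<in>Q. ennreal ((w x)\<^sup>2 - 2 * w x * w y + (w y)\<^sup>2) \<partial>lborel)"
      by (intro nn_integral_cong) (simp add: power2_diff algebra_simps)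
    also have "\<dots> = ennreal (LINT y:Q|lborel. (w x)\<^sup>2 - 2 * w x * w y + (w y)\<^sup>2)"
    proof (rule set_nn_integral_eq_set_integral)
      show "set_integrable lborel Q (\<lambda>y. (w x)\<^sup>2 - 2 * w x * w y + (w y)\<^sup>2)"
        by (intro set_integral_add set_integral_diff c w2 set_integrable_mult_right w1)
      show "0 \<le> (w x)\<^sup>2 - 2 * w x * w y + (w y)\<^sup>2" for y
        using zero_le_power2[of "w x - w y"] by (simp add: power2_diff algebra_simps)
    qed
    also have "(LINT y:Q|lborel. (w x)\<^sup>2 - 2 * w x * w y + (w y)\<^sup>2) = m * (w x)\<^sup>2 - 2 * w x * B + A"
      using fin by (simp add: set_integral_add set_integral_diff c w2 w1 A_def B_def mQ set_integral_const)
    finally show ?thesis by (simp add: mult.commute mult.left_commute)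
  qed
  have pos: "m * (w x)\<^sup>2 - 2 * B * w x + A \<ge> 0" for x
  proof -
    have "0 \<le> (LINT y:Q|lborel. (w x - w y)\<^sup>2)"
      unfolding set_lebesgue_integral_def by (intro integral_nonneg_AE) auto
    also have "\<dots> = (LINT y:Q|lborel. (w x)\<^sup>2 - 2 * w x * w y + (w y)\<^sup>2)"
      by (simp add: power2_diff algebra_simps)
    also have "\<dots> = m * (w x)\<^sup>2 - 2 * w x * B + A"
      using fin by (simp add: set_integral_add set_integral_diff c w2 w1 A_def B_def mQ set_integral_const)
    finally show ?thesis by (simp add: mult.commute mult.left_commute)
  qed
  have int: "set_integrable lborel Q (\<lambda>x. m * (w x)\<^sup>2 - 2 * B * w x + A)"
    by (intro set_integral_add set_integral_diff c w2 set_integrable_mult_right w1)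
  have eq: "(LINT x:Q|lborel. m * (w x)\<^sup>2 - 2 * B * w x + A) = 2 * m * A - 2 * B\<^sup>2"
  proof -
    have "(LINT x:Q|lborel. m * (w x)\<^sup>2 - 2 * B * w x + A) = m * A - 2 * B * B + m * A"
      using fin by (simp add: set_integral_add set_integral_diff c w2 w1 A_def[symmetric] B_def[symmetric] mQ set_integral_const)
    then show ?thesis by (simp add: power2_eq_square)
  qed
  have "(\<integral>\<^sup>+x\<in>Q. (\<integral>\<^sup>+y\<in>Q. ennreal ((w x - w y)\<^sup>2) \<partial>lborel) \<partial>lborel)
    = (\<integral>\<^sup>+x\<in>Q. ennreal (m * (w x)\<^sup>2 - 2 * B * w x + A) \<partial>lborel)"
    by (simp only: inner)
  also have "\<dots> = ennreal (LINT x:Q|lborel. m * (w x)\<^sup>2 - 2 * B * w x + A)"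
    by (intro set_nn_integral_eq_set_integral int pos)
  finally show "(\<integral>\<^sup>+x\<in>Q. (\<integral>\<^sup>+y\<in>Q. ennreal ((w x - w y)\<^sup>2) \<partial>lborel) \<partial>lborel)
       = ennreal (2 * m * (LINT x:Q|lborel. (w x)\<^sup>2) - 2 * (LINT x:Q|lborel. w x)\<^sup>2)"
    unfolding eq by (simp only: A_def B_def)
  have "0 \<le> (LINT x:Q|lborel. m * (w x)\<^sup>2 - 2 * B * w x + A)"
    unfolding set_lebesgue_integral_def using pos by (intro integral_nonneg_AE) auto
  then show "(LINT x:Q|lborel. w x)\<^sup>2 \<le> m * (LINT x:Q|lborel. (w x)\<^sup>2)"
    unfolding eq by (simp add: A_def B_def)
qed

lemma integral_sum_disjoint_cover:
  fixes f :: "'a \<Rightarrow> real"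
  assumes "finite \<Q>" "disjoint \<Q>" "\<And>Q. Q \<in> \<Q> \<Longrightarrow> set_integrable M Q f"
    and "\<And>x. f x \<noteq> 0 \<Longrightarrow> x \<in> \<Union>\<Q>"
  shows "integral\<^sup>L M f = (\<Sum>Q\<in>\<Q>. LINT x:Q|M. f x)"
proof -
  have "f x = (\<Sum>Q\<in>\<Q>. indicator Q x *\<^sub>R f x)" for x
  proof (cases "f x = 0")
    case False
    then obtain P where P: "P \<in> \<Q>" "x \<in> P" using assms(4) by blast
    have "Q = P" if "Q \<in> \<Q>" "x \<in> Q" for Q
      using disjointD[OF assms(2) that(1) P(1)] that(2) P(2) by blast
    then show ?thesis
      using sum_indicator_unique[OF assms(1) P, of "\<lambda>_. f x"] by simp
  qed simp
  then have "integral\<^sup>L M f = integral\<^sup>L M (\<lambda>x. \<Sum>Q\<in>\<Q>. indicator Q x *\<^sub>R f x)"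
    by presburger
  also have "\<dots> = (\<Sum>Q\<in>\<Q>. LINT x:Q|M. f x)"
    unfolding set_lebesgue_integral_def
    using assms(3) by (intro Bochner_Integration.integral_sum) (auto simp: set_integrable_def)
  finally show ?thesis .
qed

text \<open>On a cube of volume m the square integral exceeds the term of the mean by the double
  integral of (w x - w y)^2 divided by 2 m. Two points of one cube differ by some z in
  \<open>B\<close>; after the substitution y = x + z and an exchange of integrals the translation
  bound applies, and \<open>B\<close> has 2 ^ d times the volume of a cube.\<close>

lemma sq_integral_le_cube_means:
  fixes w :: "'a::euclidean_space \<Rightarrow> real"
  assumes [measurable]: "w \<in> borel_measurable borel" and w2: "integrable lborel (\<lambda>x. (w x)\<^sup>2)"
    and supp: "\<And>x. w x \<noteq> 0 \<Longrightarrow> x \<in> cball 0 R" and \<delta>: "\<delta> > 0" and K: "K \<ge> 0"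
    and tr: "\<And>z. (\<And>i. i \<in> Basis \<Longrightarrow> \<bar>z \<bullet> i\<bar> \<le> \<delta>) \<Longrightarrow>
      (\<integral>\<^sup>+x. ennreal ((w (x + z) - w x)\<^sup>2) \<partial>lborel) \<le> ennreal K"
  shows "(LINT x|lborel. (w x)\<^sup>2)
    \<le> (\<Sum>Q\<in>cube_of \<delta> ` cball 0 R. (LINT x:Q|lborel. w x)\<^sup>2 / \<delta> ^ DIM('a)) + 2 ^ DIM('a) * K"
proof -
  define \<Q> where "\<Q> = cube_of \<delta> ` cball (0::'a) R"
  define m where "m = \<delta> ^ DIM('a)"
  define B where "B = cbox (- \<delta> *\<^sub>R One) (\<delta> *\<^sub>R One :: 'a)"
  define D where "D Q x = (\<integral>\<^sup>+y\<in>Q. ennreal ((w x - w y)\<^sup>2) \<partial>lborel)" for Q x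
  have m0: "m > 0" using \<delta> by (simp add: m_def)
  have fin: "finite \<Q>" unfolding \<Q>_def by (rule finite_cubes[OF \<delta>])
  have Q: "Q \<in> sets borel" "emeasure lborel Q = ennreal m" if "Q \<in> \<Q>" for Q
    using that borel_cube_of[OF \<delta>] emeasure_cube_of[OF \<delta>] by (auto simp: \<Q>_def m_def)
  have disj: "disjoint \<Q>"
    unfolding disjoint_def \<Q>_def using cube_of_eq by blast
  have int: "set_integrable lborel Q (\<lambda>x. (w x)\<^sup>2)" if "Q \<in> \<Q>" for Q
    unfolding set_integrable_def using Q(1)[OF that] by (intro integrable_mult_indicator w2) simp
  have cover: "(LINT x|lborel. (w x)\<^sup>2) = (\<Sum>Q\<in>\<Q>. LINT x:Q|lborel. (w x)\<^sup>2)"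
  proof (rule integral_sum_disjoint_cover[OF fin disj int])
    fix x assume "(w x)\<^sup>2 \<noteq> 0"
    then have "x \<in> cball 0 R" using supp[of x] by simp
    then show "x \<in> \<Union>\<Q>" unfolding \<Q>_def using self_in_cube_of[of x \<delta>] by blast
  qed
  note var = variance_double_integral[OF assms(1) Q(1) int Q(2) less_imp_le[OF m0], folded D_def]
  have [measurable]: "B \<in> sets borel" by (simp add: B_def)
  have "ennreal (\<Sum>Q\<in>\<Q>. 2 * m * (LINT x:Q|lborel. (w x)\<^sup>2) - 2 * (LINT x:Q|lborel. w x)\<^sup>2)
    = (\<Sum>Q\<in>\<Q>. ennreal (2 * m * (LINT x:Q|lborel. (w x)\<^sup>2) - 2 * (LINT x:Q|lborel. w x)\<^sup>2))"
    using var(3) by (intro sum_ennreal[symmetric]) (simp add: mult.assoc)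
  also have "\<dots> = (\<Sum>Q\<in>\<Q>. \<integral>\<^sup>+x\<in>Q. D Q x \<partial>lborel)"
    by (intro sum.cong refl var(2)[symmetric])
  also have "\<dots> = (\<integral>\<^sup>+x. (\<Sum>Q\<in>\<Q>. D Q x * indicator Q x) \<partial>lborel)"
  proof (rule nn_integral_sum[symmetric])
    fix Q assume "Q \<in> \<Q>"
    then have [measurable]: "Q \<in> sets borel" by (rule Q(1))
    show "(\<lambda>x. D Q x * indicator Q x) \<in> borel_measurable lborel"
      unfolding D_def by measurable
  qed
  also have "\<dots> \<le> (\<integral>\<^sup>+x. (\<integral>\<^sup>+y. ennreal ((w y - w x)\<^sup>2) * indicator B (y - x) \<partial>lborel) \<partial>lborel)"
  proof (rule nn_integral_mono)
    fix x
    show "(\<Sum>Q\<in>\<Q>. D Q x * indicator Q x)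
       \<le> (\<integral>\<^sup>+y. ennreal ((w y - w x)\<^sup>2) * indicator B (y - x) \<partial>lborel)"
    proof (cases "\<exists>Q\<in>\<Q>. x \<in> Q")
      case True
      then obtain P where P: "P \<in> \<Q>" "x \<in> P" by blast
      have "Q = P" if "Q \<in> \<Q>" "x \<in> Q" for Q
        using disjointD[OF disj that(1) P(1)] that(2) P(2) by blast
      then have "(\<Sum>Q\<in>\<Q>. D Q x * indicator Q x)
        = D P x"
        using sum_indicator_unique[OF fin P, of "\<lambda>Q. D Q x"]
        by (simp add: mult.commute)
      also have "\<dots> \<le> (\<integral>\<^sup>+y. ennreal ((w y - w x)\<^sup>2) * indicator B (y - x) \<partial>lborel)"
        unfolding D_def
      proof (rule nn_integral_mono)
        fix y
        have "y - x \<in> B" if "y \<in> P"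
        proof -
          obtain p where p: "P = cube_of \<delta> p" using P(1) by (auto simp: \<Q>_def)
          have "\<bar>(y - x) \<bullet> i\<bar> \<le> \<delta>" if "i \<in> Basis" for i
            using cube_of_diff_le[OF \<delta> _ _ that] P(2) \<open>y \<in> P\<close> unfolding p by blast
          then have "- \<delta> \<le> (y - x) \<bullet> i \<and> (y - x) \<bullet> i \<le> \<delta>" if "i \<in> Basis" for i
            using that by (meson abs_le_D1 abs_le_D2 minus_le_iff)
          then show ?thesis unfolding B_def mem_box by simp
        qed
        then show "ennreal ((w x - w y)\<^sup>2) * indicator P y \<le> ennreal ((w y - w x)\<^sup>2) * indicator B (y - x)"
          by (auto simp: indicator_def power2_commute)
      qed
      finally show ?thesis .
    next
      case False
      then have "(\<Sum>Q\<in>\<Q>. D Q x * indicator Q x) = 0"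
        by (intro sum.neutral) auto
      then show ?thesis by simp
    qed
  qed
  also have "\<dots> = (\<integral>\<^sup>+x. (\<integral>\<^sup>+z. ennreal ((w (x + z) - w x)\<^sup>2) * indicator B z \<partial>lborel) \<partial>lborel)"
  proof (rule nn_integral_cong)
    fix x
    have "(\<lambda>y. ennreal ((w y - w x)\<^sup>2) * indicator B (y - x)) \<in> borel_measurable borel" by measurable
    from nn_integral_lborel_translate[OF this, of x]
    show "(\<integral>\<^sup>+y. ennreal ((w y - w x)\<^sup>2) * indicator B (y - x) \<partial>lborel)
      = (\<integral>\<^sup>+z. ennreal ((w (x + z) - w x)\<^sup>2) * indicator B z \<partial>lborel)"
      by (simp add: add.commute)
  qed
  also have "\<dots> = (\<integral>\<^sup>+z. (\<integral>\<^sup>+x. ennreal ((w (x + z) - w x)\<^sup>2) * indicator B z \<partial>lborel) \<partial>lborel)"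
    by (rule lborel_pair.Fubini') measurable
  also have "\<dots> \<le> (\<integral>\<^sup>+z. ennreal K * indicator B z \<partial>lborel)"
  proof (rule nn_integral_mono)
    fix z
    show "(\<integral>\<^sup>+x. ennreal ((w (x + z) - w x)\<^sup>2) * indicator B z \<partial>lborel) \<le> ennreal K * indicator B z"
    proof (cases "z \<in> B")
      case True
      then have "\<bar>z \<bullet> i\<bar> \<le> \<delta>" if "i \<in> Basis" for i
        using that unfolding B_def mem_box by (auto simp: abs_le_iff)
      then show ?thesis using tr[of z] True by simp
    qed simp
  qed
  also have "\<dots> = ennreal K * emeasure lborel B"
    by (rule nn_integral_cmult_indicator) (simp add: B_def)
  also have "emeasure lborel B = ennreal (2 ^ DIM('a) * m)"
  proof -
    have "emeasure lborel B = ennreal (\<Prod>i\<in>(Basis::'a set). (\<delta> *\<^sub>R One - (- \<delta> *\<^sub>R One)) \<bullet> i)"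
      unfolding B_def using \<delta> by (intro emeasure_lborel_cbox) (simp add: inner_simps)
    also have "(\<Prod>i\<in>(Basis::'a set). (\<delta> *\<^sub>R One - (- \<delta> *\<^sub>R One)) \<bullet> i) = (\<Prod>i\<in>(Basis::'a set). 2 * \<delta>)"
      by (intro prod.cong refl) (simp add: inner_simps)
    also have "\<dots> = 2 ^ DIM('a) * m" by (simp add: m_def power_mult_distrib)
    finally show ?thesis .
  qed
  also have "ennreal K * ennreal (2 ^ DIM('a) * m) = ennreal (K * (2 ^ DIM('a) * m))"
    using K m0 by (simp add: ennreal_mult)
  finally have "(\<Sum>Q\<in>\<Q>. 2 * m * (LINT x:Q|lborel. (w x)\<^sup>2) - 2 * (LINT x:Q|lborel. w x)\<^sup>2) \<le> K * (2 ^ DIM('a) * m)"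
    using K m0 by (simp add: ennreal_le_iff)
  then have "2 * m * (LINT x|lborel. (w x)\<^sup>2) \<le> 2 * (\<Sum>Q\<in>\<Q>. (LINT x:Q|lborel. w x)\<^sup>2) + K * (2 ^ DIM('a) * m)"
    by (simp add: cover sum_subtractf sum_distrib_left)
  moreover have "0 \<le> K * (2 ^ DIM('a) * m)" using K m0 by simp
  ultimately have "m * (LINT x|lborel. (w x)\<^sup>2) \<le> (\<Sum>Q\<in>\<Q>. (LINT x:Q|lborel. w x)\<^sup>2) + K * (2 ^ DIM('a) * m)"
    by linarith
  then have "(LINT x|lborel. (w x)\<^sup>2) \<le> ((\<Sum>Q\<in>\<Q>. (LINT x:Q|lborel. w x)\<^sup>2) + K * (2 ^ DIM('a) * m)) / m"
    using m0 by (simp add: pos_le_divide_eq mult.commute)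
  also have "\<dots> = (\<Sum>Q\<in>\<Q>. (LINT x:Q|lborel. w x)\<^sup>2 / m) + 2 ^ DIM('a) * K"
    using m0 by (simp add: add_divide_distrib sum_divide_distrib)
  finally show ?thesis by (simp add: \<Q>_def m_def)
qed

text \<open>The order of choices matters: the cube size is fixed first, by means of the
  \<open>C\<close> common to all j; then finitely many cubes remain, on each of which the integrals
  converge, and by Cauchy--Schwarz the means of v contribute at most its square integral.\<close>

lemma sq_integral_limsup_le:
  fixes w :: "nat \<Rightarrow> 'a::euclidean_space \<Rightarrow> real" and v :: "'a \<Rightarrow> real"
  assumes wm: "\<And>j. w j \<in> borel_measurable borel" and w2: "\<And>j. integrable lborel (\<lambda>x. (w j x)\<^sup>2)"
    and supp: "\<And>j x. w j x \<noteq> 0 \<Longrightarrow> x \<in> cball 0 R" and C: "C \<ge> 0"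
    and tr: "\<And>j. translation_bound C (w j)"
    and vm: "v \<in> borel_measurable borel" and v2: "integrable lborel (\<lambda>x. (v x)\<^sup>2)"
    and weak: "\<And>Q. Q \<in> sets borel \<Longrightarrow> bounded Q \<Longrightarrow>
      (\<lambda>j. LINT x:Q|lborel. w j x) \<longlonglongrightarrow> (LINT x:Q|lborel. v x)"
    and \<eta>: "\<eta> > 0"
  shows "\<forall>\<^sub>F j in sequentially. (LINT x|lborel. (w j x)\<^sup>2) \<le> (LINT x|lborel. (v x)\<^sup>2) + \<eta>"
proof -
  \<comment> \<open>The coefficient of \<delta> in the remainder, plus 1 so that it can be divided
    by.\<close>
  define c where "c = 2 ^ DIM('a) * (4 ^ DIM('a) * C) + 1"
  define \<delta> where "\<delta> = \<eta> / (2 * c)"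
  have c0: "c > 0" unfolding c_def using C by (intro add_nonneg_pos) auto
  have \<delta>: "\<delta> > 0" using c0 \<eta> by (simp add: \<delta>_def)
  have small: "2 ^ DIM('a) * (4 ^ DIM('a) * (C * \<delta>)) \<le> \<eta> / 2"
  proof -
    have "2 ^ DIM('a) * (4 ^ DIM('a) * (C * \<delta>)) = (c - 1) * \<delta>" by (simp add: c_def)
    also have "\<dots> \<le> c * \<delta>" using \<delta> by (intro mult_right_mono) auto
    also have "\<dots> = \<eta> / 2" using c0 by (simp add: \<delta>_def)
    finally show ?thesis .
  qed
  define \<Q> where "\<Q> = cube_of \<delta> ` cball (0::'a) R"
  define M where "M u = (\<Sum>Q\<in>\<Q>. (LINT x:Q|lborel. u x)\<^sup>2 / \<delta> ^ DIM('a))" for u :: "'a \<Rightarrow> real"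
  have Q: "Q \<in> sets borel" "bounded Q" "emeasure lborel Q = ennreal (\<delta> ^ DIM('a))" if "Q \<in> \<Q>" for Q
    using that borel_cube_of[OF \<delta>] bounded_cube_of[OF \<delta>] emeasure_cube_of[OF \<delta>] by (auto simp: \<Q>_def)
  have "(\<lambda>j. M (w j)) \<longlonglongrightarrow> M v"
    unfolding M_def using \<delta> by (intro tendsto_sum tendsto_divide tendsto_power weak Q) auto
  then have ev: "\<forall>\<^sub>F j in sequentially. M (w j) < M v + \<eta> / 2"
    using \<eta> by (intro order_tendstoD) auto
  have le: "(LINT x|lborel. (w j x)\<^sup>2) \<le> M (w j) + \<eta> / 2" for j
  proof -
    have "(LINT x|lborel. (w j x)\<^sup>2) \<le> M (w j) + 2 ^ DIM('a) * (4 ^ DIM('a) * (C * \<delta>))"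
      unfolding M_def \<Q>_def using C \<delta>
      by (intro sq_integral_le_cube_means wm w2 supp translate_by_vector[OF wm C tr]) auto
    then show ?thesis using small by linarith
  qed
  have Mv: "M v \<le> (LINT x|lborel. (v x)\<^sup>2)"
  proof -
    have int: "set_integrable lborel Q (\<lambda>x. (v x)\<^sup>2)" if "Q \<in> sets borel" for Q
      unfolding set_integrable_def using that by (intro integrable_mult_indicator v2) simp
    have fin: "finite \<Q>" unfolding \<Q>_def by (rule finite_cubes[OF \<delta>])
    have disj: "disjoint \<Q>"
      unfolding disjoint_def \<Q>_def using cube_of_eq by blast
    have "(LINT x:Q|lborel. v x)\<^sup>2 / \<delta> ^ DIM('a) \<le> (LINT x:Q|lborel. (v x)\<^sup>2)" if "Q \<in> \<Q>" for Q
      using variance_double_integral(3)[OF vm Q(1)[OF that] int[OF Q(1)[OF that]] Q(3)[OF that]] \<delta>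
      by (simp add: divide_le_eq mult.commute)
    then have "M v \<le> (\<Sum>Q\<in>\<Q>. LINT x:Q|lborel. (v x)\<^sup>2)"
      unfolding M_def by (rule sum_mono)
    also have "\<dots> = (\<Sum>Q\<in>\<Q>. LINT x:Q|lborel. indicator (\<Union>\<Q>) x * (v x)\<^sup>2)"
      unfolding set_lebesgue_integral_def
      by (intro sum.cong refl Bochner_Integration.integral_cong) (auto simp: indicator_def)
    also have "\<dots> = (LINT x|lborel. indicator (\<Union>\<Q>) x * (v x)\<^sup>2)"
    proof (rule integral_sum_disjoint_cover[OF fin disj, symmetric])
      fix Q assume "Q \<in> \<Q>"
      have "(\<lambda>x. indicat_real Q x *\<^sub>R (indicat_real (\<Union>\<Q>) x * (v x)\<^sup>2)) = (\<lambda>x. indicat_real Q x *\<^sub>R (v x)\<^sup>2)"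
      proof
        fix x
        show "indicat_real Q x *\<^sub>R (indicat_real (\<Union>\<Q>) x * (v x)\<^sup>2) = indicat_real Q x *\<^sub>R (v x)\<^sup>2"
          using \<open>Q \<in> \<Q>\<close> by (cases "x \<in> Q") (auto simp: indicator_def)
      qed
      then show "set_integrable lborel Q (\<lambda>x. indicat_real (\<Union>\<Q>) x * (v x)\<^sup>2)"
        using int[OF Q(1)[OF \<open>Q \<in> \<Q>\<close>]] by (simp add: set_integrable_def)
    qed (auto simp: indicator_def split: if_splits)
    also have "\<dots> \<le> (LINT x|lborel. (v x)\<^sup>2)"
    proof (rule integral_mono)
      have "\<Union>\<Q> \<in> sets lborel" using fin Q(1) by (intro sets.finite_Union) auto
      then show "integrable lborel (\<lambda>x. indicat_real (\<Union>\<Q>) x * (v x)\<^sup>2)"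
        using integrable_mult_indicator[OF _ v2] by simp
    qed (auto simp: v2 indicator_def)
    finally show ?thesis .
  qed
  from ev show ?thesis
  proof eventually_elim
    case (elim j)
    then show ?case using le[of j] Mv by linarith
  qed
qed

section \<open>Strong convergence\<close>

text \<open>Translations and Fubini are applied to Borel functions on the whole space, while the
  function spaces on \<Omega> consist of Lebesgue measurable functions; this passes between the
  two.\<close>

lemma integral_lborel_eq_lebesgue_on:
  fixes g h :: "real^'d \<Rightarrow> real"
  assumes g: "g \<in> borel_measurable borel" and h: "h \<in> borel_measurable (lebesgue_on \<Omega>)"
    and \<Omega>: "\<Omega> \<in> sets lebesgue" and AE: "AE x in lebesgue. g x = indicator \<Omega> x * h x"
  shows "integral\<^sup>L lborel g = integral\<^sup>L (lebesgue_on \<Omega>) h"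
proof -
  have "(\<lambda>x. indicator \<Omega> x *\<^sub>R h x) \<in> borel_measurable lebesgue"
    using h \<Omega> by (simp add: borel_measurable_restrict_space_iff)
  moreover have "g \<in> borel_measurable lebesgue"
    using g by (intro measurable_completion) simp
  moreover have "integral\<^sup>L lborel g = integral\<^sup>L lebesgue g"
    using g by (intro integral_completion[symmetric]) simp
  ultimately have "integral\<^sup>L lborel g = integral\<^sup>L lebesgue (\<lambda>x. indicator \<Omega> x *\<^sub>R h x)"
    using AE by (simp, intro integral_cong_AE) auto
  then show ?thesis using \<Omega> by (simp add: integral_restrict_space)
qed

text \<open>\<open>w\<close> is a Borel representative of the zero extension. Besides the gradient
  norm, the mesh enters the bound only through the shape constant \<open>c\<close>.\<close>

lemma CR_component_translate:
  fixes v :: "real^'d \<Rightarrow> real^'d"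
  assumes \<T>: "conforming_triangulation \<Omega> \<T>" and \<Omega>: "open \<Omega>" "negligible (frontier \<Omega>)"
    and R: "closure \<Omega> \<subseteq> cball 0 R" "R \<ge> 0"
    and c: "\<And>T. T \<in> \<T> \<Longrightarrow> diameter T ^ CARD('d) \<le> c * measure lebesgue T" "c \<ge> 0"
    and v: "v \<in> CR_space \<Omega> \<T>" and jac: "jac v \<in> L2 \<Omega>"
  shows "\<exists>w. w \<in> borel_measurable borel \<and> integrable lborel (\<lambda>x. (w x)\<^sup>2) \<and>
    (AE x in lebesgue. w x = indicator \<Omega> x * (v x $ i)) \<and> (\<forall>x. w x \<noteq> 0 \<longrightarrow> x \<in> cball 0 R) \<and>
    translation_bound (translate_const CARD('d) R c * (l2_norm \<Omega> (jac v))\<^sup>2) w"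
proof -
  have "\<forall>T\<in>\<T>. \<exists>L C. linear L \<and> (\<forall>x\<in>interior T. v x = L x + C)"
    using v by (simp add: CR_space_def P1_on_def)
  then obtain L C where LC: "\<And>T. T \<in> \<T> \<Longrightarrow> linear (L T)" "\<And>T x. T \<in> \<T> \<Longrightarrow> x \<in> interior T \<Longrightarrow> v x = L T x + C T"
    by metis
  interpret broken_affine \<T> "\<lambda>T. matrix (L T) $ i" "\<lambda>T. C T $ i"
    by (rule CR_broken_affine[OF \<T> \<Omega>(1) v LC])
  have cover: "\<Union>\<T> = closure \<Omega>" using \<T> by (simp add: conforming_triangulation_def)
  have ae: "AE x in lebesgue. x \<notin> skeleton \<union> frontier \<Omega>"
    by (rule AE_not_in) (use negligible_skeleton \<Omega>(2) in \<open>simp add: negligible_iff_null_sets null_sets.Un\<close>)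
  have val_v: "val T x = v x $ i" if "T \<in> \<T>" "x \<in> interior T" for T x
  proof -
    have "L T x = matrix (L T) *v x" using matrix_vector_mul(2)[OF LC(1)[OF that(1)]] by (rule fun_cong[THEN sym])
    then have "L T x $ i = matrix (L T) $ i \<bullet> x" by (simp add: matrix_vector_mul_component)
    then show ?thesis using LC(2)[OF that] by (simp add: val_def)
  qed
  have eq: "AE x in lebesgue. fun_of x = indicator \<Omega> x * (v x $ i)"
    using ae
  proof eventually_elim
    case (elim x)
    show ?case
    proof (cases "x \<in> \<Omega>")
      case True
      then obtain T where T: "T \<in> \<T>" "x \<in> T" using cover closure_subset by blast
      then have "fun_of x = val T x" using fun_of_in elim by blast
      also have "\<dots> = v x $ i" using val_v[OF T(1)] in_interior[OF T] elim by blast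
      finally show ?thesis using True by simp
    next
      case False
      then have "x \<notin> closure \<Omega>" using elim \<Omega>(1) by (simp add: frontier_def interior_open)
      then show ?thesis using False cover fun_of_outside[of x] by simp
    qed
  qed
  \<comment> \<open>A row is at most as long as the Frobenius norm of the whole matrix, and
    \<open>jac v\<close> equals that matrix in the interior of each element.\<close>
  have grad: "sq_grad \<le> (l2_norm \<Omega> (jac v))\<^sup>2"
  proof -
    define s where "s x = (\<Sum>T\<in>\<T>. indicator T x * (norm (matrix (L T)))\<^sup>2)" for x
    have hb: "has_bochner_integral lborel s (\<Sum>T\<in>\<T>. measure lborel T * (norm (matrix (L T)))\<^sup>2)"
      unfolding s_def[abs_def]
      by (intro has_bochner_integral_sum has_bochner_integral_mult_left has_bochner_integral_indicator_compact elem(2)) auto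
    have "(\<Sum>T\<in>\<T>. measure lborel T * (norm (matrix (L T) $ i))\<^sup>2)
        \<le> (\<Sum>T\<in>\<T>. measure lborel T * (norm (matrix (L T)))\<^sup>2)"
      by (intro sum_mono mult_left_mono power_mono Finite_Cartesian_Product.norm_nth_le) auto
    also have "\<dots> = integral\<^sup>L lborel s" using hb by (simp add: has_bochner_integral_iff)
    also have "\<dots> = (\<integral>x. (norm (jac v x))\<^sup>2 \<partial>lebesgue_on \<Omega>)"
    proof (rule integral_lborel_eq_lebesgue_on)
      show "s \<in> borel_measurable borel" using hb by (auto simp: has_bochner_integral_iff dest: borel_measurable_integrable)
      show "(\<lambda>x. (norm (jac v x))\<^sup>2) \<in> borel_measurable (lebesgue_on \<Omega>)"
        using jac by (auto simp: L2_def)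
      show "\<Omega> \<in> sets lebesgue" using \<Omega>(1) by simp
      show "AE x in lebesgue. s x = indicator \<Omega> x * (norm (jac v x))\<^sup>2"
        using ae
      proof eventually_elim
        case (elim x)
        show ?case
        proof (cases "x \<in> \<Omega>")
          case True
          then obtain P where P: "P \<in> \<T>" "x \<in> P" using cover closure_subset by blast
          then have "jac v x = matrix (L P)"
            using in_interior[OF P] elim by (intro jac_affine[OF LC(1)[OF P(1)] LC(2)[OF P(1)]]) auto
          moreover have "s x = (norm (matrix (L P)))\<^sup>2"
            unfolding s_def using elim by (intro sum_indicator_elem[OF P]) blast
          ultimately show ?thesis using True by simp
        next
          case False
          then have "x \<notin> closure \<Omega>" using elim \<Omega>(1) by (simp add: frontier_def interior_open)
          then have "x \<notin> T" if "T \<in> \<T>" for T using cover that by blast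
          then show ?thesis using False by (simp add: s_def)
        qed
      qed
    qed
    also have "\<dots> = (l2_norm \<Omega> (jac v))\<^sup>2" by (simp add: l2_norm_def)
    finally show ?thesis by (simp add: sq_grad_def)
  qed
  have c': "diameter T ^ DIM(real^'d) \<le> c * measure lborel T" if "T \<in> \<T>" for T
    using c(1)[OF that] elem(2)[OF that] by (simp add: measure_completion borel_compact)
  show ?thesis
  proof (intro exI[of _ fun_of] conjI ballI allI impI)
    show "integrable lborel (\<lambda>x. (fun_of x)\<^sup>2)"
      using has_bochner_integral_fun_of_sq by (simp add: has_bochner_integral_iff)
    show "AE x in lebesgue. fun_of x = indicator \<Omega> x * (v x $ i)" by (rule eq)
    show "x \<in> cball 0 R" if "fun_of x \<noteq> 0" for x
      using fun_of_outside[of x] that cover R(1) by blast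
    have "translation_bound (translate_const CARD('d) R c * sq_grad) fun_of"
      unfolding translation_bound_def using l2_translate_grad[of _ _ R c] R cover c' c(2) by simp
    then show "translation_bound (translate_const CARD('d) R c * (l2_norm \<Omega> (jac v))\<^sup>2) fun_of"
      by (rule translation_bound_mono) (intro mult_left_mono[OF grad] translate_const_nonneg R(2) c(2))
  qed simp
qed

lemma L2_component:
  fixes v :: "real^'d \<Rightarrow> real^'n"
  assumes "v \<in> L2 S"
  shows "(\<lambda>x. v x $ i) \<in> borel_measurable (lebesgue_on S)" "integrable (lebesgue_on S) (\<lambda>x. (v x $ i)\<^sup>2)"
proof -
  have [measurable]: "v \<in> borel_measurable (lebesgue_on S)" using assms by (simp add: L2_def)
  have "(\<lambda>x. v x \<bullet> axis i 1) \<in> borel_measurable (lebesgue_on S)" by measurable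
  then show [measurable]: "(\<lambda>x. v x $ i) \<in> borel_measurable (lebesgue_on S)" by (simp add: inner_axis)
  have "integrable (lebesgue_on S) (\<lambda>x. (norm (v x))\<^sup>2)" using assms by (simp add: L2_def)
  then show "integrable (lebesgue_on S) (\<lambda>x. (v x $ i)\<^sup>2)"
  proof (rule Bochner_Integration.integrable_bound)
    have "(v x $ i)\<^sup>2 \<le> (norm (v x))\<^sup>2" for x
      using component_le_norm_cart[of "v x" i] by (simp add: abs_le_square_iff[symmetric])
    then show "AE x in lebesgue_on S. norm ((v x $ i)\<^sup>2) \<le> norm ((norm (v x))\<^sup>2)" by simp
  qed measurable
qed

lemma L2_norm_sq_integral:
  fixes v :: "real^'d \<Rightarrow> real^'n"
  assumes "v \<in> L2 S"
  shows "(\<integral>x. (norm (v x))\<^sup>2 \<partial>lebesgue_on S) = (\<Sum>i\<in>UNIV. \<integral>x. (v x $ i)\<^sup>2 \<partial>lebesgue_on S)"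
proof -
  have "(norm (v x))\<^sup>2 = (\<Sum>i\<in>UNIV. (v x $ i)\<^sup>2)" for x
    unfolding power2_norm_eq_inner inner_vec_def by (simp add: power2_eq_square)
  then show ?thesis using L2_component(2)[OF assms] by simp
qed

lemma L2_diff_sq_integral:
  fixes v w :: "'a::euclidean_space \<Rightarrow> 'b::euclidean_space"
  assumes v: "v \<in> L2 S" and w: "w \<in> L2 S"
  shows "(\<integral>x. (norm (v x - w x))\<^sup>2 \<partial>lebesgue_on S)
    = (\<integral>x. (norm (v x))\<^sup>2 \<partial>lebesgue_on S) - 2 * l2_inner S v w + (\<integral>x. (norm (w x))\<^sup>2 \<partial>lebesgue_on S)"
proof -
  have [measurable]: "v \<in> borel_measurable (lebesgue_on S)" "w \<in> borel_measurable (lebesgue_on S)"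
    and i: "integrable (lebesgue_on S) (\<lambda>x. (norm (v x))\<^sup>2)" "integrable (lebesgue_on S) (\<lambda>x. (norm (w x))\<^sup>2)"
    using v w by (simp_all add: L2_def)
  have vw: "integrable (lebesgue_on S) (\<lambda>x. v x \<bullet> w x)"
  proof (rule Bochner_Integration.integrable_bound[OF Bochner_Integration.integrable_add[OF i]])
    have "\<bar>v x \<bullet> w x\<bar> \<le> (norm (v x))\<^sup>2 + (norm (w x))\<^sup>2" for x
    proof -
      have "\<bar>v x \<bullet> w x\<bar> \<le> norm (v x) * norm (w x)" by (rule Cauchy_Schwarz_ineq2)
      also have "\<dots> \<le> 2 * norm (v x) * norm (w x)" by simp
      also have "\<dots> \<le> (norm (v x))\<^sup>2 + (norm (w x))\<^sup>2" by (rule sum_squares_bound)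
      finally show ?thesis .
    qed
    then show "AE x in lebesgue_on S. norm (v x \<bullet> w x) \<le> norm ((norm (v x))\<^sup>2 + (norm (w x))\<^sup>2)" by simp
  qed measurable
  have "(norm (v x - w x))\<^sup>2 = (norm (v x))\<^sup>2 - 2 * (v x \<bullet> w x) + (norm (w x))\<^sup>2" for x
    by (simp add: power2_norm_eq_inner inner_diff inner_commute algebra_simps)
  then show ?thesis using i vw by (simp add: l2_inner_def)
qed

lemma discrete_velocity_energy:
  fixes u :: "real^'d \<Rightarrow> real^'d"
  assumes dv: "discrete_velocity \<Omega> \<mu> \<alpha> body \<T> \<phi> u" and \<phi>: "AE x in lebesgue_on \<Omega>. \<phi> x \<in> {0..1}"
    and \<alpha>: "\<And>s. s \<in> {0..1} \<Longrightarrow> \<alpha> s \<ge> 0"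
  shows "\<mu> * (l2_norm \<Omega> (jac u))\<^sup>2 \<le> l2_inner \<Omega> u body"
proof -
  have "\<mu> * l2_inner \<Omega> (jac u) (jac u) + l2_inner \<Omega> (\<lambda>x. \<alpha> (\<phi> x) *\<^sub>R u x) u = l2_inner \<Omega> body u"
    using dv by (simp add: discrete_velocity_def)
  moreover have "l2_inner \<Omega> (\<lambda>x. \<alpha> (\<phi> x) *\<^sub>R u x) u \<ge> 0"
    unfolding l2_inner_def
  proof (rule integral_nonneg_AE)
    show "AE x in lebesgue_on \<Omega>. 0 \<le> (\<alpha> (\<phi> x) *\<^sub>R u x) \<bullet> u x"
      using \<phi> by eventually_elim (simp add: \<alpha>)
  qed
  moreover have "l2_inner \<Omega> (jac u) (jac u) = (l2_norm \<Omega> (jac u))\<^sup>2"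
    by (simp add: l2_inner_def l2_norm_def power2_norm_eq_inner)
  moreover have "l2_inner \<Omega> body u = l2_inner \<Omega> u body" by (simp add: l2_inner_def inner_commute)
  ultimately show ?thesis by simp
qed

lemma adaptive_sequence_meshes:
  fixes G :: "nat \<Rightarrow> 'd::finite tagged_simplex set"
  assumes "adaptive_sequence \<Omega> \<mu> \<gamma> \<epsilon> \<beta> \<alpha> d\<alpha> f body G \<phi> u"
  shows "bisection_step\<^sup>*\<^sup>* (G 0) (G k)" "conforming_triangulation \<Omega> (elements (G k))"
proof -
  have ini: "initial_mesh \<Omega> (G 0)" and ref: "G (Suc k) \<in> refinements \<Omega> (G k)" for k
    using assms unfolding adaptive_sequence_def by blast+
  show "bisection_step\<^sup>*\<^sup>* (G 0) (G k)"
  proof (induction k)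
    case (Suc k)
    then show ?case using ref[of k] by (auto simp: refinements_def intro: rtranclp_trans)
  qed simp
  show "conforming_triangulation \<Omega> (elements (G k))"
    using ini ref by (cases k) (auto simp: initial_mesh_def refinements_def)
qed

text \<open>The test field that extracts from weak convergence the integral of component
  \<open>i\<close> over Q.\<close>

lemma L2_indicator_axis:
  assumes "\<Omega> \<in> lmeasurable" "Q \<in> sets borel"
  shows "(\<lambda>x. indicator Q x *\<^sub>R (axis i 1 :: real^'d)) \<in> L2 (\<Omega> :: (real^'d) set)"
proof -
  interpret finite_measure "lebesgue_on \<Omega>" using assms(1) by (rule finite_measure_lebesgue_on)
  have "indicat_real Q \<in> borel_measurable lebesgue"
    using assms(2) by (intro borel_measurable_indicator) simp
  then have [measurable]: "indicat_real Q \<in> borel_measurable (lebesgue_on \<Omega>)"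
    by (rule measurable_restrict_space1)
  show ?thesis
    unfolding L2_def
  proof (intro CollectI conjI)
    show "(\<lambda>x. indicator Q x *\<^sub>R (axis i 1 :: real^'d)) \<in> borel_measurable (lebesgue_on \<Omega>)" by measurable
    have "integrable (lebesgue_on \<Omega>) (indicat_real Q)"
      by (rule integrable_const_bound[of _ 1]) (auto simp: indicator_def)
    moreover have "(\<lambda>x. (norm (indicat_real Q x *\<^sub>R (axis i 1 :: real^'d)))\<^sup>2) = indicat_real Q"
      by (auto simp: fun_eq_iff indicator_def)
    ultimately show "integrable (lebesgue_on \<Omega>) (\<lambda>x. (norm (indicat_real Q x *\<^sub>R (axis i 1 :: real^'d)))\<^sup>2)"
      by (simp only:)
  qed
qed

theorem lemma3p5:
  fixes \<Omega> :: "(real^'d::finite) set"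
    and \<mu> \<gamma> \<epsilon> \<beta> \<alpha>bar :: real
    and \<alpha> d\<alpha> f :: "real \<Rightarrow> real"
    and body :: "real^'d \<Rightarrow> real^'d"
    and G :: "nat \<Rightarrow> 'd tagged_simplex set"
    and \<phi> :: "nat \<Rightarrow> real^'d \<Rightarrow> real"
    and u :: "nat \<Rightarrow> real^'d \<Rightarrow> real^'d"
    and r :: "nat \<Rightarrow> nat"
    and ubar :: "real^'d \<Rightarrow> real^'d"
    and Dubar :: "real^'d \<Rightarrow> real^'d^'d"
  assumes "CARD('d) \<in> {2, 3}"
    and "polyhedral_domain \<Omega>"
    and "\<mu> > 0" and "\<gamma> > 0" and "\<epsilon> > 0"
    and "0 < \<beta>" and "\<beta> < 1"
    and "body \<in> L2 \<Omega>"
    and "\<alpha>bar > 0" and "\<And>s. s \<in> {0..1} \<Longrightarrow> \<alpha> s \<in> {0..\<alpha>bar}"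
    and "\<And>s. s \<in> {0..1} \<Longrightarrow> (\<alpha> has_real_derivative d\<alpha> s) (at s within {0..1})"
    and "continuous_on {0..1} d\<alpha>"
    and "f = (\<lambda>s. 1/2 * s * (1 - s)) \<or> f = (\<lambda>s. 1/4 * s\<^sup>2 * (1 - s)\<^sup>2)"
    and "adaptive_sequence \<Omega> \<mu> \<gamma> \<epsilon> \<beta> \<alpha> d\<alpha> f body G \<phi> u"
    and "strict_mono r"
    and "ubar \<in> V_space \<Omega>" and "weak_jacobian \<Omega> ubar Dubar"
    and "l2_weakly_converges \<Omega> (\<lambda>j. u (r j)) ubar"
    and "l2_weakly_converges \<Omega> (\<lambda>j. jac (u (r j))) Dubar"
  shows "(\<lambda>j. l2_norm \<Omega> (\<lambda>x. u (r j) x - ubar x)) \<longlonglongrightarrow> 0"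
proof -
  note d = assms(1) and adaptive = assms(14)
  have \<Omega>: "open \<Omega>" "bounded \<Omega>" using assms(2) by (auto simp: polyhedral_domain_def)
  have \<Omega>m: "\<Omega> \<in> lmeasurable" "\<Omega> \<in> sets lebesgue" using \<Omega> by (auto simp: lmeasurable_open)
  \<comment> \<open>As a null set, the frontier makes \<Omega> and the union of the elements
    interchangeable under integrals.\<close>
  have front: "negligible (frontier \<Omega>)"
  proof -
    obtain P where P: "finite P" "\<And>p. p \<in> P \<Longrightarrow> aff_dim p = int CARD('d) - 1" "frontier \<Omega> = \<Union>P"
      using assms(2) unfolding polyhedral_domain_def by blast
    have "negligible p" if "p \<in> P" for p
      using P(2)[OF that] by (intro negligible_aff_dim_less) simp
    then show ?thesis unfolding P(3) using P(1) by (rule negligible_Union[rotated])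
  qed
  obtain R where R: "closure \<Omega> \<subseteq> cball 0 R" "R \<ge> 0"
  proof -
    obtain B where "\<And>x. x \<in> closure \<Omega> \<Longrightarrow> norm x \<le> B"
      using bounded_closure[OF \<Omega>(2)] by (auto simp: bounded_iff)
    then have "closure \<Omega> \<subseteq> cball 0 (max B 0)" by fastforce
    then show ?thesis by (rule that) simp
  qed
  have "initial_mesh \<Omega> (G 0)" using adaptive by (simp add: adaptive_sequence_def)
  from shape_regular_refinements[OF d this] obtain c where c: "c > 0"
    "\<And>G' T. bisection_step\<^sup>*\<^sup>* (G 0) G' \<Longrightarrow> T \<in> elements G' \<Longrightarrow> diameter T ^ CARD('d) \<le> c * measure lebesgue T"
    by blast
  note weak = assms(18)[unfolded l2_weakly_converges_def]
  have uL: "u (r j) \<in> L2 \<Omega>" and ubarL: "ubar \<in> L2 \<Omega>" for j using weak by auto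
  have jL: "jac (u (r j)) \<in> L2 \<Omega>" for j using assms(19) by (simp add: l2_weakly_converges_def)
  have pair: "discrete_minimizing_pair \<Omega> \<mu> \<gamma> \<epsilon> \<beta> \<alpha> f body (elements (G k)) (\<phi> k) (u k)" for k
    using adaptive unfolding adaptive_sequence_def by blast
  have dv: "discrete_velocity \<Omega> \<mu> \<alpha> body (elements (G k)) (\<phi> k) (u k)"
    and \<phi>01: "AE x in lebesgue_on \<Omega>. \<phi> k x \<in> {0..1}" for k
    using pair[of k] by (auto simp: discrete_minimizing_pair_def Uk_space_def U_space_def)
  have CR: "u k \<in> CR_space \<Omega> (elements (G k))" for k
    using dv[of k] by (simp add: discrete_velocity_def Vk_space_def)
  \<comment> \<open>A convergent real sequence is bounded; by the energy inequality this bounds the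
    gradients without an appeal to the uniform boundedness principle.\<close>
  have "convergent (\<lambda>j. l2_inner \<Omega> (u (r j)) body)"
    using weak assms(8) by (auto simp: convergent_def)
  then have "Bseq (\<lambda>j. l2_inner \<Omega> (u (r j)) body)" by (rule convergent_imp_Bseq)
  then obtain M where M: "\<And>j. \<bar>l2_inner \<Omega> (u (r j)) body\<bar> \<le> M" by (auto simp: Bseq_def)
  have jac_bound: "(l2_norm \<Omega> (jac (u (r j))))\<^sup>2 \<le> M / \<mu>" for j
  proof -
    have "\<mu> * (l2_norm \<Omega> (jac (u (r j))))\<^sup>2 \<le> l2_inner \<Omega> (u (r j)) body"
      using assms(10) by (intro discrete_velocity_energy[OF dv \<phi>01]) auto
    also have "\<dots> \<le> M" using M[of j] by linarith
    finally show ?thesis using assms(3) by (simp add: pos_le_divide_eq mult.commute)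
  qed
  define K where "K = translate_const CARD('d) R c * (M / \<mu>)"
  have tc: "translate_const CARD('d) R c \<ge> 0" using R(2) c(1) by (intro translate_const_nonneg) auto
  have K0: "K \<ge> 0"
    unfolding K_def using tc order_trans[OF zero_le_power2 jac_bound] by (rule mult_nonneg_nonneg)
  have comp: "\<forall>\<^sub>F j in sequentially. (\<integral>x. (u (r j) x $ i)\<^sup>2 \<partial>lebesgue_on \<Omega>)
      \<le> (\<integral>x. (ubar x $ i)\<^sup>2 \<partial>lebesgue_on \<Omega>) + \<eta>" if \<eta>: "\<eta> > 0" for i \<eta>
  proof -
    \<comment> \<open>One predicate for all properties, so that the representatives for all j can be
      chosen at once.\<close>
    define P where "P j w \<longleftrightarrow> w \<in> borel_measurable borel \<and> integrable lborel (\<lambda>x. (w x)\<^sup>2) \<and>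
      (AE x in lebesgue. w x = indicator \<Omega> x * (u (r j) x $ i)) \<and> (\<forall>x. w x \<noteq> 0 \<longrightarrow> x \<in> cball 0 R) \<and>
      translation_bound (translate_const CARD('d) R c * (l2_norm \<Omega> (jac (u (r j))))\<^sup>2) w" for j w
    have "\<exists>w. P j w" for j
      unfolding P_def
    proof (rule CR_component_translate[OF adaptive_sequence_meshes(2)[OF adaptive] \<Omega>(1) front R _ _ CR jL])
      show "diameter T ^ CARD('d) \<le> c * measure lebesgue T" if "T \<in> elements (G (r j))" for T
        using c(2)[OF adaptive_sequence_meshes(1)[OF adaptive] that] .
    qed (use c(1) in simp)
    then have "\<exists>w. \<forall>j. P j (w j)" by (intro choice allI)
    then obtain w where "\<And>j. P j (w j)" by blast
    then have w: "\<And>j. w j \<in> borel_measurable borel" "\<And>j. integrable lborel (\<lambda>x. (w j x)\<^sup>2)"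
      "\<And>j. AE x in lebesgue. w j x = indicator \<Omega> x * (u (r j) x $ i)" "\<And>j x. w j x \<noteq> 0 \<Longrightarrow> x \<in> cball 0 R"
      "\<And>j. translation_bound (translate_const CARD('d) R c * (l2_norm \<Omega> (jac (u (r j))))\<^sup>2) (w j)"
      unfolding P_def by blast+
    have tr: "translation_bound K (w j)" for j
      using w(5) unfolding K_def by (rule translation_bound_mono) (intro mult_left_mono[OF jac_bound tc])
    \<comment> \<open>The zero extension of a component of the limit is only Lebesgue measurable;
      \<open>v\<close> is a Borel representative of it.\<close>
    have "(\<lambda>x. indicator \<Omega> x *\<^sub>R (ubar x $ i)) \<in> borel_measurable lebesgue"
      using L2_component(1)[OF ubarL] \<Omega>m by (simp add: borel_measurable_restrict_space_iff)
    then obtain v where v: "v \<in> borel_measurable lborel" "AE x in lborel. indicator \<Omega> x *\<^sub>R (ubar x $ i) = v x"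
      using completion_ex_borel_measurable_real by blast
    then have vb: "v \<in> borel_measurable borel" and vae: "AE x in lebesgue. v x = indicator \<Omega> x * (ubar x $ i)"
      by (auto simp: AE_completion_iff elim!: eventually_mono)
    have sq: "(LINT x|lborel. (g x)\<^sup>2) = (\<integral>x. (h x $ i)\<^sup>2 \<partial>lebesgue_on \<Omega>)"
      if "g \<in> borel_measurable borel" "h \<in> L2 \<Omega>" "AE x in lebesgue. g x = indicator \<Omega> x * (h x $ i)"
      for g and h :: "real^'d \<Rightarrow> real^'d"
      using that L2_component(1)[OF that(2), of i] \<Omega>m(2)
      by (intro integral_lborel_eq_lebesgue_on) (auto elim!: eventually_mono simp: power_mult_distrib indicator_def)
    have mean: "(LINT x:Q|lborel. g x) = l2_inner \<Omega> h (\<lambda>x. indicator Q x *\<^sub>R axis i 1)"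
      if "g \<in> borel_measurable borel" "h \<in> L2 \<Omega>" "AE x in lebesgue. g x = indicator \<Omega> x * (h x $ i)" "Q \<in> sets borel"
      for g Q and h :: "real^'d \<Rightarrow> real^'d"
    proof -
      have "indicat_real Q \<in> borel_measurable lebesgue"
        using that(4) by (intro borel_measurable_indicator) simp
      then have [measurable]: "indicat_real Q \<in> borel_measurable (lebesgue_on \<Omega>)"
        by (rule measurable_restrict_space1)
      have [measurable]: "(\<lambda>x. h x $ i) \<in> borel_measurable (lebesgue_on \<Omega>)" by (rule L2_component(1)[OF that(2)])
      have "(LINT x:Q|lborel. g x) = (\<integral>x. indicator Q x * (h x $ i) \<partial>lebesgue_on \<Omega>)"
        unfolding set_lebesgue_integral_def using that \<Omega>m(2)
        by (intro integral_lborel_eq_lebesgue_on) (auto elim!: eventually_mono)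
      then show ?thesis by (simp add: l2_inner_def inner_axis)
    qed
    have v2: "integrable lborel (\<lambda>x. (v x)\<^sup>2)"
    proof -
      have "integrable lebesgue (\<lambda>x. indicator \<Omega> x *\<^sub>R (ubar x $ i)\<^sup>2)"
        using L2_component(2)[OF ubarL] \<Omega>m by (simp add: integrable_restrict_space)
      moreover have "AE x in lebesgue. indicator \<Omega> x *\<^sub>R (ubar x $ i)\<^sup>2 = (v x)\<^sup>2"
        using vae by eventually_elim (simp add: power_mult_distrib indicator_def)
      ultimately have "integrable lebesgue (\<lambda>x. (v x)\<^sup>2)"
        using vb by (subst integrable_cong_AE[symmetric]) (auto intro: measurable_completion)
      then show ?thesis using vb by (subst (asm) integrable_completion) auto
    qed
    have "(\<lambda>j. LINT x:Q|lborel. w j x) \<longlonglongrightarrow> (LINT x:Q|lborel. v x)" if Q: "Q \<in> sets borel" for Q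
      unfolding mean[OF w(1) uL w(3) Q] mean[OF vb ubarL vae Q]
      using weak L2_indicator_axis[OF \<Omega>m(1) Q] by blast
    then have "\<forall>\<^sub>F j in sequentially. (LINT x|lborel. (w j x)\<^sup>2) \<le> (LINT x|lborel. (v x)\<^sup>2) + \<eta>"
      using \<eta> by (intro sq_integral_limsup_le[OF w(1,2,4) K0 tr vb v2]) auto
    then show ?thesis unfolding sq[OF w(1) uL w(3)] sq[OF vb ubarL vae] .
  qed
  let ?N = "\<lambda>v. \<integral>x. (norm (v x))\<^sup>2 \<partial>lebesgue_on \<Omega>"
  \<comment> \<open>\<eta> is distributed evenly over the d components.\<close>
  have N: "\<forall>\<^sub>F j in sequentially. ?N (u (r j)) \<le> ?N ubar + \<eta>" if "\<eta> > 0" for \<eta>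
  proof -
    have "\<forall>\<^sub>F j in sequentially. \<forall>i. (\<integral>x. (u (r j) x $ i)\<^sup>2 \<partial>lebesgue_on \<Omega>)
      \<le> (\<integral>x. (ubar x $ i)\<^sup>2 \<partial>lebesgue_on \<Omega>) + \<eta> / CARD('d)"
      using that by (intro eventually_all_finite comp) simp
    then show ?thesis
    proof eventually_elim
      case (elim j)
      have "?N (u (r j)) \<le> (\<Sum>i\<in>(UNIV::'d set). (\<integral>x. (ubar x $ i)\<^sup>2 \<partial>lebesgue_on \<Omega>) + \<eta> / CARD('d))"
        unfolding L2_norm_sq_integral[OF uL] by (intro sum_mono) (use elim in blast)
      then show ?case by (simp add: L2_norm_sq_integral[OF ubarL] sum.distrib)
    qed
  qed
  have ip: "(\<lambda>j. l2_inner \<Omega> (u (r j)) ubar) \<longlonglongrightarrow> ?N ubar"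
  proof -
    have "l2_inner \<Omega> ubar ubar = ?N ubar" by (simp add: l2_inner_def power2_norm_eq_inner)
    moreover have "(\<lambda>j. l2_inner \<Omega> (u (r j)) ubar) \<longlonglongrightarrow> l2_inner \<Omega> ubar ubar"
      using weak ubarL by blast
    ultimately show ?thesis by simp
  qed
  have "(\<lambda>j. ?N (\<lambda>x. u (r j) x - ubar x)) \<longlonglongrightarrow> 0"
  proof (rule LIMSEQ_I)
    \<comment> \<open>With N the squared norm of the limit, the expanded square is less than (N +
      e/4) - 2 (N - e/4) + N = 3 e/4.\<close>
    fix e :: real assume e: "e > 0"
    have "\<forall>\<^sub>F j in sequentially. ?N (u (r j)) \<le> ?N ubar + e / 4" using e by (intro N) simp
    moreover have "\<forall>\<^sub>F j in sequentially. l2_inner \<Omega> (u (r j)) ubar > ?N ubar - e / 4"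
      using e by (intro order_tendstoD(1)[OF ip]) simp
    ultimately have "\<forall>\<^sub>F j in sequentially. norm (?N (\<lambda>x. u (r j) x - ubar x) - 0) < e"
    proof eventually_elim
      case (elim j)
      have "?N (\<lambda>x. u (r j) x - ubar x) \<ge> 0" by (intro integral_nonneg_AE) simp
      then show ?case using elim e unfolding L2_diff_sq_integral[OF uL ubarL] by simp
    qed
    then show "\<exists>no. \<forall>n\<ge>no. norm (?N (\<lambda>x. u (r n) x - ubar x) - 0) < e"
      by (simp add: eventually_sequentially)
  qed
  from tendsto_real_sqrt[OF this] show ?thesis by (simp add: l2_norm_def)
qed

end
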